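(* Two compositions $\beta$ and $\gamma$ satisfy $\beta\sim\gamma$ if and only if for some $k\ge 1$ there are compositions $\beta_1,\dots,\beta_k,\gamma_1,\dots,\gamma_k$ such that $$\beta=\beta_1\circ\beta_2\circ\cdots\circ\beta_k\quad\text{and}\quad\gamma=\gamma_1\circ\gamma_2\circ\cdots\circ\gamma_k,$$ where, for each $i$, either $\gamma_i=\beta_i$ or $\gamma_i=\beta_i^\ast$. Thus the equivalence class of a composition $\beta$ under $\sim$ contains exactly $2^r$ elements, where $r$ is the number of nonsymmetric irreducible factors (i.e. factors $\alpha_i$ with $\alpha_i\neq\alpha_i^\ast$, counted with multiplicity) in the irreducible factorization of $\beta$.
   Context: A composition $\beta\vDash n$ is a finite list $\beta_1\beta_2\cdots\beta_k$ of positive integers with sum $n$; $l(\beta)=k$, $|\beta|=n$. Its reversal is $\beta^\ast=\beta_k\cdots\beta_2\beta_1$. A composition $\alpha$ is a coarsening of $\gamma$, written $\alpha\ge\gamma$, if $\alpha$ is obtained from $\gamma$ by adding together adjacent components (possibly none). Quasisymmetric functions: $M_\beta=\sum_{i_1<\cdots<i_k}x_{i_1}^{\beta_1}\cdots x_{i_k}^{\beta_k}$ and $F_\beta=\sum_{\gamma\le\beta}M_\gamma$ (sum over all refinements $\gamma$ of $\beta$), $F_0=1$. The $F_\beta$ form a basis of the algebra $\mathcal{Q}$ of quasisymmetric functions over $\mathbb{Q}$, which contains the algebra $\Lambda$ of symmetric functions. Compositions $\beta,\gamma$ are equivalent, $\beta\sim\gamma$, if for all $F=\sum_\alpha c_\alpha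 F_\alpha\in\Lambda$ one has $c_\beta=c_\gamma$. For $\alpha=\alpha_1\cdots\alpha_k$ and $\beta=\beta_1\cdots\beta_l$ define concatenation $\alpha\cdot\beta=\alpha_1\cdots\alpha_k\beta_1\cdots\beta_l$, near concatenation $\alpha\odot\beta=\alpha_1\cdots\alpha_{k-1}(\alpha_k+\beta_1)\beta_2\cdots\beta_l$, $\beta^{\odot n}=\beta\odot\cdots\odot\beta$ ($n$ factors), and $\alpha\circ\beta=\beta^{\odot\alpha_1}\cdot\beta^{\odot\alpha_2}\cdots\beta^{\odot\alpha_k}$. The operation $\circ$ is associative. A factorization $\alpha=\beta\circ\gamma$ is trivial if (1) one of $\beta,\gamma$ is the composition $1$, or (2) $\beta$ and $\gamma$ both have length 1, or (3) $\beta$ and $\gamma$ both have all components equal to $1$. A factorization $\alpha=\alpha_1\circ\cdots\circ\alpha_k$ is irreducible if no $\alpha_i\circ\alpha_{i+1}$ is a trivial factorization and each $\alpha_i$ admits only trivial factorizations; the $\alpha_i$ are then called irreducible factors. Every composition has a unique irreducible factorization. *)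

theory Defs
  imports Complex_Main "HOL-Library.Poly_Mapping"
begin

section \<open>Compositions\<close>

text \<open>The empty list is the composition of 0; it is needed only to index F_0 = 1.\<close>

definition composition :: "nat list \<Rightarrow> bool" where
  "composition \<beta> \<longleftrightarrow> 0 \<notin> set \<beta>"

definition pos_composition :: "nat list \<Rightarrow> bool" where
  "pos_composition \<beta> \<longleftrightarrow> composition \<beta> \<and> \<beta> \<noteq> []"

text \<open>\<open>coarsening \<alpha> \<gamma>\<close> means \<open>\<alpha> \<ge> \<gamma>\<close>: cut \<open>\<gamma>\<close> into nonempty consecutive blocks and add up
  each block.\<close>

definition coarsening :: "nat list \<Rightarrow> nat list \<Rightarrow> bool" where
  "coarsening \<alpha> \<gamma> \<longleftrightarrow> (\<exists>bs. [] \<notin> set bs \<and> concat bs = \<gamma> \<and> map sum_list bs = \<alpha>)"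

section \<open>Quasisymmetric and symmetric functions\<close>

text \<open>Formal power series over the rationals in the variables \<open>x\<^sub>0, x\<^sub>1, \<dots>\<close>, given by their
  coefficients; a monomial is its finitely supported exponent function.\<close>

type_synonym monomial = "nat \<Rightarrow>\<^sub>0 nat"
type_synonym series = "monomial \<Rightarrow> rat"

definition mono_deg :: "monomial \<Rightarrow> nat" where
  "mono_deg m = (\<Sum>i\<in>Poly_Mapping.keys m. Poly_Mapping.lookup m i)"

text \<open>The coefficient of \<open>m\<close> in \<open>M\<^sub>\<beta>\<close> counts the index sequences \<open>i\<^sub>1 < \<dots> < i\<^sub>k\<close> whose
  summand equals \<open>m\<close>.\<close>

definition M :: "nat list \<Rightarrow> series" where
  "M \<beta> m = of_nat (card {is. length is = length \<beta> \<and> sorted_wrt (<) is \<and>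
     m = (\<Sum>j<length \<beta>. Poly_Mapping.single (is ! j) (\<beta> ! j))})"

definition F :: "nat list \<Rightarrow> series" where
  "F \<beta> m = (\<Sum>\<gamma> | composition \<gamma> \<and> coarsening \<beta> \<gamma>. M \<gamma> m)"

text \<open>Symmetric functions: series of bounded degree invariant under every permutation of the
  variables.\<close>

definition symmetric_functions :: "series set" where
  "symmetric_functions = {f.
     (\<exists>d. \<forall>m. f m \<noteq> 0 \<longrightarrow> mono_deg m \<le> d) \<and>
     (\<forall>\<pi> m. bij \<pi> \<longrightarrow> f (Poly_Mapping.map_key \<pi> m) = f m)}"

definition F_combination :: "(nat list \<Rightarrow>\<^sub>0 rat) \<Rightarrow> series" where
  "F_combination c m =
     (\<Sum>\<alpha>\<in>Poly_Mapping.keys c. Poly_Mapping.lookup c \<alpha> * F \<alpha> m)"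

definition comp_equiv :: "nat list \<Rightarrow> nat list \<Rightarrow> bool"  (infix "\<sim>\<^sub>c" 50) where
  "\<beta> \<sim>\<^sub>c \<gamma> \<longleftrightarrow>
     (\<forall>c. (\<forall>\<alpha>\<in>Poly_Mapping.keys c. composition \<alpha>) \<and> F_combination c \<in> symmetric_functions
        \<longrightarrow> Poly_Mapping.lookup c \<beta> = Poly_Mapping.lookup c \<gamma>)"

section \<open>The operation \<open>\<circ>\<close> and factorizations\<close>

text \<open>The operations below are meaningful for nonempty compositions (and exponents \<open>n \<ge> 1\<close>).\<close>

definition near_concat :: "nat list \<Rightarrow> nat list \<Rightarrow> nat list"  (infixr "\<odot>\<^sub>c" 65) where
  "\<alpha> \<odot>\<^sub>c \<beta> = butlast \<alpha> @ [last \<alpha> + hd \<beta>] @ tl \<beta>"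

fun near_power :: "nat list \<Rightarrow> nat \<Rightarrow> nat list" where
  "near_power \<beta> 0 = []"
| "near_power \<beta> (Suc 0) = \<beta>"
| "near_power \<beta> (Suc (Suc n)) = \<beta> \<odot>\<^sub>c near_power \<beta> (Suc n)"

definition comp_circ :: "nat list \<Rightarrow> nat list \<Rightarrow> nat list"  (infixr "\<circ>\<^sub>c" 70) where
  "\<alpha> \<circ>\<^sub>c \<beta> = concat (map (near_power \<beta>) \<alpha>)"

text \<open>\<open>circ_list [\<alpha>\<^sub>1, \<dots>, \<alpha>\<^sub>k] = \<alpha>\<^sub>1 \<circ> \<dots> \<circ> \<alpha>\<^sub>k\<close> for \<open>k \<ge> 1\<close>; the value at \<open>[]\<close> is the unit of \<open>\<circ>\<close>.\<close>

fun circ_list :: "nat list list \<Rightarrow> nat list" where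
  "circ_list [] = [1]"
| "circ_list [\<alpha>] = \<alpha>"
| "circ_list (\<alpha> # \<beta> # \<alpha>s) = \<alpha> \<circ>\<^sub>c circ_list (\<beta> # \<alpha>s)"

text \<open>\<open>trivial_pair \<beta> \<gamma>\<close>: the factorization \<open>\<beta> \<circ> \<gamma>\<close> is trivial.\<close>

definition trivial_pair :: "nat list \<Rightarrow> nat list \<Rightarrow> bool" where
  "trivial_pair \<beta> \<gamma> \<longleftrightarrow>
     (\<beta> = [1] \<or> \<gamma> = [1]) \<or>
     (length \<beta> = 1 \<and> length \<gamma> = 1) \<or>
     ((\<forall>x\<in>set \<beta>. x = 1) \<and> (\<forall>x\<in>set \<gamma>. x = 1))"

definition only_trivial_factorizations :: "nat list \<Rightarrow> bool" where
  "only_trivial_factorizations \<alpha> \<longleftrightarrow>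
     (\<forall>\<beta> \<gamma>. pos_composition \<beta> \<and> pos_composition \<gamma> \<and> \<alpha> = \<beta> \<circ>\<^sub>c \<gamma> \<longrightarrow> trivial_pair \<beta> \<gamma>)"

definition is_irreducible_factorization :: "nat list list \<Rightarrow> nat list \<Rightarrow> bool" where
  "is_irreducible_factorization \<alpha>s \<alpha> \<longleftrightarrow>
     \<alpha>s \<noteq> [] \<and> (\<forall>\<beta>\<in>set \<alpha>s. pos_composition \<beta>) \<and> \<alpha> = circ_list \<alpha>s \<and>
     (\<forall>i. Suc i < length \<alpha>s \<longrightarrow> \<not> trivial_pair (\<alpha>s ! i) (\<alpha>s ! Suc i)) \<and>
     (\<forall>\<beta>\<in>set \<alpha>s. only_trivial_factorizations \<beta>)"

text \<open>Well defined because every nonempty composition has exactly one irreducible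
  factorization.\<close>

definition irreducible_factorization :: "nat list \<Rightarrow> nat list list" where
  "irreducible_factorization \<alpha> = (THE \<alpha>s. is_irreducible_factorization \<alpha>s \<alpha>)"

definition num_nonsymmetric_factors :: "nat list \<Rightarrow> nat" where
  "num_nonsymmetric_factors \<alpha> =
     length (filter (\<lambda>\<beta>. \<beta> \<noteq> rev \<beta>) (irreducible_factorization \<alpha>))"

end

theory Submission
  imports Defs "HOL-Combinatorics.Permutations"
begin

text \<open>A composition \<open>\<beta>\<close> of \<open>n\<close> is the same thing as its set of proper partial sums, a subset of
\<open>{1, \<dots>, n - 1}\<close>. Let \<open>\<chi>\<close> be the indicator function of that set, extended to the integers with
period \<open>n\<close> and with \<open>\<chi> 0 = 0\<close>. Reversal is \<open>x \<mapsto> - x\<close>, coarsening is passing to a subset, and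
\<open>\<beta> = \<sigma> \<circ> \<tau>\<close> with \<open>\<tau>\<close> of size \<open>m\<close> says that \<open>\<chi>\<close> has period \<open>m\<close> away from the multiples of \<open>m\<close>:
there it is the function of \<open>\<tau>\<close>, and on the multiples of \<open>m\<close> it is the function of \<open>\<sigma>\<close>.

\<^bold>\<open>From series to multisets.\<close> The coefficient of \<open>F\<^sub>\<beta>\<close> in a series is the alternating sum over the
coarsenings of \<open>\<beta>\<close> of its coefficients in the basis of the \<open>M\<^sub>\<alpha>\<close> (Moebius inversion), and the series
is symmetric iff the latter depend only on the multiset of parts of \<open>\<alpha>\<close>. Hence \<open>\<beta> \<sim> \<gamma>\<close> iff \<open>\<beta>\<close> and
\<open>\<gamma>\<close> have the same multiset of shapes (sorted parts) of coarsenings: \<open>comp_equiv_iff_coarsening_shapes\<close>.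

\<^bold>\<open>Reversing factors preserves the class.\<close> Attach to \<open>\<beta>\<close> the polynomial summing the monomials of all
its coarsenings. It satisfies \<open>p(\<alpha> \<cdot> \<beta>) = p(\<alpha>) p(\<beta>) + p(\<alpha> \<odot> \<beta>)\<close>, so that
\<open>p(\<sigma> \<circ> \<tau>)\<close> arises from \<open>p(\<sigma>)\<close> by substituting for the \<open>j\<close>-th variable the polynomial of
the \<open>j\<close>-th near power of \<open>\<tau>\<close>. Thus \<open>\<sigma> \<sim> \<sigma>'\<close> implies \<open>\<sigma> \<circ> \<tau> \<sim> \<sigma>' \<circ> \<tau>\<close>; as \<open>\<sim>\<close> is invariant under
reversal, all prefixes of a factorization may be reversed, and these generate all choices.

\<^bold>\<open>Equivalent compositions differ by reversing factors.\<close> Write \<open>\<chi> = (u + v) / 2\<close> with \<open>u\<close> even and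
\<open>v\<close> odd; let \<open>u'\<close> and \<open>v'\<close> belong to \<open>\<gamma>\<close>. Coarsenings with two parts give \<open>u' = u\<close>, hence
\<open>v' = v\<close> or \<open>v' = - v\<close> at every point. Let \<open>P\<close> and \<open>Q\<close> be the sets where \<open>v' = v \<noteq> 0\<close> and
\<open>v' = - v \<noteq> 0\<close>. Coarsenings with three parts give the absorption law: for \<open>p \<in> P\<close> and \<open>q \<in> Q\<close>
the sum \<open>p + q\<close> lies in \<open>P\<close> and has the value \<open>v\<close> of \<open>p\<close>, or lies in \<open>Q\<close> and has the value of \<open>q\<close>.
From this alone, if neither set is empty, one of them is not contained in the subgroup generated by
the other and \<open>n\<close> (\<open>not_mutually_generated\<close>); replacing \<open>\<gamma>\<close> by its reversal, let it be \<open>P\<close>, and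
let \<open>h\<close> generate the subgroup of \<open>Q\<close> and \<open>n\<close>. Off the multiples of \<open>h\<close> we have \<open>\<chi>' = \<chi>\<close>,
and \<open>v\<close> has period \<open>h\<close> there. The even part \<open>u\<close> need not have period \<open>h\<close>, but longer coarsenings
show that the failures can be absorbed: if \<open>b\<close> witnesses that \<open>u\<close> does not have some period \<open>k\<close> that
was reached before, then \<open>b\<close> is itself a period of \<open>v\<close>, and the coarsening identities known for \<open>k\<close>
are inherited by \<open>b\<close>. Adjoining all such \<open>b\<close>, again and again, ends with a proper divisor \<open>d > 1\<close> of
\<open>n\<close> such that \<open>\<chi>\<close> has period \<open>d\<close> off the multiples of \<open>d\<close> (\<open>periodic_off_exists\<close>). Then
\<open>\<beta> = \<sigma> \<circ> \<tau>\<close> and \<open>\<gamma> = \<sigma>' \<circ> \<tau>\<close> with \<open>\<sigma>\<close> and \<open>\<sigma>'\<close> subject to the same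
identities, and induction on the size applies (\<open>rev_choice_of_same_path_sums\<close>).

\<^bold>\<open>Counting.\<close> The divisors \<open>m\<close> of \<open>n\<close> for which \<open>\<chi>\<close> has period \<open>m\<close> off the multiples of \<open>m\<close> are
closed under gcd and lcm, and between two incomparable ones \<open>\<chi>\<close> is constant. This makes the first
factor of an irreducible factorization unique (\<open>first_cut_unique\<close>), hence the whole factorization.
Any factorization can be refined to the irreducible one, merging only symmetric factors,
so every member of the class is obtained by reversing irreducible factors, and different outcomes on
the nonsymmetric factors give different compositions by uniqueness.\<close>

section \<open>Compositions as sets of partial sums\<close>

definition partial_sums :: "nat list \<Rightarrow> nat set" where
  "partial_sums \<alpha> = (\<lambda>i. sum_list (take i \<alpha>)) ` {0<..<length \<alpha>}"

lemma partial_sums_Nil [simp]: "partial_sums [] = {}"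
  and partial_sums_single [simp]: "partial_sums [x] = {}"
  by (auto simp: partial_sums_def)

lemma partial_sums_empty_iff: "partial_sums \<alpha> = {} \<longleftrightarrow> length \<alpha> \<le> 1"
proof -
  have "{0<..<length \<alpha>} = {} \<longleftrightarrow> length \<alpha> \<le> 1"
    by (cases "length \<alpha> \<le> 1") (auto simp: not_le)
  then show ?thesis by (simp add: partial_sums_def)
qed

lemma partial_sums_append:
  assumes "xs \<noteq> []" "ys \<noteq> []"
  shows "partial_sums (xs @ ys) =
    partial_sums xs \<union> {sum_list xs} \<union> (+) (sum_list xs) ` partial_sums ys"
proof -
  have split: "{0<..<length (xs @ ys)} =
      {0<..<length xs} \<union> {length xs} \<union> (+) (length xs) ` {0<..<length ys}"
  proof -
    have "x \<in> (+) (length xs) ` {0<..<length ys}"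
      if "length xs < x" "x < length xs + length ys" for x
      using that by (intro image_eqI[of _ _ "x - length xs"]) auto
    then show ?thesis
      using assms by (auto simp: nat_neq_iff)
  qed
  show ?thesis
    unfolding partial_sums_def split image_Un image_image
    by (intro arg_cong2[of _ _ _ _ "(\<union>)"]) (auto intro!: image_cong)
qed

lemma partial_sums_Cons:
  "xs \<noteq> [] \<Longrightarrow> partial_sums (x # xs) = insert x ((+) x ` partial_sums xs)"
  using partial_sums_append[of "[x]" xs] by simp

text \<open>Adding \<open>x\<close> to the first part translates all partial sums, with or without a break after \<open>x\<close>;
this is how near concatenation and merging of parts enter below.\<close>

lemma partial_sums_merge: "partial_sums ((x + y) # ys) = (+) x ` partial_sums (y # ys)"
  by (cases "ys = []") (auto simp: partial_sums_Cons image_image add.assoc)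

lemma pos_compositionD:
  assumes "pos_composition \<alpha>" shows "\<alpha> \<noteq> []" "composition \<alpha>" "sum_list \<alpha> > 0"
  using assms by (cases \<alpha>; auto simp: pos_composition_def composition_def)+

lemma pos_composition_append:
  "pos_composition \<alpha> \<Longrightarrow> pos_composition \<beta> \<Longrightarrow> pos_composition (\<alpha> @ \<beta>)"
  by (auto simp: pos_composition_def composition_def)

lemma composition_simps [simp]:
  "composition []" "composition (x # xs) \<longleftrightarrow> x > 0 \<and> composition xs"
  "composition (xs @ ys) \<longleftrightarrow> composition xs \<and> composition ys"
  "composition (rev xs) \<longleftrightarrow> composition xs"
  by (auto simp: composition_def)

lemma composition_sum_pos: "composition \<alpha> \<Longrightarrow> \<alpha> \<noteq> [] \<Longrightarrow> sum_list \<alpha> > 0"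
  by (cases \<alpha>) auto

lemma partial_sums_bounds:
  assumes "composition \<alpha>" shows "partial_sums \<alpha> \<subseteq> {0<..<sum_list \<alpha>}"
proof
  fix s assume "s \<in> partial_sums \<alpha>"
  then obtain i where i: "0 < i" "i < length \<alpha>" "s = sum_list (take i \<alpha>)"
    by (auto simp: partial_sums_def)
  have "sum_list \<alpha> = sum_list (take i \<alpha>) + sum_list (drop i \<alpha>)"
    by (metis append_take_drop_id sum_list_append)
  moreover have "composition (take i \<alpha>)" "composition (drop i \<alpha>)"
    using assms by (metis append_take_drop_id composition_simps(3))+
  ultimately show "s \<in> {0<..<sum_list \<alpha>}"
    using i composition_sum_pos[of "take i \<alpha>"] composition_sum_pos[of "drop i \<alpha>"] by force
qed

text \<open>The first part is the least partial sum, and subtracting it leaves the partial sums of the tail.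
Most identities between compositions below are reduced to sizes and partial sums by this lemma.\<close>

lemma composition_eqI:
  assumes "composition \<alpha>" "composition \<beta>" "sum_list \<alpha> = sum_list \<beta>"
    "partial_sums \<alpha> = partial_sums \<beta>"
  shows "\<alpha> = \<beta>"
  using assms
proof (induction \<alpha> arbitrary: \<beta>)
  case Nil
  from Nil.prems(2,3) show ?case by (cases \<beta>) auto
next
  case (Cons x xs)
  from Cons.prems(1,3) obtain y ys where \<beta>: "\<beta> = y # ys"
    by (cases \<beta>) auto
  show ?case
  proof (cases "xs = [] \<or> ys = []")
    case True
    moreover have "xs = [] \<longleftrightarrow> ys = []"
      using Cons.prems(4) partial_sums_empty_iff[of "x # xs"] partial_sums_empty_iff[of "y # ys"]
      by (simp add: \<beta>)
    ultimately have "xs = []" "ys = []" by simp_all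
    then show ?thesis using Cons.prems(3) \<beta> by simp
  next
    case False
    have px: "0 < s" if "s \<in> partial_sums xs" for s
      using partial_sums_bounds[of xs] Cons.prems(1) that by auto
    have py: "0 < s" if "s \<in> partial_sums ys" for s
      using partial_sums_bounds[of ys] Cons.prems(2) \<beta> that by auto
    have eq: "insert x ((+) x ` partial_sums xs) = insert y ((+) y ` partial_sums ys)"
      using Cons.prems(4) False \<beta> by (simp add: partial_sums_Cons)
    have "x \<in> insert y ((+) y ` partial_sums ys)" "y \<in> insert x ((+) x ` partial_sums xs)"
      using eq by (metis insertI1)+
    then have "x \<ge> y" "y \<ge> x" by auto
    then have "x = y" by simp
    have "x \<notin> (+) x ` partial_sums xs" "x \<notin> (+) x ` partial_sums ys"
      using px[of 0] py[of 0] by auto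
    then have "(+) x ` partial_sums xs = (+) x ` partial_sums ys"
      using eq unfolding \<open>x = y\<close> by (simp add: insert_ident)
    then have "partial_sums xs = partial_sums ys"
      by (simp add: inj_image_eq_iff)
    then show ?thesis
      using Cons.IH[of ys] Cons.prems(1-3) \<beta> \<open>x = y\<close> by simp
  qed
qed

lemma composition_exists:
  assumes "n > 0" "S \<subseteq> {0<..<n}"
  shows "\<exists>\<alpha>. pos_composition \<alpha> \<and> sum_list \<alpha> = n \<and> partial_sums \<alpha> = S"
  using assms
proof (induction n arbitrary: S rule: less_induct)
  case (less n)
  have fin: "finite S" using less.prems finite_subset by blast
  show ?case
  proof (cases "S = {}")
    case True
    then show ?thesis
      using less.prems by (intro exI[of _ "[n]"]) (auto simp: pos_composition_def)
  next
    case False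
    define x where "x = Max S"
    have x: "x \<in> S" "\<And>s. s \<in> S \<Longrightarrow> s \<le> x"
      using fin False by (auto simp: x_def)
    then obtain \<alpha> where \<alpha>: "pos_composition \<alpha>" "sum_list \<alpha> = x" "partial_sums \<alpha> = S - {x}"
      using less.IH[of x "S - {x}"] less.prems(2) by fastforce
    then show ?thesis
      using less.prems(2) x partial_sums_append[of \<alpha> "[n - x]"]
      by (intro exI[of _ "\<alpha> @ [n - x]"]) (auto simp: pos_composition_def)
  qed
qed

section \<open>The operations in terms of partial sums\<close>

lemma near_concat_props:
  assumes "\<alpha> \<noteq> []" "\<beta> \<noteq> []"
  shows "sum_list (\<alpha> \<odot>\<^sub>c \<beta>) = sum_list \<alpha> + sum_list \<beta>"
    "partial_sums (\<alpha> \<odot>\<^sub>c \<beta>) = partial_sums \<alpha> \<union> (+) (sum_list \<alpha>) ` partial_sums \<beta>"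
    "\<alpha> \<odot>\<^sub>c \<beta> \<noteq> []"
    "composition \<alpha> \<Longrightarrow> composition \<beta> \<Longrightarrow> composition (\<alpha> \<odot>\<^sub>c \<beta>)"
proof -
  obtain xs x where a: "\<alpha> = xs @ [x]" using assms by (metis append_butlast_last_id)
  obtain y ys where b: "\<beta> = y # ys" using assms by (cases \<beta>) auto
  have ab: "\<alpha> \<odot>\<^sub>c \<beta> = xs @ ((x + y) # ys)" by (simp add: near_concat_def a b)
  show "sum_list (\<alpha> \<odot>\<^sub>c \<beta>) = sum_list \<alpha> + sum_list \<beta>" "\<alpha> \<odot>\<^sub>c \<beta> \<noteq> []"
    "composition \<alpha> \<Longrightarrow> composition \<beta> \<Longrightarrow> composition (\<alpha> \<odot>\<^sub>c \<beta>)"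
    unfolding ab by (auto simp: a b)
  show "partial_sums (\<alpha> \<odot>\<^sub>c \<beta>) = partial_sums \<alpha> \<union> (+) (sum_list \<alpha>) ` partial_sums \<beta>"
  proof (cases "xs = []")
    case True
    then show ?thesis unfolding ab by (simp add: a b partial_sums_merge)
  next
    case False
    then show ?thesis
      unfolding ab using partial_sums_append[of xs "(x + y) # ys"] partial_sums_append[of xs "[x]"]
      by (auto simp: a b partial_sums_merge image_image add.assoc)
  qed
qed

lemma Suc_lessThan_image: "{..<Suc k} = insert 0 (Suc ` {..<k})"
  by (simp add: lessThan_Suc_eq_insert_0)

lemma near_power_props:
  assumes "pos_composition \<tau>" "k > 0"
  shows "pos_composition (near_power \<tau> k)"
    "sum_list (near_power \<tau> k) = k * sum_list \<tau>"
    "partial_sums (near_power \<tau> k) = (\<Union>j<k. (+) (j * sum_list \<tau>) ` partial_sums \<tau>)"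
proof -
  have *: "pos_composition (near_power \<tau> (Suc k)) \<and>
    sum_list (near_power \<tau> (Suc k)) = Suc k * sum_list \<tau> \<and>
    partial_sums (near_power \<tau> (Suc k)) = (\<Union>j<Suc k. (+) (j * sum_list \<tau>) ` partial_sums \<tau>)" for k
  proof (induction k)
    case 0
    show ?case using assms by (auto)
  next
    case (Suc k)
    let ?\<beta> = "near_power \<tau> (Suc k)"
    have ne: "\<tau> \<noteq> []" "?\<beta> \<noteq> []" "composition \<tau>" "composition ?\<beta>"
      using assms Suc pos_compositionD(1,2) by simp_all
    have "(\<Union>j<Suc (Suc k). (+) (j * sum_list \<tau>) ` partial_sums \<tau>) =
      partial_sums \<tau> \<union> (\<Union>j<Suc k. (+) (Suc j * sum_list \<tau>) ` partial_sums \<tau>)"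
      unfolding Suc_lessThan_image[of "Suc k"] by simp
    also have "\<dots> = partial_sums \<tau> \<union> (+) (sum_list \<tau>) ` (\<Union>j<Suc k. (+) (j * sum_list \<tau>) ` partial_sums \<tau>)"
      by (simp add: image_UN image_image add.assoc)
    finally show ?case
      using near_concat_props[OF ne(1,2)] ne Suc by (simp add: pos_composition_def)
  qed
  note * = *[of "k - 1", unfolded Suc_pred'[OF assms(2), symmetric]]
  show "pos_composition (near_power \<tau> k)" by (rule *[THEN conjunct1])
  show "sum_list (near_power \<tau> k) = k * sum_list \<tau>"
    by (rule *[THEN conjunct2, THEN conjunct1])
  show "partial_sums (near_power \<tau> k) = (\<Union>j<k. (+) (j * sum_list \<tau>) ` partial_sums \<tau>)"
    by (rule *[THEN conjunct2, THEN conjunct2])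
qed

lemma comp_circ_Cons: "(x # xs) \<circ>\<^sub>c \<tau> = near_power \<tau> x @ (xs \<circ>\<^sub>c \<tau>)"
  by (simp add: comp_circ_def)

lemma comp_circ_single: "[x] \<circ>\<^sub>c \<tau> = near_power \<tau> x"
  by (simp add: comp_circ_def)

lemma comp_circ_props:
  assumes "pos_composition \<sigma>" "pos_composition \<tau>"
  shows "pos_composition (\<sigma> \<circ>\<^sub>c \<tau>)"
    "sum_list (\<sigma> \<circ>\<^sub>c \<tau>) = sum_list \<sigma> * sum_list \<tau>"
    "partial_sums (\<sigma> \<circ>\<^sub>c \<tau>) = (\<lambda>j. j * sum_list \<tau>) ` partial_sums \<sigma> \<union>
       (\<Union>j<sum_list \<sigma>. (+) (j * sum_list \<tau>) ` partial_sums \<tau>)"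
proof -
  let ?m = "sum_list \<tau>"
  have *: "pos_composition (\<sigma> \<circ>\<^sub>c \<tau>) \<and> sum_list (\<sigma> \<circ>\<^sub>c \<tau>) = sum_list \<sigma> * ?m \<and>
    partial_sums (\<sigma> \<circ>\<^sub>c \<tau>) = (\<lambda>j. j * ?m) ` partial_sums \<sigma> \<union>
       (\<Union>j<sum_list \<sigma>. (+) (j * ?m) ` partial_sums \<tau>)"
    using pos_compositionD(1)[OF assms(1)] assms(1)
  proof (induction \<sigma> rule: list_nonempty_induct)
    case (single x)
    then show ?case
      using near_power_props[OF assms(2), of x] by (simp add: comp_circ_single pos_composition_def)
  next
    case (cons x xs)
    have pos: "pos_composition xs" "x > 0" using cons by (auto simp: pos_composition_def)
    note IH = cons.IH[OF pos(1)]
    note np = near_power_props[OF assms(2) pos(2)]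
    have ne: "near_power \<tau> x \<noteq> []" "xs \<circ>\<^sub>c \<tau> \<noteq> []" 
      using pos_compositionD(1)[OF np(1)] pos_compositionD(1)[of "xs \<circ>\<^sub>c \<tau>"] IH by simp_all
    have U: "{..<x + y} = {..<x} \<union> (+) x ` {..<y}" for x y :: nat
    proof -
      have "k \<in> (+) x ` {..<y}" if "x \<le> k" "k < x + y" for k
        using that by (intro image_eqI[of _ _ "k - x"]) auto
      then show ?thesis by (intro set_eqI iffI) (auto, meson not_less)
    qed
    have "partial_sums ((x # xs) \<circ>\<^sub>c \<tau>) = (\<Union>j<x. (+) (j * ?m) ` partial_sums \<tau>) \<union> {x * ?m} \<union>
        (+) (x * ?m) ` ((\<lambda>j. j * ?m) ` partial_sums xs \<union>
          (\<Union>j<sum_list xs. (+) (j * ?m) ` partial_sums \<tau>))"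
      using IH np ne by (simp add: comp_circ_Cons partial_sums_append)
    also have "\<dots> = (\<lambda>j. j * ?m) ` partial_sums (x # xs) \<union>
        (\<Union>j<x + sum_list xs. (+) (j * ?m) ` partial_sums \<tau>)"
      unfolding U partial_sums_Cons[OF cons.hyps(1)] image_Un image_UN image_insert image_image UN_Un
      by (simp add: add_mult_distrib add.assoc Un_ac)
    finally show ?case
      using IH np by (simp add: comp_circ_Cons pos_composition_append add_mult_distrib)
  qed
  show "pos_composition (\<sigma> \<circ>\<^sub>c \<tau>)" by (rule *[THEN conjunct1])
  show "sum_list (\<sigma> \<circ>\<^sub>c \<tau>) = sum_list \<sigma> * sum_list \<tau>"
    by (rule *[THEN conjunct2, THEN conjunct1])
  show "partial_sums (\<sigma> \<circ>\<^sub>c \<tau>) = (\<lambda>j. j * sum_list \<tau>) ` partial_sums \<sigma> \<union>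
       (\<Union>j<sum_list \<sigma>. (+) (j * sum_list \<tau>) ` partial_sums \<tau>)"
    by (rule *[THEN conjunct2, THEN conjunct2])
qed

text \<open>Multiples of the size of \<open>\<tau>\<close> see only \<open>\<sigma>\<close>, and all other positions see only \<open>\<tau>\<close>, through their
residue.\<close>

lemma partial_sums_comp_circ_iff:
  assumes "pos_composition \<sigma>" "pos_composition \<tau>" "x < sum_list \<sigma> * sum_list \<tau>"
  shows "x \<in> partial_sums (\<sigma> \<circ>\<^sub>c \<tau>) \<longleftrightarrow>
    (if sum_list \<tau> dvd x then x div sum_list \<tau> \<in> partial_sums \<sigma>
     else x mod sum_list \<tau> \<in> partial_sums \<tau>)"
proof -
  let ?m = "sum_list \<tau>"
  have m: "?m > 0" using assms by (simp add: pos_compositionD)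
  have b: "0 < s \<and> s < ?m" if "s \<in> partial_sums \<tau>" for s
    using partial_sums_bounds[OF pos_compositionD(2)[OF assms(2)]] that by auto
  have 1: "x \<in> (\<lambda>j. j * ?m) ` partial_sums \<sigma> \<longleftrightarrow> ?m dvd x \<and> x div ?m \<in> partial_sums \<sigma>"
    using m by (auto intro!: image_eqI[of x _ "x div ?m"])
  have 2: "x \<in> (\<Union>j<sum_list \<sigma>. (+) (j * ?m) ` partial_sums \<tau>) \<longleftrightarrow>
     \<not> ?m dvd x \<and> x mod ?m \<in> partial_sums \<tau>" (is "?L \<longleftrightarrow> ?R")
  proof
    assume ?L
    then obtain j s where js: "x = j * ?m + s" "s \<in> partial_sums \<tau>" by auto
    then have "x mod ?m = s" using b by (simp)
    then show ?R using js b by (auto simp: dvd_eq_mod_eq_0)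
  next
    assume ?R
    then have "x = x div ?m * ?m + x mod ?m" "x div ?m < sum_list \<sigma>"
      using assms(3) m by (auto simp: less_mult_imp_div_less)
    then show ?L using \<open>?R\<close> by blast
  qed
  show ?thesis
    unfolding comp_circ_props(3)[OF assms(1,2)] Un_iff 1 2 by auto
qed

lemma partial_sums_rev:
  "partial_sums (rev \<alpha>) = (\<lambda>s. sum_list \<alpha> - s) ` partial_sums \<alpha>"
proof (induction \<alpha>)
  case (Cons x xs)
  show ?case
  proof (cases "xs = []")
    case False
    have "partial_sums (rev (x # xs)) = partial_sums (rev xs) \<union> {sum_list xs}"
      using partial_sums_append[of "rev xs" "[x]"] False by simp
    also have "\<dots> = (\<lambda>s. sum_list (x # xs) - s) ` partial_sums (x # xs)"
      using False by (auto simp: partial_sums_Cons Cons.IH image_image)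
    finally show ?thesis .
  qed auto
qed auto

lemma partial_sums_rev_iff:
  assumes "composition \<alpha>" "0 < s" "s < sum_list \<alpha>"
  shows "s \<in> partial_sums (rev \<alpha>) \<longleftrightarrow> sum_list \<alpha> - s \<in> partial_sums \<alpha>"
  using partial_sums_bounds[OF assms(1)] assms(2,3)
  by (auto simp: partial_sums_rev intro!: image_eqI[of s _ "sum_list \<alpha> - s"])

lemma pos_composition_rev [simp]: "pos_composition (rev \<alpha>) \<longleftrightarrow> pos_composition \<alpha>"
  by (auto simp: pos_composition_def)

lemma pos_composition_eqI:
  assumes "pos_composition \<alpha>" "pos_composition \<beta>" "sum_list \<alpha> = sum_list \<beta>"
    "\<And>x. 0 < x \<Longrightarrow> x < sum_list \<alpha> \<Longrightarrow> x \<in> partial_sums \<alpha> \<longleftrightarrow> x \<in> partial_sums \<beta>"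
  shows "\<alpha> = \<beta>"
proof (rule composition_eqI)
  have b: "x \<in> partial_sums \<alpha> \<Longrightarrow> 0 < x \<and> x < sum_list \<alpha>"
    "x \<in> partial_sums \<beta> \<Longrightarrow> 0 < x \<and> x < sum_list \<alpha>" for x
    using partial_sums_bounds[OF pos_compositionD(2)[OF assms(1)]]
      partial_sums_bounds[OF pos_compositionD(2)[OF assms(2)]] assms(3) by auto
  show "partial_sums \<alpha> = partial_sums \<beta>"
    using b assms(4) by (intro set_eqI) metis
qed (use pos_compositionD(2) assms(1-3) in simp_all)

text \<open>Both sides have three levels of positions, distinguished by divisibility by the size of \<open>\<gamma>\<close> and by the
size of \<open>\<beta> \<circ> \<gamma>\<close>.\<close>

lemma comp_circ_assoc:
  assumes "pos_composition \<alpha>" "pos_composition \<beta>" "pos_composition \<gamma>"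
  shows "(\<alpha> \<circ>\<^sub>c \<beta>) \<circ>\<^sub>c \<gamma> = \<alpha> \<circ>\<^sub>c (\<beta> \<circ>\<^sub>c \<gamma>)"
proof (rule pos_composition_eqI)
  note props = comp_circ_props(1,2)
  show "pos_composition ((\<alpha> \<circ>\<^sub>c \<beta>) \<circ>\<^sub>c \<gamma>)" "pos_composition (\<alpha> \<circ>\<^sub>c \<beta> \<circ>\<^sub>c \<gamma>)"
    "sum_list ((\<alpha> \<circ>\<^sub>c \<beta>) \<circ>\<^sub>c \<gamma>) = sum_list (\<alpha> \<circ>\<^sub>c \<beta> \<circ>\<^sub>c \<gamma>)"
    using assms by (simp_all add: props)
  fix x assume "0 < x" "x < sum_list ((\<alpha> \<circ>\<^sub>c \<beta>) \<circ>\<^sub>c \<gamma>)"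
  then have x: "x < sum_list \<alpha> * sum_list \<beta> * sum_list \<gamma>" using assms by (simp add: props)
  define b c where "b = sum_list \<beta>" and "c = sum_list \<gamma>"
  have pos: "b > 0" "c > 0" using assms by (simp_all add: pos_compositionD b_def c_def)
  have x1: "x div c < sum_list \<alpha> * b" "x mod (b * c) < b * c" "x mod c < c"
    using x pos by (auto simp: b_def c_def less_mult_imp_div_less mult.assoc)
  have l: "x \<in> partial_sums ((\<alpha> \<circ>\<^sub>c \<beta>) \<circ>\<^sub>c \<gamma>) \<longleftrightarrow>
     (if c dvd x then (if b dvd x div c then x div c div b \<in> partial_sums \<alpha> else x div c mod b \<in> partial_sums \<beta>)
      else x mod c \<in> partial_sums \<gamma>)"
    using x x1 assms by (simp add: partial_sums_comp_circ_iff props b_def c_def)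
  have r: "x \<in> partial_sums (\<alpha> \<circ>\<^sub>c (\<beta> \<circ>\<^sub>c \<gamma>)) \<longleftrightarrow>
     (if b * c dvd x then x div (b * c) \<in> partial_sums \<alpha>
      else if c dvd x mod (b * c) then x mod (b * c) div c \<in> partial_sums \<beta>
        else x mod (b * c) mod c \<in> partial_sums \<gamma>)"
    using x x1 assms by (simp add: partial_sums_comp_circ_iff props b_def c_def mult.assoc)
  have "c dvd x mod (b * c) \<longleftrightarrow> c dvd x" by (simp add: dvd_mod_iff)
  moreover have "b * c dvd x \<longleftrightarrow> c dvd x \<and> b dvd x div c"
    using pos dvd_mult_right[of b c x] by (auto simp: dvd_div_iff_mult)
  moreover have "x div (b * c) = x div c div b" using div_mult2_eq[of x c b] by (simp add: mult.commute)
  moreover have "x mod (b * c) div c = x div c mod b"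
    using pos mod_mult2_eq[of x c b] by (simp add: mult.commute[of b c])
  moreover have "x mod (b * c) mod c = x mod c" by (simp add: mod_mod_cancel)
  ultimately show "x \<in> partial_sums ((\<alpha> \<circ>\<^sub>c \<beta>) \<circ>\<^sub>c \<gamma>) \<longleftrightarrow> x \<in> partial_sums (\<alpha> \<circ>\<^sub>c \<beta> \<circ>\<^sub>c \<gamma>)"
    unfolding l r by auto
qed

lemma rev_comp_circ:
  assumes "pos_composition \<sigma>" "pos_composition \<tau>"
  shows "rev (\<sigma> \<circ>\<^sub>c \<tau>) = rev \<sigma> \<circ>\<^sub>c rev \<tau>"
proof (rule pos_composition_eqI)
  note props = comp_circ_props(1,2)
  show "pos_composition (rev (\<sigma> \<circ>\<^sub>c \<tau>))" "pos_composition (rev \<sigma> \<circ>\<^sub>c rev \<tau>)"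
    "sum_list (rev (\<sigma> \<circ>\<^sub>c \<tau>)) = sum_list (rev \<sigma> \<circ>\<^sub>c rev \<tau>)"
    using assms by (simp_all add: props)
  define s m where "s = sum_list \<sigma>" and "m = sum_list \<tau>"
  have pos: "s > 0" "m > 0" using assms by (simp_all add: pos_compositionD s_def m_def)
  have comp: "composition \<sigma>" "composition \<tau>" "composition (\<sigma> \<circ>\<^sub>c \<tau>)"
    using assms by (simp_all add: comp_circ_props(1) pos_compositionD)
  fix x assume x: "0 < x" "x < sum_list (rev (\<sigma> \<circ>\<^sub>c \<tau>))"
  then have x': "x < s * m" using assms by (simp add: props s_def m_def)
  have l: "x \<in> partial_sums (rev (\<sigma> \<circ>\<^sub>c \<tau>)) \<longleftrightarrow> s * m - x \<in> partial_sums (\<sigma> \<circ>\<^sub>c \<tau>)"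
    using partial_sums_rev_iff[OF comp(3)] x assms by (simp add: props s_def m_def)
  show "x \<in> partial_sums (rev (\<sigma> \<circ>\<^sub>c \<tau>)) \<longleftrightarrow> x \<in> partial_sums (rev \<sigma> \<circ>\<^sub>c rev \<tau>)"
  proof (cases "m dvd x")
    case True
    then obtain y where y: "x = m * y" by blast
    have "y < s" "0 < y" using x(1) x' y pos by (auto simp: mult.commute)
    have "s * m - x = m * (s - y)" by (simp add: y algebra_simps diff_mult_distrib2)
    then show ?thesis
      using l x' assms \<open>0 < y\<close> \<open>y < s\<close> pos y
      by (simp add: partial_sums_comp_circ_iff partial_sums_rev_iff[OF comp(1)] flip: s_def m_def)
  next
    case False
    define r where "r = x mod m"
    have r: "0 < r" "r < m" using False pos by (auto simp: r_def dvd_eq_mod_eq_0)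
    have xdec: "x = m * (x div m) + r" by (simp add: r_def)
    have "x div m < s" using x' by (simp add: less_mult_imp_div_less)
    then obtain d where d: "s = x div m + Suc d" using less_imp_Suc_add by auto
    have "s * m = m * (x div m) + m * d + m" by (simp add: d algebra_simps)
    then have e: "s * m - x = m * d + (m - r)" using xdec r by linarith
    have "(s * m - x) mod m = m - r" unfolding e using r mod_mult_self4[of m d "m - r"] by (simp only: mod_less diff_less)
    moreover from this have "\<not> m dvd s * m - x" using r by (simp add: dvd_eq_mod_eq_0)
    ultimately show ?thesis
      using l x' x(1) assms False r pos
      by (simp add: partial_sums_comp_circ_iff partial_sums_rev_iff[OF comp(2)] r_def flip: s_def m_def)
  qed
qed

lemma pos_composition_one [simp]: "pos_composition [1]" "pos_composition [Suc 0]"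
  by (auto simp: pos_composition_def)

lemma comp_circ_one [simp]:
  "pos_composition \<sigma> \<Longrightarrow> \<sigma> \<circ>\<^sub>c [1] = \<sigma>" "[1] \<circ>\<^sub>c \<sigma> = \<sigma>"
proof -
  show "[1] \<circ>\<^sub>c \<sigma> = \<sigma>" by (simp add: comp_circ_single)
  have "near_power [Suc 0] (Suc k) = [Suc k]" for k
    by (induction k) (auto simp: near_concat_def)
  then have np: "near_power [1] x = [x]" if "x > 0" for x using that by (cases x) auto
  have "composition \<sigma> \<Longrightarrow> concat (map (near_power [1]) \<sigma>) = \<sigma>"
    by (induction \<sigma>) (simp_all add: np del: One_nat_def)
  then show "\<sigma> \<circ>\<^sub>c [1] = \<sigma>" if "pos_composition \<sigma>"
    using that unfolding comp_circ_def pos_composition_def by blast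
qed

lemma circ_list_pos:
  "(\<forall>\<alpha>\<in>set \<alpha>s. pos_composition \<alpha>) \<Longrightarrow> pos_composition (circ_list \<alpha>s)"
  by (induction \<alpha>s rule: circ_list.induct) (auto simp: comp_circ_props)

lemma circ_list_Cons:
  "pos_composition \<alpha> \<Longrightarrow> circ_list (\<alpha> # \<alpha>s) = \<alpha> \<circ>\<^sub>c circ_list \<alpha>s"
  using comp_circ_one(1)[of \<alpha>] by (cases \<alpha>s) auto

lemma circ_list_append:
  "(\<forall>\<alpha>\<in>set \<alpha>s \<union> set \<beta>s. pos_composition \<alpha>) \<Longrightarrow>
    circ_list (\<alpha>s @ \<beta>s) = circ_list \<alpha>s \<circ>\<^sub>c circ_list \<beta>s"
proof (induction \<alpha>s)
  case Nil
  show ?case using comp_circ_one(2)[of "circ_list \<beta>s"] by simp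
next
  case (Cons \<alpha> \<alpha>s)
  then show ?case
    using comp_circ_assoc[of \<alpha> "circ_list \<alpha>s" "circ_list \<beta>s"] circ_list_pos[of \<alpha>s] circ_list_pos[of \<beta>s]
    by (simp add: circ_list_Cons del: circ_list.simps(2,3))
qed

lemma rev_circ_list:
  "(\<forall>\<alpha>\<in>set \<alpha>s. pos_composition \<alpha>) \<Longrightarrow> rev (circ_list \<alpha>s) = circ_list (map rev \<alpha>s)"
  by (induction \<alpha>s) (simp_all add: circ_list_Cons rev_comp_circ circ_list_pos)

section \<open>Coarsenings and Moebius inversion\<close>

lemma coarsening_Nil_right [simp]: "coarsening \<alpha> [] \<longleftrightarrow> \<alpha> = []"
proof
  assume "coarsening \<alpha> []"
  then obtain bs where bs: "[] \<notin> set bs" "concat bs = []" "\<alpha> = map sum_list bs"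
    by (auto simp: coarsening_def)
  from bs(1,2) have "bs = []" by (cases bs) auto
  with bs(3) show "\<alpha> = []" by simp
qed (auto simp: coarsening_def intro: exI[of _ "[]"])

lemma coarsening_single_right [simp]: "coarsening \<alpha> [x] \<longleftrightarrow> \<alpha> = [x]"
proof
  assume "coarsening \<alpha> [x]"
  then obtain bs where bs: "[] \<notin> set bs" "concat bs = [x]" "\<alpha> = map sum_list bs"
    by (auto simp: coarsening_def)
  from bs(1,2) obtain b bs' where b: "bs = b # bs'" by (cases bs) auto
  with bs(1,2) have "b = [x]" "concat bs' = []" by (cases b; simp)+
  with bs(1) b have "bs' = []" by (cases bs') auto
  with b bs(3) \<open>b = [x]\<close> show "\<alpha> = [x]" by simp
qed (auto simp: coarsening_def intro: exI[of _ "[[x]]"])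

lemma coarsening_Cons_Cons:
  "coarsening \<alpha> (x # y # ys) \<longleftrightarrow>
    (\<exists>\<alpha>'. \<alpha> = x # \<alpha>' \<and> coarsening \<alpha>' (y # ys)) \<or> coarsening \<alpha> ((x + y) # ys)"
proof
  assume "coarsening \<alpha> (x # y # ys)"
  then obtain bs where bs: "[] \<notin> set bs" "concat bs = x # y # ys" "\<alpha> = map sum_list bs"
    by (auto simp: coarsening_def)
  from bs(1,2) obtain b' bs' where b: "bs = (x # b') # bs'"
    by (cases bs; cases "hd bs") auto
  show "(\<exists>\<alpha>'. \<alpha> = x # \<alpha>' \<and> coarsening \<alpha>' (y # ys)) \<or> coarsening \<alpha> ((x + y) # ys)"
  proof (cases b')
    case Nil
    with bs b have "\<alpha> = x # map sum_list bs'" "coarsening (map sum_list bs') (y # ys)"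
      by (auto simp: coarsening_def)
    then show ?thesis by blast
  next
    case (Cons z b'')
    with bs b have "coarsening \<alpha> ((x + y) # ys)"
      unfolding coarsening_def by (intro exI[of _ "((x + y) # b'') # bs'"]) auto
    then show ?thesis by blast
  qed
next
  assume "(\<exists>\<alpha>'. \<alpha> = x # \<alpha>' \<and> coarsening \<alpha>' (y # ys)) \<or> coarsening \<alpha> ((x + y) # ys)"
  then show "coarsening \<alpha> (x # y # ys)"
  proof
    assume "\<exists>\<alpha>'. \<alpha> = x # \<alpha>' \<and> coarsening \<alpha>' (y # ys)"
    then obtain bs where "[] \<notin> set bs" "concat bs = y # ys" "\<alpha> = x # map sum_list bs"
      by (auto simp: coarsening_def)
    then show ?thesis
      unfolding coarsening_def by (intro exI[of _ "[x] # bs"]) auto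
  next
    assume "coarsening \<alpha> ((x + y) # ys)"
    then obtain bs where bs: "[] \<notin> set bs" "concat bs = (x + y) # ys" "\<alpha> = map sum_list bs"
      by (auto simp: coarsening_def)
    from bs(1,2) obtain b' bs' where b: "bs = ((x + y) # b') # bs'"
      by (cases bs; cases "hd bs") auto
    with bs show ?thesis
      unfolding coarsening_def by (intro exI[of _ "(x # y # b') # bs'"]) auto
  qed
qed

text \<open>A list rather than a set, because the recursion (keep or drop the first break) then directly gives
recursions for all sums over coarsenings.\<close>

fun coarsenings :: "nat list \<Rightarrow> nat list list" where
  "coarsenings [] = [[]]"
| "coarsenings [x] = [[x]]"
| "coarsenings (x # y # ys) = map ((#) x) (coarsenings (y # ys)) @ coarsenings ((x + y) # ys)"

lemma set_coarsenings: "set (coarsenings \<beta>) = {\<alpha>. coarsening \<alpha> \<beta>}"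
  by (induction \<beta> rule: coarsenings.induct) (auto simp: coarsening_Cons_Cons)

lemma coarsenings_props:
  assumes "\<alpha> \<in> set (coarsenings \<beta>)"
  shows "sum_list \<alpha> = sum_list \<beta>" "length \<alpha> \<le> length \<beta>" "\<alpha> = [] \<longleftrightarrow> \<beta> = []"
    "\<beta> \<noteq> [] \<Longrightarrow> hd \<beta> \<le> hd \<alpha>" "composition \<beta> \<Longrightarrow> composition \<alpha>"
proof -
  have "sum_list \<alpha> = sum_list \<beta> \<and> length \<alpha> \<le> length \<beta> \<and> (\<alpha> = [] \<longleftrightarrow> \<beta> = []) \<and>
      (\<beta> \<noteq> [] \<longrightarrow> hd \<beta> \<le> hd \<alpha>) \<and> (composition \<beta> \<longrightarrow> composition \<alpha>)"
    using assms
  proof (induction \<beta> arbitrary: \<alpha> rule: coarsenings.induct)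
    case (3 x y ys)
    from 3(3) consider \<delta> where "\<alpha> = x # \<delta>" "\<delta> \<in> set (coarsenings (y # ys))"
      | "\<alpha> \<in> set (coarsenings ((x + y) # ys))"
      by auto
    then show ?case
    proof cases
      case 1
      with 3(1)[OF 1(2)] show ?thesis by simp
    next
      case 2
      from 3(2)[OF this] show ?thesis by simp
    qed
  qed simp_all
  then show "sum_list \<alpha> = sum_list \<beta>" "length \<alpha> \<le> length \<beta>" "\<alpha> = [] \<longleftrightarrow> \<beta> = []"
    "\<beta> \<noteq> [] \<Longrightarrow> hd \<beta> \<le> hd \<alpha>" "composition \<beta> \<Longrightarrow> composition \<alpha>"
    by simp_all
qed

lemma self_in_coarsenings: "\<beta> \<in> set (coarsenings \<beta>)"
  by (induction \<beta> rule: coarsenings.induct) auto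

lemma distinct_coarsenings: "composition \<beta> \<Longrightarrow> distinct (coarsenings \<beta>)"
proof (induction \<beta> rule: coarsenings.induct)
  case (3 x y ys)
  have "x # \<alpha> \<notin> set (coarsenings ((x + y) # ys))" for \<alpha>
    using coarsenings_props(4)[of "x # \<alpha>" "(x + y) # ys"] 3 by auto
  then show ?case using 3 by (auto simp: distinct_map)
qed auto

text \<open>Dropping the first break commutes with coarsening the rest; this lets both inversion formulas below
be proved by recursion over the breaks.\<close>

lemma coarsenings_merge:
  "coarsenings ((x + y) # ys) = map (\<lambda>\<alpha>. (x + hd \<alpha>) # tl \<alpha>) (coarsenings (y # ys))"
proof (induction "y # ys" arbitrary: y ys rule: coarsenings.induct)
  case (3 y z zs)
  then show ?case by (simp add: add.assoc)
qed auto

abbreviation coarsening_sum :: "(nat list \<Rightarrow> 'a::comm_monoid_add) \<Rightarrow> nat list \<Rightarrow> 'a" where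
  "coarsening_sum g \<beta> \<equiv> sum_list (map g (coarsenings \<beta>))"

definition signed_coarsening_sum :: "(nat list \<Rightarrow> rat) \<Rightarrow> nat list \<Rightarrow> rat" where
  "signed_coarsening_sum g \<beta> = coarsening_sum (\<lambda>\<alpha>. (- 1) ^ (length \<beta> + length \<alpha>) * g \<alpha>) \<beta>"

lemma signed_coarsening_sum_rec:
  "signed_coarsening_sum g [] = g []"
  "signed_coarsening_sum g [x] = g [x]"
  "signed_coarsening_sum g (x # y # ys) =
    signed_coarsening_sum (\<lambda>\<alpha>. g (x # \<alpha>)) (y # ys) - signed_coarsening_sum g ((x + y) # ys)"
  by (simp_all add: signed_coarsening_sum_def o_def uminus_sum_list_map)

lemma sum_list_map_cong_set:
  "(\<And>x. x \<in> set xs \<Longrightarrow> f x = g x) \<Longrightarrow> sum_list (map f xs) = sum_list (map g xs)"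
  by (metis map_cong)

lemma coarsening_sum_Cons:
  assumes "\<alpha> \<noteq> []"
  shows "coarsening_sum g (x # \<alpha>) =
    coarsening_sum (\<lambda>\<delta>. g (x # \<delta>)) \<alpha> + coarsening_sum g ((x + hd \<alpha>) # tl \<alpha>)"
  using assms by (cases \<alpha>) (auto simp: o_def)

lemma signed_coarsening_sum_Cons:
  assumes "\<alpha> \<noteq> []"
  shows "signed_coarsening_sum g (x # \<alpha>) =
    signed_coarsening_sum (\<lambda>\<delta>. g (x # \<delta>)) \<alpha> - signed_coarsening_sum g ((x + hd \<alpha>) # tl \<alpha>)"
  using assms by (cases \<alpha>) (auto simp: signed_coarsening_sum_rec)

lemma signed_coarsening_sum_cong:
  "(\<And>\<alpha>. \<alpha> \<in> set (coarsenings \<beta>) \<Longrightarrow> f \<alpha> = g \<alpha>) \<Longrightarrow>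
    signed_coarsening_sum f \<beta> = signed_coarsening_sum g \<beta>"
  unfolding signed_coarsening_sum_def by (intro sum_list_map_cong_set) auto

lemma signed_coarsening_sum_add:
  "signed_coarsening_sum (\<lambda>\<alpha>. f \<alpha> + g \<alpha>) \<beta> = signed_coarsening_sum f \<beta> + signed_coarsening_sum g \<beta>"
  unfolding signed_coarsening_sum_def by (simp add: algebra_simps sum_list_addf)

lemma signed_coarsening_sum_merge:
  "signed_coarsening_sum g ((x + y) # ys) =
    signed_coarsening_sum (\<lambda>\<alpha>. g ((x + hd \<alpha>) # tl \<alpha>)) (y # ys)"
  unfolding signed_coarsening_sum_def coarsenings_merge map_map o_def
proof (intro sum_list_map_cong_set)
  fix \<alpha> assume "\<alpha> \<in> set (coarsenings (y # ys))"
  then have "\<alpha> \<noteq> []" using coarsenings_props(3) by blast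
  then show "(- 1) ^ (length ((x + y) # ys) + length ((x + hd \<alpha>) # tl \<alpha>)) * g ((x + hd \<alpha>) # tl \<alpha>) =
      (- 1) ^ (length (y # ys) + length \<alpha>) * g ((x + hd \<alpha>) # tl \<alpha>)"
    by (cases \<alpha>) auto
qed

text \<open>The two Moebius inversion formulas of the Boolean lattice of sets of breaks. In the induction, the
terms in which the first break is dropped cancel.\<close>

lemma signed_coarsening_sum_inverse:
  "signed_coarsening_sum (coarsening_sum g) \<beta> = g \<beta>"
proof (induction \<beta> arbitrary: g rule: coarsenings.induct)
  case (3 x y ys)
  have "signed_coarsening_sum (\<lambda>\<alpha>. coarsening_sum g (x # \<alpha>)) (y # ys) =
      signed_coarsening_sum (\<lambda>\<alpha>. coarsening_sum (\<lambda>\<delta>. g (x # \<delta>)) \<alpha> +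
        coarsening_sum g ((x + hd \<alpha>) # tl \<alpha>)) (y # ys)"
    by (intro signed_coarsening_sum_cong coarsening_sum_Cons) (auto dest: coarsenings_props(3))
  also have "\<dots> = g (x # y # ys) + signed_coarsening_sum (coarsening_sum g) ((x + y) # ys)"
    unfolding signed_coarsening_sum_add signed_coarsening_sum_merge 3(1) ..
  finally show ?case by (simp add: signed_coarsening_sum_rec)
qed (auto simp: signed_coarsening_sum_rec)

lemma coarsening_sum_inverse:
  "coarsening_sum (signed_coarsening_sum g) \<beta> = g \<beta>"
proof (induction \<beta> arbitrary: g rule: coarsenings.induct)
  case (3 x y ys)
  have "coarsening_sum (\<lambda>\<alpha>. signed_coarsening_sum g (x # \<alpha>)) (y # ys) =
      coarsening_sum (\<lambda>\<alpha>. signed_coarsening_sum (\<lambda>\<delta>. g (x # \<delta>)) \<alpha> -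
        signed_coarsening_sum g ((x + hd \<alpha>) # tl \<alpha>)) (y # ys)"
    by (intro sum_list_map_cong_set signed_coarsening_sum_Cons) (auto dest: coarsenings_props(3))
  also have "\<dots> = g (x # y # ys) - coarsening_sum (signed_coarsening_sum g) ((x + y) # ys)"
    unfolding coarsenings_merge by (simp add: sum_list_subtractf 3(1) o_def)
  finally show ?case by (simp add: o_def)
qed (auto simp: signed_coarsening_sum_rec)

text \<open>The invariant of the equivalence class: the multiset of partitions determined by the coarsenings.\<close>

definition coarsening_shapes :: "nat list \<Rightarrow> nat multiset multiset" where
  "coarsening_shapes \<beta> = mset (map mset (coarsenings \<beta>))"

lemma coarsening_sum_symmetric:
  assumes "coarsening_shapes \<beta> = coarsening_shapes \<gamma>"
    and "\<And>\<alpha>. coarsening \<alpha> \<beta> \<Longrightarrow> g \<alpha> = G (mset \<alpha>)" "\<And>\<alpha>. coarsening \<alpha> \<gamma> \<Longrightarrow> g \<alpha> = G (mset \<alpha>)"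
  shows "coarsening_sum g \<beta> = coarsening_sum g \<gamma>"
proof -
  have *: "coarsening_sum g \<beta> = sum_mset (image_mset G (coarsening_shapes \<beta>))"
    if "\<And>\<alpha>. coarsening \<alpha> \<beta> \<Longrightarrow> g \<alpha> = G (mset \<alpha>)" for \<beta>
  proof -
    have "coarsening_sum g \<beta> = coarsening_sum (\<lambda>\<alpha>. G (mset \<alpha>)) \<beta>"
      by (intro sum_list_map_cong_set that) (use set_coarsenings in blast)
    also have "\<dots> = sum_mset (image_mset G (coarsening_shapes \<beta>))"
      by (simp add: coarsening_shapes_def sum_mset_sum_list[symmetric] image_mset.compositionality o_def)
    finally show ?thesis .
  qed
  show ?thesis using *[OF assms(2)] *[OF assms(3)] assms(1) by simp
qed

text \<open>A composition is its own longest coarsening.\<close>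

lemma coarsening_shapes_length:
  assumes "coarsening_shapes \<beta> = coarsening_shapes \<gamma>" shows "length \<beta> = length \<gamma>"
proof -
  have "length \<beta> \<le> length \<gamma>" if eq: "coarsening_shapes \<beta> = coarsening_shapes \<gamma>" for \<beta> \<gamma>
  proof -
    have "mset \<beta> \<in># coarsening_shapes \<beta>"
      using self_in_coarsenings by (auto simp: coarsening_shapes_def)
    then obtain \<alpha> where "\<alpha> \<in> set (coarsenings \<gamma>)" "mset \<beta> = mset \<alpha>"
      unfolding eq by (auto simp: coarsening_shapes_def)
    then show ?thesis using coarsenings_props(2)[of \<alpha> \<gamma>] mset_eq_length[of \<beta> \<alpha>] by simp
  qed
  from this[OF assms] this[OF assms[symmetric]] show ?thesis by simp
qed

section \<open>Equivalence and multisets of coarsenings\<close>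

text \<open>The composition \<open>\<gamma>\<close> for which the monomial \<open>m\<close> occurs in \<open>M\<^sub>\<gamma>\<close>: the nonzero exponents of \<open>m\<close> in
the order of the variables.\<close>

definition exponents :: "monomial \<Rightarrow> nat list" where
  "exponents m = map (Poly_Mapping.lookup m) (sorted_list_of_set (Poly_Mapping.keys m))"

definition initial_monomial :: "nat list \<Rightarrow> monomial" where
  "initial_monomial \<delta> = (\<Sum>j<length \<delta>. Poly_Mapping.single j (\<delta> ! j))"

lemma composition_exponents: "composition (exponents m)"
  by (auto simp: composition_def exponents_def in_keys_iff)

text \<open>The variables of a summand are forced to be those of the monomial in increasing order.\<close>

lemma M_eq: 
  assumes "composition \<gamma>" shows "M \<gamma> m = of_bool (\<gamma> = exponents m)"
proof -
  let ?K = "sorted_list_of_set (Poly_Mapping.keys m)"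
  let ?S = "{ks. length ks = length \<gamma> \<and> sorted_wrt (<) ks \<and>
     m = (\<Sum>j<length \<gamma>. Poly_Mapping.single (ks ! j) (\<gamma> ! j))}"
  have l: "Poly_Mapping.lookup (\<Sum>j<length \<gamma>. Poly_Mapping.single (ks ! j) (\<gamma> ! j)) i =
      (if i \<in> set ks then \<gamma> ! (THE j. j < length \<gamma> \<and> ks ! j = i) else 0)"
    if lk0: "length ks = length \<gamma>" "distinct ks" for ks :: "nat list" and i
  proof (cases "i \<in> set ks")
    case True
    then obtain j where j: "j < length \<gamma>" "ks ! j = i" using lk0(1) by (auto simp: in_set_conv_nth)
    have u: "k = j" if "k < length \<gamma>" "ks ! k = i" for k
      using nth_eq_iff_index_eq[of ks k j] that j lk0 by simp
    have "(THE j. j < length \<gamma> \<and> ks ! j = i) = j" using j u by (intro the_equality conjI) (assumption | blast)+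
    moreover have "(\<Sum>k<length \<gamma>. \<gamma> ! k when ks ! k = i) = (\<Sum>k<length \<gamma>. if k = j then \<gamma> ! j else 0)"
    proof (rule sum.cong[OF refl])
      show "(\<gamma> ! k when ks ! k = i) = (if k = j then \<gamma> ! j else 0)" if "k \<in> {..<length \<gamma>}" for k
        using u[of k] j(2) that by (cases "k = j") (auto simp: when_def)
    qed
    ultimately show ?thesis using True j by (simp add: lookup_sum lookup_single)
  next
    case False
    then have "(\<Sum>k<length \<gamma>. \<gamma> ! k when ks ! k = i) = 0"
      using lk0(1) by (intro sum.neutral) (auto simp: when_def)
    then show ?thesis using False by (simp add: lookup_sum lookup_single)
  qed
  have the: "(THE k. k < length \<gamma> \<and> ks ! k = ks ! j) = j"
    if "length ks = length \<gamma>" "distinct ks" "j < length \<gamma>" for ks :: "nat list" and j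
    using that nth_eq_iff_index_eq[of ks _ j] by (intro the_equality conjI) (simp | metis)+
  have S: "ks \<in> ?S \<longleftrightarrow> ks = ?K \<and> \<gamma> = exponents m" for ks
  proof
    assume "ks \<in> ?S"
    then have lk0: "length ks = length \<gamma>" "sorted_wrt (<) ks"
      and m: "m = (\<Sum>j<length \<gamma>. Poly_Mapping.single (ks ! j) (\<gamma> ! j))" by auto
    have d: "distinct ks" using lk0(2) strict_sorted_iff by blast
    have nz: "\<gamma> ! j \<noteq> 0" if "j < length \<gamma>" for j
      using assms that nth_mem[of j \<gamma>] by (metis composition_def)
    have lk: "Poly_Mapping.lookup m (ks ! j) = \<gamma> ! j" if "j < length \<gamma>" for j
      using that l[OF lk0(1) d, of "ks ! j"] the[OF lk0(1) d that] lk0(1) unfolding m by simp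
    have "Poly_Mapping.keys m = set ks"
    proof (rule set_eqI)
      fix i
      show "i \<in> Poly_Mapping.keys m \<longleftrightarrow> i \<in> set ks"
      proof
        assume "i \<in> Poly_Mapping.keys m"
        then have "Poly_Mapping.lookup m i \<noteq> 0" by (simp add: in_keys_iff)
        then show "i \<in> set ks" using l[OF lk0(1) d, of i] unfolding m by (auto split: if_splits)
      next
        assume "i \<in> set ks"
        then obtain j where "j < length \<gamma>" "ks ! j = i" using lk0(1) by (auto simp: in_set_conv_nth)
        then show "i \<in> Poly_Mapping.keys m" using lk[of j] nz[of j] by (auto simp: in_keys_iff)
      qed
    qed
    then have isK: "ks = ?K"
      using lk0(2) by (metis sorted_list_of_set.idem_if_sorted_distinct strict_sorted_iff)
    moreover have "\<gamma> = exponents m"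
      unfolding exponents_def isK[symmetric] using lk lk0(1) by (intro nth_equalityI) auto
    ultimately show "ks = ?K \<and> \<gamma> = exponents m" by blast
  next
    assume *: "ks = ?K \<and> \<gamma> = exponents m"
    then have lk0: "length ks = length \<gamma>" by (simp add: exponents_def)
    have s: "sorted_wrt (<) ks" using * by simp
    have d: "distinct ks" using * by simp
    have "m = (\<Sum>j<length \<gamma>. Poly_Mapping.single (ks ! j) (\<gamma> ! j))"
    proof (rule poly_mapping_eqI)
      fix i
      show "Poly_Mapping.lookup m i =
        Poly_Mapping.lookup (\<Sum>j<length \<gamma>. Poly_Mapping.single (ks ! j) (\<gamma> ! j)) i"
      proof (cases "i \<in> set ks")
        case True
        then obtain j where j: "j < length \<gamma>" "ks ! j = i" using lk0 by (auto simp: in_set_conv_nth)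
        then have "\<gamma> ! j = Poly_Mapping.lookup m i" using * lk0 by (simp add: exponents_def)
        then show ?thesis using j True l[OF lk0 d, of i] the[OF lk0 d j(1)] by simp
      next
        case False
        then have "i \<notin> Poly_Mapping.keys m" using * by simp
        then show ?thesis using False l[OF lk0 d, of i] by (simp add: in_keys_iff)
      qed
    qed
    then show "ks \<in> ?S" using lk0 s by blast
  qed
  have "?S = (if \<gamma> = exponents m then {?K} else {})"
  proof (rule set_eqI)
    show "ks \<in> ?S \<longleftrightarrow> ks \<in> (if \<gamma> = exponents m then {?K} else {})" for ks
      unfolding S by simp
  qed
  then show ?thesis unfolding M_def by simp
qed

lemma length_le_sum_list: "composition \<alpha> \<Longrightarrow> length \<alpha> \<le> sum_list \<alpha>"
  by (induction \<alpha>) (auto simp: Suc_le_eq)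

lemma finite_compositions: "finite {\<gamma>. composition \<gamma> \<and> sum_list \<gamma> = n}"
proof (rule finite_subset)
  show "{\<gamma>. composition \<gamma> \<and> sum_list \<gamma> = n} \<subseteq> {xs. set xs \<subseteq> {..n} \<and> length xs \<le> n}"
    by (auto simp: length_le_sum_list intro: member_le_sum_list)
qed (simp add: finite_lists_length_le)

lemma F_eq: "F \<beta> m = of_bool (coarsening \<beta> (exponents m))"
proof -
  have fin: "finite {\<gamma>. composition \<gamma> \<and> coarsening \<beta> \<gamma>}"
  proof (rule finite_subset[OF _ finite_compositions[of "sum_list \<beta>"]])
    show "{\<gamma>. composition \<gamma> \<and> coarsening \<beta> \<gamma>} \<subseteq> {\<gamma>. composition \<gamma> \<and> sum_list \<gamma> = sum_list \<beta>}"
      by (auto dest: coarsenings_props(1)[of \<beta>, unfolded set_coarsenings, simplified])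
  qed
  have "F \<beta> m = (\<Sum>\<gamma> | composition \<gamma> \<and> coarsening \<beta> \<gamma>. if \<gamma> = exponents m then 1 else 0)"
    unfolding F_def by (intro sum.cong) (auto simp: M_eq)
  also have "\<dots> = of_bool (coarsening \<beta> (exponents m))"
    using fin by (simp add: sum.delta' composition_exponents)
  finally show ?thesis .
qed

text \<open>The coefficient in the basis of the \<open>M\<^sub>\<gamma>\<close> is the sum over the coarsenings of \<open>\<gamma>\<close>, so that Moebius
inversion recovers the coefficients in the basis of the \<open>F\<^sub>\<alpha>\<close>.\<close>

lemma F_combination_eq:
  assumes "\<forall>\<alpha>\<in>Poly_Mapping.keys c. composition \<alpha>"
  shows "F_combination c m = coarsening_sum (Poly_Mapping.lookup c) (exponents m)"
proof -
  have "F_combination c m = (\<Sum>\<alpha>\<in>Poly_Mapping.keys c.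
      if \<alpha> \<in> set (coarsenings (exponents m)) then Poly_Mapping.lookup c \<alpha> else 0)"
    unfolding F_combination_def F_eq by (intro sum.cong) (auto simp: set_coarsenings)
  also have "\<dots> =
      (\<Sum>\<alpha>\<in>Poly_Mapping.keys c \<inter> set (coarsenings (exponents m)). Poly_Mapping.lookup c \<alpha>)"
    by (rule sum.inter_restrict[symmetric]) simp
  also have "\<dots> = (\<Sum>\<alpha>\<in>set (coarsenings (exponents m)). Poly_Mapping.lookup c \<alpha>)"
    by (intro sum.mono_neutral_left) (auto simp: in_keys_iff)
  also have "\<dots> = coarsening_sum (Poly_Mapping.lookup c) (exponents m)"
    using distinct_coarsenings[OF composition_exponents] by (simp add: sum_list_distinct_conv_sum_set)
  finally show ?thesis .
qed

lemma mset_exponents: "mset (exponents m) = image_mset (Poly_Mapping.lookup m) (mset_set (Poly_Mapping.keys m))"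
  using mset_set_set[of "sorted_list_of_set (Poly_Mapping.keys m)"] by (simp add: exponents_def)

lemma mset_exponents_map_key:
  assumes "bij \<pi>" shows "mset (exponents (Poly_Mapping.map_key \<pi> m)) = mset (exponents m)"
proof -
  have inj: "inj \<pi>" using assms bij_is_inj by blast
  have k: "Poly_Mapping.keys m = \<pi> ` Poly_Mapping.keys (Poly_Mapping.map_key \<pi> m)"
    using inj assms by (auto simp: keys_map_key bij_is_surj)
  have "mset (exponents m) = image_mset (Poly_Mapping.lookup m \<circ> \<pi>)
      (mset_set (Poly_Mapping.keys (Poly_Mapping.map_key \<pi> m)))"
    unfolding mset_exponents k
    by (subst image_mset_mset_set[symmetric]) (use inj in \<open>auto intro: inj_on_subset simp: image_mset.compositionality\<close>)
  then show ?thesis unfolding mset_exponents using inj by (simp add: map_key.rep_eq o_def)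
qed

lemma lookup_initial_monomial:
  "Poly_Mapping.lookup (initial_monomial \<delta>) i = (if i < length \<delta> then \<delta> ! i else 0)"
proof -
  have "Poly_Mapping.lookup (initial_monomial \<delta>) i = (\<Sum>j<length \<delta>. if i = j then \<delta> ! j else 0)"
    unfolding initial_monomial_def by (auto simp: lookup_sum lookup_single when_def intro!: sum.cong)
  then show ?thesis by simp
qed

lemma exponents_initial_monomial:
  assumes "composition \<delta>" shows "exponents (initial_monomial \<delta>) = \<delta>"
proof -
  have "\<delta> ! i \<noteq> 0" if "i < length \<delta>" for i
    using assms that nth_mem[of i \<delta>] by (metis composition_def)
  then have "Poly_Mapping.keys (initial_monomial \<delta>) = {0..<length \<delta>}"
    by (auto simp: in_keys_iff lookup_initial_monomial split: if_splits)
  then show ?thesis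
    unfolding exponents_def by (auto simp: lookup_initial_monomial intro!: nth_equalityI)
qed

text \<open>A permutation of the list \<open>\<delta>\<close> is realized by a permutation of the variables.\<close>

lemma symmetric_exponents:
  assumes "f \<in> symmetric_functions" "composition \<delta>" "mset \<delta> = mset \<delta>'"
  shows "f (initial_monomial \<delta>) = f (initial_monomial \<delta>')"
proof -
  obtain p where p: "p permutes {..<length \<delta>}" "permute_list p \<delta> = \<delta>'"
    using mset_eq_permutation[OF assms(3)[symmetric]] by metis
  have b: "bij p" using p(1) permutes_bij by blast
  have "Poly_Mapping.map_key p (initial_monomial \<delta>) = initial_monomial \<delta>'"
  proof (rule poly_mapping_eqI)
    fix i
    have "p i < length \<delta> \<longleftrightarrow> i < length \<delta>" using permutes_in_image[OF p(1), of i] by simp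
    then show "Poly_Mapping.lookup (Poly_Mapping.map_key p (initial_monomial \<delta>)) i =
        Poly_Mapping.lookup (initial_monomial \<delta>') i"
      using p b by (auto simp: map_key.rep_eq bij_is_inj lookup_initial_monomial permute_list_nth)
  qed
  moreover have "f (Poly_Mapping.map_key p (initial_monomial \<delta>)) = f (initial_monomial \<delta>)"
    using assms(1) b unfolding symmetric_functions_def by blast
  ultimately show ?thesis by simp
qed

lemma composition_mset_cong: "mset \<delta> = mset \<delta>' \<Longrightarrow> composition \<delta> \<longleftrightarrow> composition \<delta>'"
  by (metis composition_def mset_eq_setD)

text \<open>If the shapes agree, Moebius inversion expresses both coefficients by the same values. Conversely, the
series that is the monomial symmetric function of shape \<open>Y\<close> has at \<open>F\<^sub>\<beta>\<close> the coefficient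
plus or minus the number of coarsenings of \<open>\<beta>\<close> of shape \<open>Y\<close>; comparing absolute values spares
a comparison of the lengths.\<close>

theorem comp_equiv_iff_coarsening_shapes:
  assumes "composition \<beta>" "composition \<gamma>"
  shows "\<beta> \<sim>\<^sub>c \<gamma> \<longleftrightarrow> coarsening_shapes \<beta> = coarsening_shapes \<gamma>"
proof
  assume eq: "coarsening_shapes \<beta> = coarsening_shapes \<gamma>"
  show "\<beta> \<sim>\<^sub>c \<gamma>"
    unfolding comp_equiv_def
  proof (intro allI impI)
    fix c assume c: "(\<forall>\<alpha>\<in>Poly_Mapping.keys c. composition \<alpha>) \<and> F_combination c \<in> symmetric_functions"
    define d where "d = coarsening_sum (Poly_Mapping.lookup c)"
    have d: "d \<delta> = F_combination c (initial_monomial \<delta>)" if "composition \<delta>" for \<delta>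
      unfolding d_def using F_combination_eq[of c "initial_monomial \<delta>"] c that
      by (simp add: exponents_initial_monomial)
    define G where "G Y = d (sorted_list_of_multiset Y)" for Y
    have G: "d \<delta> = G (mset \<delta>)" if "composition \<delta>" for \<delta>
    proof -
      let ?\<delta> = "sorted_list_of_multiset (mset \<delta>)"
      have m: "mset \<delta> = mset ?\<delta>" by simp
      show ?thesis
        using symmetric_exponents[OF conjunct2[OF c] that m] d[OF that] d[of ?\<delta>]
          composition_mset_cong[OF m] that unfolding G_def by simp
    qed
    have l: "length \<beta> = length \<gamma>" using coarsening_shapes_length[OF eq] .
    have "Poly_Mapping.lookup c \<beta> = signed_coarsening_sum d \<beta>"
      unfolding d_def by (simp add: signed_coarsening_sum_inverse)
    also have "\<dots> = coarsening_sum (\<lambda>\<alpha>. (- 1) ^ (length \<beta> + length \<alpha>) * d \<alpha>) \<gamma>"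
      unfolding signed_coarsening_sum_def
    proof (rule coarsening_sum_symmetric[OF eq, where G = "\<lambda>Y. (- 1) ^ (length \<beta> + size Y) * G Y"])
      show "(- 1) ^ (length \<beta> + length \<alpha>) * d \<alpha> = (- 1) ^ (length \<beta> + size (mset \<alpha>)) * G (mset \<alpha>)"
        if "coarsening \<alpha> \<beta>" for \<alpha>
        using that G coarsenings_props(5)[of \<alpha> \<beta>] assms(1) set_coarsenings[of \<beta>] by simp
      show "(- 1) ^ (length \<beta> + length \<alpha>) * d \<alpha> = (- 1) ^ (length \<beta> + size (mset \<alpha>)) * G (mset \<alpha>)"
        if "coarsening \<alpha> \<gamma>" for \<alpha>
        using that G coarsenings_props(5)[of \<alpha> \<gamma>] assms(2) set_coarsenings[of \<gamma>] by simp
    qed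
    also have "\<dots> = signed_coarsening_sum d \<gamma>"
      unfolding signed_coarsening_sum_def l ..
    also have "\<dots> = Poly_Mapping.lookup c \<gamma>"
      unfolding d_def by (simp add: signed_coarsening_sum_inverse)
    finally show "Poly_Mapping.lookup c \<beta> = Poly_Mapping.lookup c \<gamma>" .
  qed
next
  assume equiv: "\<beta> \<sim>\<^sub>c \<gamma>"
  show "coarsening_shapes \<beta> = coarsening_shapes \<gamma>"
  proof (rule multiset_eqI)
    fix Y :: "nat multiset"
    \<comment> \<open>coefficients of the monomial symmetric function of shape \<open>Y\<close>\<close>
    define g :: "nat list \<Rightarrow> rat" where "g \<alpha> = of_bool (mset \<alpha> = Y)" for \<alpha>
    define h where "h \<alpha> = (if composition \<alpha> then signed_coarsening_sum g \<alpha> else 0)" for \<alpha>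
    have nz: "composition \<alpha> \<and> sum_list \<alpha> = sum_mset Y" if "h \<alpha> \<noteq> 0" for \<alpha>
    proof (rule ccontr)
      assume "\<not> (composition \<alpha> \<and> sum_list \<alpha> = sum_mset Y)"
      then have ne: "sum_list \<alpha> \<noteq> sum_mset Y" using that by (auto simp: h_def split: if_splits)
      have "signed_coarsening_sum g \<alpha> = signed_coarsening_sum (\<lambda>_. 0) \<alpha>"
      proof (rule signed_coarsening_sum_cong)
        fix \<delta> assume "\<delta> \<in> set (coarsenings \<alpha>)"
        then have "mset \<delta> \<noteq> Y" using ne coarsenings_props(1)[of \<delta> \<alpha>] by (auto simp: sum_mset_sum_list)
        then show "g \<delta> = 0" by (simp add: g_def)
      qed
      then show False using that by (simp add: h_def signed_coarsening_sum_def split: if_splits)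
    qed
    have fin: "finite {\<alpha>. h \<alpha> \<noteq> 0}"
      by (rule finite_subset[OF _ finite_compositions[of "sum_mset Y"]]) (use nz in blast)
    define c where "c = Abs_poly_mapping h"
    have lc: "Poly_Mapping.lookup c = h" unfolding c_def using fin by (simp add: Abs_poly_mapping_inverse)
    have kc: "\<forall>\<alpha>\<in>Poly_Mapping.keys c. composition \<alpha>" using nz by (auto simp: in_keys_iff lc)
    have F: "F_combination c m = g (exponents m)" for m
    proof -
      have "F_combination c m = coarsening_sum (signed_coarsening_sum g) (exponents m)"
        unfolding F_combination_eq[OF kc] lc
        by (intro sum_list_map_cong_set) (auto simp: h_def dest: coarsenings_props(5)[OF _ composition_exponents])
      then show ?thesis by (simp add: coarsening_sum_inverse)
    qed
    have "mono_deg m = sum_mset Y" if "g (exponents m) \<noteq> 0" for m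
    proof -
      have "mono_deg m = sum_mset (mset (exponents m))"
        unfolding mset_exponents by (simp add: mono_deg_def sum_unfold_sum_mset)
      then show ?thesis using that by (auto simp: g_def)
    qed
    then have "\<exists>d. \<forall>m. F_combination c m \<noteq> 0 \<longrightarrow> mono_deg m \<le> d"
      unfolding F by (metis order_refl)
    moreover have "\<forall>\<pi> m. bij \<pi> \<longrightarrow> F_combination c (Poly_Mapping.map_key \<pi> m) = F_combination c m"
      unfolding F g_def by (metis mset_exponents_map_key)
    ultimately have "F_combination c \<in> symmetric_functions"
      unfolding symmetric_functions_def by blast
    then have "h \<beta> = h \<gamma>" using equiv kc unfolding comp_equiv_def lc[symmetric] by blast
    then have e: "signed_coarsening_sum g \<beta> = signed_coarsening_sum g \<gamma>" using assms by (simp add: h_def)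
    have count: "signed_coarsening_sum g \<delta> =
        (- 1) ^ (length \<delta> + size Y) * of_nat (count (coarsening_shapes \<delta>) Y)" for \<delta>
    proof -
      have *: "(\<Sum>\<alpha>\<leftarrow>xs. (- 1) ^ (k + length \<alpha>) * g \<alpha>) =
          (- 1) ^ (k + size Y) * of_nat (count (mset (map mset xs)) Y)" for k xs
        by (induction xs) (auto simp: g_def algebra_simps)
      show ?thesis unfolding signed_coarsening_sum_def coarsening_shapes_def * ..
    qed
    have "\<bar>signed_coarsening_sum g \<delta>\<bar> = of_nat (count (coarsening_shapes \<delta>) Y)" for \<delta>
      unfolding count by (simp add: abs_mult power_abs)
    then have "(of_nat (count (coarsening_shapes \<beta>) Y) :: rat) = of_nat (count (coarsening_shapes \<gamma>) Y)"
      using e by metis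
    then show "count (coarsening_shapes \<beta>) Y = count (coarsening_shapes \<gamma>) Y" by simp
  qed
qed

section \<open>The coarsening polynomial and reversal of factors\<close>

text \<open>For all \<open>t\<close> together this is a polynomial in variables indexed by the parts; in terms of ribbon
Schur functions it is the expansion in complete homogeneous functions up to signs.\<close>

definition coarsening_polynomial :: "(nat \<Rightarrow> 'a::comm_semiring_1) \<Rightarrow> nat list \<Rightarrow> 'a" where
  "coarsening_polynomial t \<beta> = coarsening_sum (\<lambda>\<alpha>. prod_list (map t \<alpha>)) \<beta>"

lemma coarsening_polynomial_simps [simp]:
  "coarsening_polynomial t [x] = t x"
  "coarsening_polynomial t (x # y # ys) = t x * coarsening_polynomial t (y # ys) + coarsening_polynomial t ((x + y) # ys)"
  by (simp_all add: coarsening_polynomial_def o_def sum_list_const_mult)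

lemma coarsening_polynomial_Cons:
  "\<alpha> \<noteq> [] \<Longrightarrow> coarsening_polynomial t (x # \<alpha>) = t x * coarsening_polynomial t \<alpha> + coarsening_polynomial t ((x + hd \<alpha>) # tl \<alpha>)"
  by (cases \<alpha>) auto

lemma near_concat_Cons:
  "\<alpha> \<noteq> [] \<Longrightarrow> (x # \<alpha>) \<odot>\<^sub>c \<beta> = x # (\<alpha> \<odot>\<^sub>c \<beta>)"
  "(x + hd ((y # ys) \<odot>\<^sub>c \<beta>)) # tl ((y # ys) \<odot>\<^sub>c \<beta>) = ((x + y) # ys) \<odot>\<^sub>c \<beta>"
  by (auto simp: near_concat_def)

text \<open>A coarsening of \<open>\<alpha> \<cdot> \<beta>\<close> either respects the break between \<open>\<alpha>\<close> and \<open>\<beta>\<close> or not.\<close>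

lemma coarsening_polynomial_append:
  "\<alpha> \<noteq> [] \<Longrightarrow> \<beta> \<noteq> [] \<Longrightarrow>
    coarsening_polynomial t (\<alpha> @ \<beta>) = coarsening_polynomial t \<alpha> * coarsening_polynomial t \<beta> + coarsening_polynomial t (\<alpha> \<odot>\<^sub>c \<beta>)"
proof (induction \<alpha> rule: coarsenings.induct)
  case (2 x)
  then show ?case by (cases \<beta>) (simp_all add: near_concat_def)
next
  case (3 x y ys)
  have ne: "(y # ys) \<odot>\<^sub>c \<beta> \<noteq> []" by (simp add: near_concat_def)
  have "coarsening_polynomial t ((x # y # ys) \<odot>\<^sub>c \<beta>) =
      t x * coarsening_polynomial t ((y # ys) \<odot>\<^sub>c \<beta>) + coarsening_polynomial t (((x + y) # ys) \<odot>\<^sub>c \<beta>)"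
    using coarsening_polynomial_Cons[OF ne, of t x] near_concat_Cons(1)[of "y # ys" x \<beta>]
    by (simp add: near_concat_Cons(2))
  then show ?case using 3 by (simp add: algebra_simps)
qed simp

lemma lessThan_add: "{..<x + y} = {..<x} \<union> (+) x ` {..<y}" for x y :: nat
proof -
  have "k \<in> (+) x ` {..<y}" if "x \<le> k" "k < x + y" for k
    using that by (intro image_eqI[of _ _ "k - x"]) auto
  then show ?thesis by (intro set_eqI iffI) (auto, meson not_less)
qed

lemma near_power_concat_comp_circ:
  assumes "pos_composition (x # y # ys)" "pos_composition \<tau>"
  shows "near_power \<tau> x \<odot>\<^sub>c ((y # ys) \<circ>\<^sub>c \<tau>) = ((x + y) # ys) \<circ>\<^sub>c \<tau>"
proof (rule composition_eqI)
  let ?m = "sum_list \<tau>"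
  have x: "x > 0" and pos: "pos_composition (y # ys)" "pos_composition ((x + y) # ys)"
    using assms(1) by (auto simp: pos_composition_def)
  note np = near_power_props[OF assms(2) x]
  note cc = comp_circ_props[OF pos(1) assms(2)]
  note cc' = comp_circ_props[OF pos(2) assms(2)]
  note nc = near_concat_props[OF pos_compositionD(1)[OF np(1)] pos_compositionD(1)[OF cc(1)]]
  show "composition (near_power \<tau> x \<odot>\<^sub>c ((y # ys) \<circ>\<^sub>c \<tau>))"
    by (rule nc(4)) (simp_all add: np cc pos_compositionD)
  show "composition (((x + y) # ys) \<circ>\<^sub>c \<tau>)" by (simp add: cc' pos_compositionD)
  show "sum_list (near_power \<tau> x \<odot>\<^sub>c ((y # ys) \<circ>\<^sub>c \<tau>)) = sum_list (((x + y) # ys) \<circ>\<^sub>c \<tau>)"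
    unfolding nc(1) np(2) cc(2) cc'(2) by (simp add: algebra_simps)
  have "partial_sums (near_power \<tau> x \<odot>\<^sub>c ((y # ys) \<circ>\<^sub>c \<tau>)) =
     (\<Union>j<x. (+) (j * ?m) ` partial_sums \<tau>) \<union> (+) (x * ?m) ` ((\<lambda>j. j * ?m) ` partial_sums (y # ys) \<union>
          (\<Union>j<y + sum_list ys. (+) (j * ?m) ` partial_sums \<tau>))"
    unfolding nc(2) np cc by simp
  also have "\<dots> = partial_sums (((x + y) # ys) \<circ>\<^sub>c \<tau>)"
    unfolding cc'(3) partial_sums_merge image_Un image_UN image_image sum_list_simps add.assoc
      lessThan_add[of x] UN_Un
    by (simp add: add_mult_distrib add.assoc Un_ac)
  finally show "partial_sums (near_power \<tau> x \<odot>\<^sub>c ((y # ys) \<circ>\<^sub>c \<tau>)) = partial_sums (((x + y) # ys) \<circ>\<^sub>c \<tau>)" .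
qed

text \<open>Substitution law. Since \<open>(x \<rho>) \<circ> \<tau>\<close> is the near power of \<open>\<tau>\<close> followed by \<open>\<rho> \<circ> \<tau>\<close>, both sides obey
the same recursion for concatenation and near concatenation.\<close>

lemma coarsening_polynomial_comp_circ:
  assumes "pos_composition \<sigma>" "pos_composition \<tau>"
  shows "coarsening_polynomial t (\<sigma> \<circ>\<^sub>c \<tau>) = coarsening_polynomial (\<lambda>j. coarsening_polynomial t (near_power \<tau> j)) \<sigma>"
  using assms(1)
proof (induction \<sigma> rule: coarsenings.induct)
  case 1
  then show ?case by (simp add: pos_composition_def)
next
  case (2 x)
  then show ?case by (simp add: comp_circ_single)
next
  case (3 x y ys)
  have x: "x > 0" and pos: "pos_composition (y # ys)" "pos_composition ((x + y) # ys)"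
    using 3(3) by (auto simp: pos_composition_def)
  have ne: "near_power \<tau> x \<noteq> []" "(y # ys) \<circ>\<^sub>c \<tau> \<noteq> []"
    using near_power_props(1)[OF assms(2) x] comp_circ_props(1)[OF pos(1) assms(2)]
      pos_compositionD(1) by simp_all
  have "coarsening_polynomial t ((x # y # ys) \<circ>\<^sub>c \<tau>) = coarsening_polynomial t (near_power \<tau> x @ ((y # ys) \<circ>\<^sub>c \<tau>))"
    by (simp add: comp_circ_Cons)
  also have "\<dots> = coarsening_polynomial t (near_power \<tau> x) * coarsening_polynomial t ((y # ys) \<circ>\<^sub>c \<tau>) +
      coarsening_polynomial t (((x + y) # ys) \<circ>\<^sub>c \<tau>)"
    unfolding coarsening_polynomial_append[OF ne] near_power_concat_comp_circ[OF 3(3) assms(2)] ..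
  finally show ?case unfolding 3(1)[OF pos(1)] 3(2)[OF pos(2)] by simp
qed

lemma coarsening_polynomial_coarsening_shapes:
  assumes "coarsening_shapes \<beta> = coarsening_shapes \<gamma>" shows "coarsening_polynomial t \<beta> = coarsening_polynomial t \<gamma>"
  unfolding coarsening_polynomial_def
  by (rule coarsening_sum_symmetric[OF assms, where G = "\<lambda>Y. prod_mset (image_mset t Y)"])
    (simp_all flip: mset_map add: prod_mset_prod_list)

text \<open>Evaluating the variable of the part \<open>a\<close> at the monomial \<open>{#a#}\<close> of a monoid semiring keeps all
shapes apart.\<close>

lemma coarsening_shapes_of_polynomial:
  fixes t :: "nat \<Rightarrow> nat multiset \<Rightarrow>\<^sub>0 nat"
  assumes t: "t = (\<lambda>a. Poly_Mapping.single {#a#} 1)" and "coarsening_polynomial t \<beta> = coarsening_polynomial t \<gamma>"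
  shows "coarsening_shapes \<beta> = coarsening_shapes \<gamma>"
proof (rule multiset_eqI)
  fix Y
  have p: "prod_list (map t \<alpha>) = Poly_Mapping.single (mset \<alpha>) 1" for \<alpha>
  proof (induction \<alpha>)
    case Nil
    show ?case using single_one[where ?'a = "nat multiset" and ?'b = nat] by (simp del: One_nat_def add: zero_multiset_def)
  next
    case (Cons a \<alpha>)
    then show ?case by (simp add: t mult_single)
  qed
  have *: "Poly_Mapping.lookup (\<Sum>\<alpha>\<leftarrow>xs. prod_list (map t \<alpha>)) Y = count (mset (map mset xs)) Y" for xs
    by (induction xs) (auto simp: p lookup_add lookup_single when_def)
  show "count (coarsening_shapes \<beta>) Y = count (coarsening_shapes \<gamma>) Y"
    using assms(2) *[of "coarsenings \<beta>"] *[of "coarsenings \<gamma>"]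
    unfolding coarsening_polynomial_def coarsening_shapes_def by simp
qed

lemma coarsening_shapes_comp_circ:
  assumes "pos_composition \<sigma>" "pos_composition \<sigma>'" "pos_composition \<tau>"
    "coarsening_shapes \<sigma> = coarsening_shapes \<sigma>'"
  shows "coarsening_shapes (\<sigma> \<circ>\<^sub>c \<tau>) = coarsening_shapes (\<sigma>' \<circ>\<^sub>c \<tau>)"
  by (rule coarsening_shapes_of_polynomial[OF refl])
    (simp only: coarsening_polynomial_comp_circ assms(1-3) coarsening_polynomial_coarsening_shapes[OF assms(4)])

lemma coarsening_rev: "coarsening \<alpha> \<beta> \<Longrightarrow> coarsening (rev \<alpha>) (rev \<beta>)"
proof -
  assume "coarsening \<alpha> \<beta>"
  then obtain bs where "[] \<notin> set bs" "concat bs = \<beta>" "map sum_list bs = \<alpha>"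
    by (auto simp: coarsening_def)
  then show ?thesis
    unfolding coarsening_def
    by (intro exI[of _ "rev (map rev bs)"]) (auto simp: rev_concat rev_map o_def)
qed

lemma coarsening_shapes_rev:
  assumes "composition \<beta>" shows "coarsening_shapes (rev \<beta>) = coarsening_shapes \<beta>"
proof -
  have "set (coarsenings (rev \<beta>)) = set (map rev (coarsenings \<beta>))"
  proof -
    have "coarsening \<alpha> (rev \<beta>) \<longleftrightarrow> (\<exists>\<delta>. \<alpha> = rev \<delta> \<and> coarsening \<delta> \<beta>)" for \<alpha>
      using coarsening_rev[of \<alpha> "rev \<beta>"] coarsening_rev[of _ \<beta>] by (metis rev_rev_ident)
    then show ?thesis by (auto simp: set_coarsenings)
  qed
  moreover have "distinct (coarsenings (rev \<beta>))" "distinct (map rev (coarsenings \<beta>))"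
    using assms by (simp_all add: distinct_coarsenings distinct_map)
  ultimately have "mset (coarsenings (rev \<beta>)) = mset (map rev (coarsenings \<beta>))"
    using set_eq_iff_mset_eq_distinct by blast
  then show ?thesis
    by (simp add: coarsening_shapes_def image_mset.compositionality o_def)
qed

text \<open>Each entry of the second list is the corresponding entry of the first or its reversal.\<close>

abbreviation rev_choice :: "nat list list \<Rightarrow> nat list list \<Rightarrow> bool" where
  "rev_choice \<equiv> list_all2 (\<lambda>\<beta> \<gamma>. \<gamma> = \<beta> \<or> \<gamma> = rev \<beta>)"

lemma rev_choice_map_rev: "rev_choice \<beta>s \<gamma>s \<Longrightarrow> rev_choice \<beta>s (map rev \<gamma>s)"
  unfolding list.rel_map by (erule list_all2_mono) (metis rev_rev_ident)

lemma rev_choice_pos: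
  "rev_choice \<beta>s \<gamma>s \<Longrightarrow> \<forall>\<beta>\<in>set \<beta>s. pos_composition \<beta> \<Longrightarrow> \<forall>\<gamma>\<in>set \<gamma>s. pos_composition \<gamma>"
  by (induction rule: list_all2_induct) auto

text \<open>Induction from the right. If the last factor is reversed, reverse the whole composition, which
restores the last factor and turns the choice for the other factors into another choice for them.\<close>

theorem coarsening_shapes_rev_choice:
  assumes "rev_choice \<beta>s \<gamma>s" "\<forall>\<beta>\<in>set \<beta>s. pos_composition \<beta>"
  shows "coarsening_shapes (circ_list \<gamma>s) = coarsening_shapes (circ_list \<beta>s)"
  using assms
proof (induction \<beta>s arbitrary: \<gamma>s rule: rev_induct)
  case Nil
  then show ?case by simp
next
  case (snoc b \<beta>s)
  from snoc.prems(1) obtain \<gamma>s' g where \<gamma>s: "\<gamma>s = \<gamma>s' @ [g]" "rev_choice \<beta>s \<gamma>s'" "g = b \<or> g = rev b"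
    by (auto simp: list_all2_append1 list_all2_Cons1)
  have pos: "\<forall>\<beta>\<in>set \<beta>s. pos_composition \<beta>" "pos_composition b" using snoc.prems(2) by auto
  have pos': "\<forall>\<gamma>\<in>set \<gamma>s'. pos_composition \<gamma>" by (rule rev_choice_pos[OF \<gamma>s(2) pos(1)])
  have cb: "circ_list (\<beta>s @ [b]) = circ_list \<beta>s \<circ>\<^sub>c b" using pos by (subst circ_list_append) auto
  have key: "coarsening_shapes (circ_list \<delta>s \<circ>\<^sub>c b) = coarsening_shapes (circ_list \<beta>s \<circ>\<^sub>c b)"
    if "rev_choice \<beta>s \<delta>s" for \<delta>s
    using coarsening_shapes_comp_circ[OF _ _ pos(2) snoc.IH[OF that pos(1)]]
      circ_list_pos[OF pos(1)] circ_list_pos[OF rev_choice_pos[OF that pos(1)]] by blast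
  show ?case
    using \<gamma>s(3)
  proof
    assume "g = b"
    then have "circ_list \<gamma>s = circ_list \<gamma>s' \<circ>\<^sub>c b" using pos pos' \<gamma>s(1) by (simp add: circ_list_append)
    then show ?thesis using key[OF \<gamma>s(2)] cb by simp
  next
    assume g: "g = rev b"
    have c: "circ_list \<gamma>s = circ_list \<gamma>s' \<circ>\<^sub>c rev b" using pos pos' \<gamma>s(1) g by (simp add: circ_list_append)
    have p: "pos_composition (circ_list \<gamma>s' \<circ>\<^sub>c rev b)"
      using comp_circ_props(1)[of "circ_list \<gamma>s'" "rev b"] circ_list_pos[OF pos'] pos(2) by simp
    have "rev (circ_list \<gamma>s) = circ_list (map rev \<gamma>s') \<circ>\<^sub>c b"
      unfolding c using rev_comp_circ[of "circ_list \<gamma>s'" "rev b"] circ_list_pos[OF pos'] pos(2)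
        rev_circ_list[OF pos'] by simp
    then show ?thesis
      using key[OF rev_choice_map_rev[OF \<gamma>s(2)]] cb c
        coarsening_shapes_rev[OF pos_compositionD(2)[OF p]] by simp
  qed
qed

section \<open>Subgroups of the integers and absorption\<close>

definition int_subgroup :: "int set \<Rightarrow> bool" where
  "int_subgroup I \<longleftrightarrow> 0 \<in> I \<and> (\<forall>x\<in>I. \<forall>y\<in>I. x - y \<in> I)"

lemma int_subgroupI:
  assumes "0 \<in> I" "\<And>x y. x \<in> I \<Longrightarrow> y \<in> I \<Longrightarrow> x + y \<in> I" "\<And>x. x \<in> I \<Longrightarrow> - x \<in> I"
  shows "int_subgroup I"
proof -
  have "x - y \<in> I" if "x \<in> I" "y \<in> I" for x y
    using assms(2)[OF that(1) assms(3)[OF that(2)]] by simp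
  then show ?thesis using assms(1) by (simp add: int_subgroup_def)
qed

text \<open>Every subgroup of the integers is generated by its least positive element. Subgroups are used as sets
of periods, and this lemma extends a property from generators to all multiples of their gcd.\<close>

lemma int_subgroup_Gcd:
  assumes I: "int_subgroup I" and X: "X \<subseteq> I" and h: "Gcd X dvd h"
  shows "h \<in> I"
proof (cases "\<exists>x\<in>I. x \<noteq> 0")
  case False
  then have "X \<subseteq> {0}" using X by auto
  then have "Gcd X = 0" by (simp add: Gcd_0_iff)
  then have "h = 0" using h by (metis Gcd_0_iff dvd_0_left)
  then show ?thesis using I by (simp add: int_subgroup_def)
next
  case True
  have neg: "- x \<in> I" if "x \<in> I" for x
    using I that unfolding int_subgroup_def by (metis diff_0)
  have add: "x + y \<in> I" if "x \<in> I" "y \<in> I" for x y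
    using I neg[OF that(2)] that(1) unfolding int_subgroup_def by (metis diff_minus_eq_add)
  have mult_nat: "int k * x \<in> I" if "x \<in> I" for k x
  proof (induction k)
    case 0
    then show ?case using I by (simp add: int_subgroup_def)
  next
    case (Suc k)
    then show ?case using add[OF that Suc] by (simp add: algebra_simps)
  qed
  have mult: "k * x \<in> I" if "x \<in> I" for k x
  proof (cases "k \<ge> 0")
    case True
    then show ?thesis using mult_nat[OF that, of "nat k"] by simp
  next
    case False
    then show ?thesis using neg[OF mult_nat[OF that, of "nat (- k)"]] by simp
  qed
  define D where "D = {k::nat. k > 0 \<and> int k \<in> I}"
  have "D \<noteq> {}"
  proof -
    obtain x where x: "x \<in> I" "x \<noteq> 0" using True by blast
    then have "nat \<bar>x\<bar> \<in> D" using neg[OF x(1)] by (auto simp: D_def abs_if)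
    then show ?thesis by blast
  qed
  define d where "d = int (LEAST k. k \<in> D)"
  have "(LEAST k. k \<in> D) \<in> D" using \<open>D \<noteq> {}\<close> by (meson LeastI ex_in_conv)
  then have d: "d > 0" "d \<in> I" by (simp_all add: d_def D_def)
  have min: "k \<ge> d" if "k > 0" "k \<in> I" for k
    using Least_le[of "\<lambda>k. k \<in> D" "nat k"] that by (simp add: D_def d_def nat_le_eq_zle le_nat_iff)
  have "d dvd x" if "x \<in> I" for x
  proof -
    have "x mod d = x - (x div d) * d" by (simp add: minus_div_mult_eq_mod)
    then have "x mod d \<in> I" using I that mult[OF d(2)] by (simp add: int_subgroup_def)
    moreover have "0 \<le> x mod d" "x mod d < d" using d(1) by simp_all
    ultimately have "x mod d = 0" using min[of "x mod d"] by linarith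
    then show ?thesis by (simp add: dvd_eq_mod_eq_0)
  qed
  then have "d dvd Gcd X" using X by (intro Gcd_greatest) blast
  then have "d dvd h" using h by (rule dvd_trans)
  then show ?thesis using mult[OF d(2)] by (auto simp: dvd_def mult.commute)
qed

text \<open>\<open>P\<close> and \<open>Q\<close> are the points at which two odd functions \<open>v\<close> and \<open>v'\<close> with the same absolute value
agree and disagree. The last assumption is what the coarsenings with three parts tell about them. Say
that \<open>p\<close> absorbs \<open>q\<close> if \<open>p + q\<close> lies on the side of \<open>p\<close>. The situation is symmetric in \<open>P\<close> and
\<open>Q\<close>.\<close>

locale absorption =
  fixes P Q :: "int set" and v :: "int \<Rightarrow> int" and n :: int
  assumes n_pos: "n > 0"
    and uminus_P: "x \<in> P \<Longrightarrow> - x \<in> P" and uminus_Q: "x \<in> Q \<Longrightarrow> - x \<in> Q"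
    and periodic_P: "x \<in> P \<Longrightarrow> x + k * n \<in> P" and periodic_Q: "x \<in> Q \<Longrightarrow> x + k * n \<in> Q"
    and zero_P: "0 \<notin> P" and zero_Q: "0 \<notin> Q"
    and disjoint: "x \<in> P \<Longrightarrow> x \<notin> Q"
    and odd: "v (- x) = - v x"
    and nonzero_P: "x \<in> P \<Longrightarrow> v x \<noteq> 0" and nonzero_Q: "x \<in> Q \<Longrightarrow> v x \<noteq> 0"
    and absorb: "p \<in> P \<Longrightarrow> q \<in> Q \<Longrightarrow> p + q \<in> P \<and> v (p + q) = v p \<or> p + q \<in> Q \<and> v (p + q) = v q"
begin

lemma swap: "absorption Q P v n"
proof
  show "\<And>x. x \<in> Q \<Longrightarrow> x \<notin> P" using disjoint by blast
  fix p q assume "p \<in> Q" "q \<in> P"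
  then show "p + q \<in> Q \<and> v (p + q) = v p \<or> p + q \<in> P \<and> v (p + q) = v q"
    using absorb[of q p] by (auto simp: add.commute)
qed (use n_pos uminus_P uminus_Q periodic_P periodic_Q zero_P zero_Q odd nonzero_P nonzero_Q in auto)

lemma convex:
  assumes "x \<in> P" "y \<in> P" "v x = v y" shows "x + y \<notin> Q"
proof
  assume "x + y \<in> Q"
  from absorb[OF uminus_P[OF assms(2)] this] disjoint[OF assms(1)]
  have "v x = - v y" by (simp add: odd)
  then show False using assms nonzero_P[of x] by simp
qed

lemma absorb_value: "p \<in> P \<Longrightarrow> q \<in> Q \<Longrightarrow> p + q \<in> P \<Longrightarrow> v (p + q) = v p"
  using absorb[of p q] disjoint by blast

lemma absorbed_value: "p \<in> P \<Longrightarrow> q \<in> Q \<Longrightarrow> p + q \<in> Q \<Longrightarrow> v (p + q) = v q"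
  using absorb[of p q] disjoint by blast

lemma absorb_cases: "p \<in> P \<Longrightarrow> q \<in> Q \<Longrightarrow> p + q \<in> P \<or> p + q \<in> Q"
  using absorb by blast

text \<open>If \<open>p\<close> absorbed \<open>q\<close> but not \<open>- q\<close>, then by induction all positive multiples of \<open>p\<close>, and
their sums with \<open>q\<close>, would lie in \<open>P\<close> with the value of \<open>p\<close>: step from \<open>k p\<close> to \<open>k p + q\<close> to
\<open>(k + 1) p = (k p + q) + (p - q)\<close>, where \<open>convex\<close> excludes \<open>Q\<close> each time. But \<open>n p\<close> is a period
and cannot lie in \<open>P\<close>.\<close>

lemma absorb_minus:
  assumes p: "p \<in> P" and q: "q \<in> Q" and pq: "p + q \<in> P" shows "p - q \<in> P"
proof (rule ccontr)
  assume "p - q \<notin> P"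
  then have m: "p - q \<in> Q" using absorb_cases[OF p uminus_Q[OF q]] by simp
  have "int (Suc k) * p \<in> P \<and> v (int (Suc k) * p) = v p \<and>
      int (Suc k) * p + q \<in> P \<and> v (int (Suc k) * p + q) = v p" for k
  proof (induction k)
    case 0
    then show ?case using p pq absorb_value[OF p q pq] by simp
  next
    case (Suc k)
    define a where "a = int (Suc k) * p"
    have IH: "a \<in> P" "v a = v p" "a + q \<in> P" "v (a + q) = v p" using Suc by (simp_all add: a_def)
    have e: "a + q + (p - q) = a + p" "a + p + q = a + q + p" by simp_all
    have "a + p \<in> P" using absorb_cases[OF IH(3) m] convex[OF IH(1) p IH(2)] unfolding e by blast
    moreover from this have va: "v (a + p) = v p" using absorb_value[OF IH(3) m] IH(4) unfolding e by simp
    ultimately have "a + p + q \<in> P"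
      using absorb_cases[OF _ q, of "a + p"] convex[OF IH(3) p IH(4)] unfolding e by blast
    moreover have "int (Suc (Suc k)) * p = a + p" by (simp add: a_def algebra_simps)
    ultimately show ?case
      using \<open>a + p \<in> P\<close> va absorb_value[OF \<open>a + p \<in> P\<close> q] by metis
  qed
  \<comment> \<open>\<open>n * p\<close> differs from \<open>0\<close> by the multiple \<open>p * n\<close> of the period\<close>
  from this[of "nat n - 1"] have "n * p \<in> P" using n_pos by (simp add: Suc_nat_eq_nat_zadd1)
  from periodic_P[OF this, of "- p"] show False using zero_P by simp
qed

lemma absorbed_minus:
  assumes "p \<in> P" "q \<in> Q" "p + q \<in> Q" shows "q - p \<in> Q"
  using absorption.absorb_minus[OF swap assms(2,1)] assms(3) by (simp add: add.commute)

text \<open>Otherwise \<open>p + q + r\<close> lies in \<open>Q\<close> with the value of \<open>q\<close> and of \<open>r\<close>, while \<open>p + q - r\<close> lies in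
\<open>Q\<close> with the value of \<open>q\<close> and the opposite of the value of \<open>r\<close>. Consequently the set of elements
absorbed by \<open>p\<close> does not change when an absorbed element is added to \<open>p\<close>.\<close>

lemma absorb_add:
  assumes p: "p \<in> P" and q: "q \<in> Q" and r: "r \<in> Q" and pq: "p + q \<in> P" and pr: "p + r \<in> P"
  shows "p + q + r \<in> P"
proof (rule ccontr)
  assume "p + q + r \<notin> P"
  then have x: "p + q + r \<in> Q" using absorb_cases[OF pq r] by simp
  have "v (p + q + r) = v r" using absorbed_value[OF pq r x] .
  moreover have "v (p + q + r) = v q"
    using absorbed_value[OF pr q] x by (simp add: algebra_simps)
  moreover have y: "- (p + q) + r \<in> Q" using absorbed_minus[OF pq r x] by (simp add: algebra_simps)
  have "v (- (p + q) + r) = v r" using absorbed_value[OF uminus_P[OF pq] r y] .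
  then have "v (p + q - r) = - v r" using odd[of "p + q - r"] by (simp add: algebra_simps)
  moreover have "p - r + q \<in> Q" using uminus_Q[OF y] by (simp add: algebra_simps)
  then have "v (p - r + q) = v q" using absorbed_value[OF absorb_minus[OF p r pr] q] by simp
  then have "v (p + q - r) = v q" by (simp add: algebra_simps)
  ultimately show False using nonzero_Q[OF q] by simp
qed

lemma absorb_same:
  assumes p: "p \<in> P" and q: "q \<in> Q" and r: "r \<in> Q" and pq: "p + q \<in> P" and pqr: "p + q + r \<in> P"
  shows "p + r \<in> P"
  using absorb_add[OF pq uminus_Q[OF q] r] p pqr by simp

text \<open>If \<open>p'\<close> absorbs \<open>q\<close> and \<open>q\<close> absorbs \<open>p\<close>, then \<open>p'\<close> also absorbs \<open>p + q\<close>, and \<open>p'\<close> plus the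
difference \<open>(p + q) - q\<close> stays in \<open>P\<close>.\<close>

lemma absorb_two_step:
  assumes p': "p' \<in> P" and q: "q \<in> Q" and p: "p \<in> P" and 1: "p' + q \<in> P" and 2: "p + q \<in> Q"
  shows "p' + p \<in> P" "v (p' + p) = v p'"
proof -
  have 3: "p' + (p + q) \<in> P"
  proof (rule ccontr)
    assume "p' + (p + q) \<notin> P"
    then have "p' + (p + q) \<in> Q" using absorb_cases[OF p' 2] by blast
    then have "q + p' \<in> Q"
      using absorption.absorb_same[OF swap q p p'] 2 by (simp add: algebra_simps)
    then show False using 1 disjoint by (simp add: add.commute)
  qed
  have 4: "p' + (p + q) + - q \<in> P"
    using absorb_add[OF p' 2 uminus_Q[OF q] 3] absorb_minus[OF p' q 1] by simp
  then show "p' + p \<in> P" by simp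
  have "v (p' + (p + q) + - q) = v (p' + (p + q))" using absorb_value[OF 3 uminus_Q[OF q] 4] .
  also have "\<dots> = v p'" using absorb_value[OF p' 2 3] .
  finally show "v (p' + p) = v p'" by simp
qed

text \<open>A cycle \<open>p'\<close>, \<open>q\<close>, \<open>p\<close>, \<open>r\<close> of absorptions would, by \<open>absorb_two_step\<close> in both directions,
give \<open>v (p' - p)\<close> the value of \<open>p'\<close> and the opposite of the value of \<open>p\<close>, although
\<open>v (p' + p)\<close> equals both.\<close>

lemma absorb_trans:
  assumes p': "p' \<in> P" and q: "q \<in> Q" and p: "p \<in> P" and r: "r \<in> Q"
    and 1: "p' + q \<in> P" and 2: "p + q \<in> Q" and 3: "p + r \<in> P"
  shows "p' + r \<in> P"
proof (rule ccontr)
  assume "p' + r \<notin> P"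
  then have 4: "p' + r \<in> Q" using absorb_cases[OF p' r] by blast
  have m2: "- p + q \<in> Q" using absorbed_minus[OF p q 2] by simp
  have m4: "- p' + r \<in> Q" using absorbed_minus[OF p' r 4] by simp
  have "v (p' + p) = v p'" "v (p' + - p) = v p'"
    using absorb_two_step(2)[OF p' q p 1 2] absorb_two_step(2)[OF p' q uminus_P[OF p] 1 m2] by auto
  moreover have "v (p + p') = v p" "v (p + - p') = v p"
    using absorb_two_step(2)[OF p r p' 3 4] absorb_two_step(2)[OF p r uminus_P[OF p'] 3 m4] by auto
  moreover have "v (p' + - p) = - v (p + - p')" using odd[of "p + - p'"] by simp
  ultimately show False using nonzero_P[OF p] by (simp add: add.commute)
qed

lemma periodic_P_iff: "x + k * n \<in> P \<longleftrightarrow> x \<in> P"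
  using periodic_P[of x k] periodic_P[of "x + k * n" "- k"] by auto

text \<open>Take \<open>p\<close> absorbing as many residues as possible. If it does not absorb \<open>q\<close>, then \<open>q\<close> absorbs \<open>p\<close>,
and by transitivity any \<open>p'\<close> absorbing \<open>q\<close> would absorb more than \<open>p\<close>; so \<open>q\<close> absorbs all of \<open>P\<close>.\<close>

lemma dominating_element:
  assumes "P \<noteq> {}"
  shows "(\<exists>p\<in>P. \<forall>q\<in>Q. p + q \<in> P) \<or> (\<exists>q\<in>Q. \<forall>p\<in>P. q + p \<in> Q)"
proof -
  \<comment> \<open>residues modulo \<open>n\<close> make the sets of absorbed elements finite\<close>
  define A where "A p = {q \<in> Q. 0 \<le> q \<and> q < n \<and> p + q \<in> P}" for p
  have fin: "finite (A p)" for p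
    by (rule finite_subset[of _ "{0..<n}"]) (auto simp: A_def)
  have bound: "card (A p) \<le> nat n" for p
    using card_mono[of "{0..<n}" "A p"] by (simp add: A_def subset_iff)
  obtain p0 where "p0 \<in> P" using assms by blast
  then obtain p where p: "p \<in> P" "\<And>p'. p' \<in> P \<Longrightarrow> card (A p') \<le> card (A p)"
    using ex_has_greatest_nat[of "\<lambda>p. p \<in> P" p0 "\<lambda>p. card (A p)" "Suc (nat n)"] bound
    by (auto simp: less_Suc_eq_le)
  show ?thesis
  proof (cases "\<forall>q\<in>Q. p + q \<in> P")
    case True
    then show ?thesis using p by blast
  next
    case False
    then obtain q where q: "q \<in> Q" "p + q \<notin> P" by blast
    then have pq: "p + q \<in> Q" using absorb_cases[OF p(1)] by blast
    show ?thesis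
    proof (cases "\<forall>p'\<in>P. q + p' \<in> Q")
      case True
      then show ?thesis using q by blast
    next
      case False
      then obtain p' where p': "p' \<in> P" "q + p' \<notin> Q" by blast
      then have p'q: "p' + q \<in> P" using absorb_cases[OF p'(1) q(1)] by (simp add: add.commute)
      have sub: "A p \<subseteq> A p'"
        using absorb_trans[OF p'(1) q(1) p(1) _ p'q pq] by (auto simp: A_def)
      have m: "q mod n = q + (- (q div n)) * n" by (simp add: minus_div_mult_eq_mod[symmetric])
      have "q mod n \<in> Q" unfolding m using periodic_Q q(1) by blast
      moreover have "p' + q mod n \<in> P" "p + q mod n \<notin> P"
        using periodic_P_iff[of "p' + q" "- (q div n)"] periodic_P_iff[of "p + q" "- (q div n)"] p'q q(2)
        unfolding m by (simp_all add: add_diff_eq)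
      ultimately have "q mod n \<in> A p'" "q mod n \<notin> A p" using n_pos by (auto simp: A_def)
      then have "card (A p) < card (A p')" using sub fin by (intro psubset_card_mono) auto
      then show ?thesis using p(2)[OF p'(1)] by simp
    qed
  qed
qed

text \<open>An element absorbing all of \<open>Q\<close> stays in \<open>P\<close> under translation by the whole subgroup, hence cannot
be moved to \<open>0\<close>.\<close>

lemma dominating_not_generated:
  assumes "p \<in> P" "\<forall>q\<in>Q. p + q \<in> P"
  shows "\<not> Gcd (insert n Q) dvd p"
proof
  assume dvd: "Gcd (insert n Q) dvd p"
  \<comment> \<open>the elements that absorb all of \<open>Q\<close> are permuted by translations with \<open>Q\<close>\<close>
  define D where "D = {p \<in> P. \<forall>q\<in>Q. p + q \<in> P}"
  define I where "I = {h. \<forall>x\<in>D. x + h \<in> D \<and> x - h \<in> D}"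
  have "int_subgroup I"
  proof (rule int_subgroupI)
    fix x y assume "x \<in> I" "y \<in> I"
    then show "x + y \<in> I" unfolding I_def
      by (auto simp: add.assoc[symmetric] diff_diff_eq[symmetric])
  qed (auto simp: I_def)
  moreover have "insert n Q \<subseteq> I"
  proof -
    have "x + q \<in> D" if "x \<in> D" "q \<in> Q" for x q
      using that absorb_add[of x q] by (auto simp: D_def)
    from this[of _ _] this[OF _ uminus_Q] have "Q \<subseteq> I" by (auto simp: I_def)
    moreover have "n \<in> I"
    proof -
      have "x + k * n \<in> D" if "x \<in> D" for x k
        using that periodic_P_iff[of x k] periodic_P_iff[of "x + q" k for q]
        by (auto simp: D_def algebra_simps)
      from this[of _ 1] this[of _ "-1"] show ?thesis by (auto simp: I_def)
    qed
    ultimately show ?thesis by blast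
  qed
  ultimately have "p \<in> I" using dvd by (rule int_subgroup_Gcd)
  then have "p - p \<in> D" using assms by (auto simp: I_def D_def)
  then show False using zero_P by (simp add: D_def)
qed

theorem not_mutually_generated:
  assumes "P \<noteq> {}"
  shows "(\<exists>p\<in>P. \<not> Gcd (insert n Q) dvd p) \<or> (\<exists>q\<in>Q. \<not> Gcd (insert n P) dvd q)"
  using dominating_element[OF assms] dominating_not_generated
    absorption.dominating_not_generated[OF swap] by blast

end

section \<open>Sums over arrangements of parts\<close>

text \<open>The arrangements of a list are listed by inserting its first entry everywhere, because the main
cancellation compares exactly these insertions: at the front, at the end and in between.\<close>

definition insertions :: "'a \<Rightarrow> 'a list \<Rightarrow> 'a list list" where
  "insertions a ys = map (\<lambda>j. take j ys @ a # drop j ys) [0..<Suc (length ys)]"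

fun arrangements :: "'a list \<Rightarrow> 'a list list" where
  "arrangements [] = [[]]"
| "arrangements (a # xs) = concat (map (insertions a) (arrangements xs))"

lemma mset_arrangements: "ys \<in> set (arrangements zs) \<Longrightarrow> mset ys = mset zs"
proof (induction zs arbitrary: ys)
  case (Cons a zs)
  then obtain w j where w: "w \<in> set (arrangements zs)" "ys = take j w @ a # drop j w"
    by (auto simp: insertions_def simp del: upt_Suc)
  have "mset ys = add_mset a (mset (take j w @ drop j w))"
    unfolding w(2) mset_append mset.simps by simp
  then show ?case using Cons.IH[OF w(1)] by simp
qed simp

lemma length_arrangements: "ys \<in> set (arrangements zs) \<Longrightarrow> length ys = length zs"
  using mset_arrangements mset_eq_length by blast

lemma sum_list_insertions:
  "sum_list (map f (insertions a ys)) = (\<Sum>j\<le>length ys. f (take j ys @ a # drop j ys))"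
  for f :: "'a list \<Rightarrow> 'b::comm_monoid_add"
proof -
  have "sum_list (map f (insertions a ys)) = (\<Sum>j\<in>set [0..<Suc (length ys)]. f (take j ys @ a # drop j ys))"
    unfolding insertions_def map_map o_def by (subst sum_list_distinct_conv_sum_set) simp_all
  also have "set [0..<Suc (length ys)] = {..length ys}" by auto
  finally show ?thesis .
qed

lemma sum_list_arrangements_Cons:
  "sum_list (map f (arrangements (a # zs))) =
    (\<Sum>ys\<leftarrow>arrangements zs. \<Sum>j\<le>length ys. f (take j ys @ a # drop j ys))"
  for f :: "'a list \<Rightarrow> 'b::comm_monoid_add"
proof -
  have "sum_list (map f (concat (map (insertions a) xs))) =
      (\<Sum>ys\<leftarrow>xs. \<Sum>j\<le>length ys. f (take j ys @ a # drop j ys))" for xs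
    by (induction xs) (simp_all add: sum_list_insertions)
  then show ?thesis by simp
qed

text \<open>\<open>path \<chi> k ys\<close> tests whether all proper partial sums of \<open>ys\<close>, started at \<open>k\<close>, lie in the set with
indicator \<open>\<chi>\<close>; the end point is not tested. For \<open>k = 0\<close> and \<open>ys\<close> of total \<open>n\<close> this says that
\<open>ys\<close> is a coarsening, and \<open>path_sum\<close> counts the coarsenings of a given shape (with a multiplicity
depending on the shape only).\<close>

definition path :: "(int \<Rightarrow> int) \<Rightarrow> int \<Rightarrow> int list \<Rightarrow> int" where
  "path \<chi> k ys = (\<Prod>i\<in>{0<..<length ys}. \<chi> (k + sum_list (take i ys)))"

definition path_sum :: "(int \<Rightarrow> int) \<Rightarrow> int \<Rightarrow> int list \<Rightarrow> int" where
  "path_sum \<chi> k zs = (\<Sum>ys\<leftarrow>arrangements zs. path \<chi> k ys)"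

lemma path_cong:
  "(\<And>i. 0 < i \<Longrightarrow> i < length ys \<Longrightarrow> \<chi> (k + sum_list (take i ys)) = \<chi>' (k' + sum_list (take i ys))) \<Longrightarrow>
    path \<chi> k ys = path \<chi>' k' ys"
  unfolding path_def by (intro prod.cong) auto

lemma path_Cons:
  assumes "ys \<noteq> []" shows "path \<chi> k (a # ys) = \<chi> (k + a) * path \<chi> (k + a) ys"
proof -
  have "{0<..<length (a # ys)} = insert 1 (Suc ` {0<..<length ys})"
  proof (rule set_eqI)
    show "i \<in> {0<..<length (a # ys)} \<longleftrightarrow> i \<in> insert 1 (Suc ` {0<..<length ys})" for i
      using assms by (cases i) auto
  qed
  moreover have "1 \<notin> Suc ` {0<..<length ys}" by auto
  ultimately have "path \<chi> k (a # ys) = \<chi> (k + a) * (\<Prod>i\<in>Suc ` {0<..<length ys}. \<chi> (k + sum_list (take i (a # ys))))"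
    unfolding path_def by simp
  also have "(\<Prod>i\<in>Suc ` {0<..<length ys}. \<chi> (k + sum_list (take i (a # ys)))) = path \<chi> (k + a) ys"
    unfolding path_def by (subst prod.reindex) (simp_all add: add.assoc)
  finally show ?thesis .
qed

lemma path_snoc:
  assumes "ys \<noteq> []" shows "path \<chi> k (ys @ [a]) = path \<chi> k ys * \<chi> (k + sum_list ys)"
proof -
  have "{0<..<length (ys @ [a])} = insert (length ys) {0<..<length ys}"
    using assms by auto
  then have "path \<chi> k (ys @ [a]) = \<chi> (k + sum_list ys) * (\<Prod>i\<in>{0<..<length ys}. \<chi> (k + sum_list (take i (ys @ [a]))))"
    unfolding path_def by simp
  also have "(\<Prod>i\<in>{0<..<length ys}. \<chi> (k + sum_list (take i (ys @ [a])))) = path \<chi> k ys"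
    unfolding path_def by (intro prod.cong) simp_all
  finally show ?thesis by simp
qed

lemma path_two: "path \<chi> k [x, y] = \<chi> (k + x)"
  using path_Cons[of "[y]" \<chi> k x] by (simp add: path_def)

lemma path_three: "path \<chi> k [x, y, z] = \<chi> (k + x) * \<chi> (k + x + y)"
  using path_Cons[of "[y, z]" \<chi> k x] by (simp add: path_two)

lemma path_sum_two: "path_sum \<chi> k [x, y] = \<chi> (k + x) + \<chi> (k + y)"
  by (simp add: path_sum_def insertions_def path_two)

lemma path_sum_three:
  "path_sum \<chi> k [x, y, z] =
    \<chi> (k + x) * \<chi> (k + x + y) + \<chi> (k + x) * \<chi> (k + x + z) +
    \<chi> (k + y) * \<chi> (k + y + x) + \<chi> (k + y) * \<chi> (k + y + z) +
    \<chi> (k + z) * \<chi> (k + z + x) + \<chi> (k + z) * \<chi> (k + z + y)"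
  by (simp add: path_sum_def insertions_def path_three)

text \<open>No sum over a proper nonempty part of the list is divisible by \<open>m\<close>.\<close>

definition avoiding :: "int \<Rightarrow> int list \<Rightarrow> bool" where
  "avoiding m zs \<longleftrightarrow> (\<forall>ys i. mset ys = mset zs \<longrightarrow> 0 < i \<longrightarrow> i < length ys \<longrightarrow>
     \<not> m dvd sum_list (take i ys))"

lemma avoidingD:
  "avoiding m zs \<Longrightarrow> ys \<in> set (arrangements zs) \<Longrightarrow> 0 < i \<Longrightarrow> i < length ys \<Longrightarrow>
    \<not> m dvd sum_list (take i ys)"
  unfolding avoiding_def using mset_arrangements by blast

lemma path_sum_cong:
  assumes "avoiding m zs" "m dvd c" "\<And>x. \<not> m dvd x \<Longrightarrow> \<chi> (k + x) = \<chi>' (k' + x)"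
  shows "path_sum \<chi> (k + c) zs = path_sum \<chi>' (k' + c) zs"
  unfolding path_sum_def
proof (intro arg_cong[of _ _ sum_list] map_cong refl path_cong)
  fix ys i assume "ys \<in> set (arrangements zs)" "0 < i" "i < length ys"
  then have "\<not> m dvd sum_list (take i ys)" using avoidingD[OF assms(1)] by blast
  then have "\<not> m dvd c + sum_list (take i ys)" using assms(2) by (simp add: dvd_add_right_iff)
  then show "\<chi> (k + c + sum_list (take i ys)) = \<chi>' (k' + c + sum_list (take i ys))"
    using assms(3)[of "c + sum_list (take i ys)"] by (simp add: add.assoc)
qed

text \<open>If two functions agree off the multiples of \<open>m\<close>, then inserting a multiple \<open>a\<close> of \<open>m\<close> in the interior
of an arrangement that avoids \<open>m\<close> produces equal terms, as only points off the multiples of \<open>m\<close>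
are visited. Only the insertions at the two ends survive.\<close>

lemma path_sum_Cons_diff:
  assumes av: "avoiding m zs" and zs: "zs \<noteq> []" and a: "m dvd a"
    and eq: "\<And>x. \<not> m dvd x \<Longrightarrow> \<chi> (k + x) = \<chi>' (k' + x)"
  shows "path_sum \<chi> k (a # zs) - path_sum \<chi>' k' (a # zs) =
    (\<chi> (k + a) - \<chi>' (k' + a)) * path_sum \<chi> (k + a) zs +
    (\<chi> (k + sum_list zs) - \<chi>' (k' + sum_list zs)) * path_sum \<chi> k zs"
proof -
  have inner: "(\<Sum>j\<le>length ys. path \<chi> k (take j ys @ a # drop j ys)) -
      (\<Sum>j\<le>length ys. path \<chi>' k' (take j ys @ a # drop j ys)) =
      (\<chi> (k + a) - \<chi>' (k' + a)) * path \<chi> (k + a) ys +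
      (\<chi> (k + sum_list zs) - \<chi>' (k' + sum_list zs)) * path \<chi> k ys"
    if ys: "ys \<in> set (arrangements zs)" for ys
  proof -
    have len: "length ys = length zs" "ys \<noteq> []" using length_arrangements[OF ys] zs by auto
    have sum: "sum_list ys = sum_list zs"
      using mset_arrangements[OF ys] by (metis sum_mset_sum_list)
    have nd: "\<not> m dvd sum_list (take i ys)" if "0 < i" "i < length ys" for i
      using avoidingD[OF av ys that] .
    have nda: "\<not> m dvd a + sum_list (take i ys)" if "0 < i" "i < length ys" for i
      using nd[OF that] a by (simp add: dvd_add_right_iff)
    have p1: "path \<chi> (k + a) ys = path \<chi>' (k' + a) ys"
    proof (rule path_cong)
      fix i assume "0 < i" "i < length ys"
      from eq[OF nda[OF this]]
      show "\<chi> (k + a + sum_list (take i ys)) = \<chi>' (k' + a + sum_list (take i ys))"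
        by (simp add: add.assoc)
    qed
    have p2: "path \<chi> k ys = path \<chi>' k' ys"
      by (rule path_cong) (use eq nd in blast)
    have mid: "path \<chi> k (take j ys @ a # drop j ys) = path \<chi>' k' (take j ys @ a # drop j ys)"
      if j: "0 < j" "j < length ys" for j
    proof (rule path_cong)
      fix i assume i: "0 < i" "i < length (take j ys @ a # drop j ys)"
      show "\<chi> (k + sum_list (take i (take j ys @ a # drop j ys))) =
        \<chi>' (k' + sum_list (take i (take j ys @ a # drop j ys)))"
      proof (cases "i \<le> j")
        case True
        then have "take i (take j ys @ a # drop j ys) = take i ys" using j by (simp add: min_def)
        then show ?thesis using eq[OF nd[of i]] i True j by simp
      next
        case False
        then obtain d where d: "i = Suc (j + d)" using less_iff_Suc_add[of j i] by auto
        have "take (j + d) ys = take j ys @ take d (drop j ys)" by (rule take_add)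
        then have "sum_list (take i (take j ys @ a # drop j ys)) = a + sum_list (take (j + d) ys)"
          using j d by simp
        then show ?thesis using eq[OF nda[of "j + d"]] i j d by (simp add: add.left_commute)
      qed
    qed
    have split: "{..length ys} = insert 0 (insert (length ys) {0<..<length ys})" using len(2) by auto
    have S: "(\<Sum>j\<le>length ys. f j) = f 0 + f (length ys) + (\<Sum>j\<in>{0<..<length ys}. f j)" for f :: "nat \<Rightarrow> int"
      unfolding split using len(2) by simp
    have "(\<Sum>j\<in>{0<..<length ys}. path \<chi> k (take j ys @ a # drop j ys)) =
        (\<Sum>j\<in>{0<..<length ys}. path \<chi>' k' (take j ys @ a # drop j ys))"
      by (intro sum.cong) (use mid in auto)
    then show ?thesis
      unfolding S using len(2) p1 p2 sum by (simp add: path_Cons path_snoc algebra_simps)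
  qed
  have "path_sum \<chi> k (a # zs) - path_sum \<chi>' k' (a # zs) =
    (\<Sum>ys\<leftarrow>arrangements zs. (\<Sum>j\<le>length ys. path \<chi> k (take j ys @ a # drop j ys)) -
      (\<Sum>j\<le>length ys. path \<chi>' k' (take j ys @ a # drop j ys)))"
    unfolding path_sum_def sum_list_arrangements_Cons by (simp add: sum_list_subtractf)
  also have "\<dots> = (\<Sum>ys\<leftarrow>arrangements zs. (\<chi> (k + a) - \<chi>' (k' + a)) * path \<chi> (k + a) ys +
      (\<chi> (k + sum_list zs) - \<chi>' (k' + sum_list zs)) * path \<chi> k ys)"
    by (intro arg_cong[of _ _ sum_list] map_cong refl inner)
  also have "\<dots> = (\<chi> (k + a) - \<chi>' (k' + a)) * path_sum \<chi> (k + a) zs +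
      (\<chi> (k + sum_list zs) - \<chi>' (k' + sum_list zs)) * path_sum \<chi> k zs"
    unfolding path_sum_def by (simp add: sum_list_addf sum_list_const_mult)
  finally show ?thesis .
qed

text \<open>Paths of length \<open>N\<close> that avoid the multiples of \<open>m\<close> cannot tell, after summation over all
arrangements, whether they start at \<open>k\<close> or at \<open>0\<close>.\<close>

definition balanced :: "(int \<Rightarrow> int) \<Rightarrow> int \<Rightarrow> int \<Rightarrow> int \<Rightarrow> bool" where
  "balanced \<chi> k N m \<longleftrightarrow> (\<forall>zs. (\<forall>z\<in>set zs. z > 0) \<longrightarrow> sum_list zs = N \<longrightarrow> avoiding m zs \<longrightarrow>
     path_sum \<chi> k zs = path_sum \<chi> 0 zs)"

text \<open>Balance arises from an asymmetric point \<open>q\<close> at which the two compositions differ: comparing the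
coarsenings with \<open>q\<close> as one of the parts, only those with \<open>q\<close> at the front or at the end survive, and
they occur with opposite differences.\<close>

lemma balanced_start:
  assumes eq: "\<And>zs. (\<forall>z\<in>set zs. z > 0) \<Longrightarrow> sum_list zs = n \<Longrightarrow> path_sum \<chi> 0 zs = path_sum \<chi>' 0 zs"
    and same: "\<And>x. \<not> m dvd x \<Longrightarrow> \<chi> x = \<chi>' x"
    and q: "m dvd q" "0 < q" "q < n"
    and d: "\<chi> q - \<chi>' q = d" "\<chi> (n - q) - \<chi>' (n - q) = - d" "d \<noteq> 0"
  shows "balanced \<chi> q (n - q) m"
  unfolding balanced_def
proof (intro allI impI)
  fix zs :: "int list" assume zs: "\<forall>z\<in>set zs. z > 0" "sum_list zs = n - q" and av: "avoiding m zs"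
  have "zs \<noteq> []" using zs(2) q by auto
  from path_sum_Cons_diff[OF av this q(1), of \<chi> 0 \<chi>' 0] same
  have "path_sum \<chi> 0 (q # zs) - path_sum \<chi>' 0 (q # zs) = d * path_sum \<chi> q zs + (- d) * path_sum \<chi> 0 zs"
    using d zs(2) by simp
  moreover have "path_sum \<chi> 0 (q # zs) = path_sum \<chi>' 0 (q # zs)"
    using zs q by (intro eq) auto
  ultimately have "d * (path_sum \<chi> q zs - path_sum \<chi> 0 zs) = 0" by (auto simp: algebra_simps)
  then show "path_sum \<chi> q zs = path_sum \<chi> 0 zs" using d(3) by auto
qed

lemma avoiding_Cons:
  assumes av: "avoiding m' zs" and m: "m' dvd m" and b: "m' dvd b" "\<not> m dvd b" "\<not> m dvd sum_list zs"
  shows "avoiding m (b # zs)"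
  unfolding avoiding_def
proof (intro allI impI)
  fix ys i assume ys: "mset ys = mset (b # zs)" and i: "0 < i" "i < length ys"
  have "b \<in> set ys" using mset_eq_setD[OF ys] by simp
  then obtain us ws where ys': "ys = us @ b # ws" by (meson split_list)
  have uw: "mset (us @ ws) = mset zs" using ys ys' by simp
  have nd: "\<not> m dvd s" if "\<not> m' dvd s" for s using that m dvd_trans by blast
  have pre: "\<not> m' dvd sum_list (take j (us @ ws))" if "0 < j" "j < length (us @ ws)" for j
    using av uw that unfolding avoiding_def by blast
  show "\<not> m dvd sum_list (take i ys)"
  proof (cases "i \<le> length us")
    case True
    then have t: "take i ys = take i (us @ ws)" by (simp add: ys')
    show ?thesis
    proof (cases "i < length (us @ ws)")
      case True
      then show ?thesis unfolding t using pre i nd by blast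
    next
      case False
      then have "sum_list (take i ys) = sum_list zs"
        unfolding t using uw by (metis linorder_not_less sum_mset_sum_list take_all)
      then show ?thesis using b by simp
    qed
  next
    case False
    then obtain d where d: "i = Suc (length us + d)" using less_iff_Suc_add[of "length us" i] by auto
    have t: "sum_list (take i ys) = b + sum_list (take (length us + d) (us @ ws))"
      by (simp add: ys' d)
    show ?thesis
    proof (cases "length us + d = 0")
      case True
      then show ?thesis unfolding t using b by simp
    next
      case False
      have "length us + d < length (us @ ws)" using i d ys' by simp
      then show ?thesis
        unfolding t using pre[of "length us + d"] False b(1) by (intro nd) (simp add: dvd_add_right_iff)
    qed
  qed
qed

text \<open>The three-part lists are the only ones to which balance is applied in the end.\<close>

lemma avoiding_three:
  fixes x y z m :: int
  assumes "\<not> m dvd x" "\<not> m dvd y" "\<not> m dvd z" "\<not> m dvd x + y" "\<not> m dvd x + z" "\<not> m dvd y + z"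
  shows "avoiding m [x, y, z]"
  unfolding avoiding_def
proof (intro allI impI)
  fix ys i assume ys: "mset ys = mset [x, y, z]" and i: "0 < i" "i < length ys"
  have l: "length ys = 3" using mset_eq_length[OF ys] by simp
  then obtain a b c where abc: "ys = [a, b, c]"
    by (auto simp: length_Suc_conv numeral_3_eq_3)
  have "{#a, b, c#} = {#x, y, z#}" using ys abc by simp
  then have "a \<in> {x, y, z} \<and> a + b \<in> {x + y, x + z, y + z}"
    by (auto simp: add_eq_conv_ex add_mset_eq_single add.commute)
  moreover have "sum_list (take i ys) = (if i = 1 then a else a + b)" "i = 1 \<or> i = 2"
    using i l abc by (auto simp: numeral_2_eq_2 take_Cons')
  moreover have "\<not> m dvd y + x" "\<not> m dvd z + x" "\<not> m dvd z + y"
    using assms(4-6) by (simp_all add: add.commute)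
  ultimately show "\<not> m dvd sum_list (take i ys)" using assms by auto
qed

section \<open>Windows\<close>

definition even_part :: "(int \<Rightarrow> int) \<Rightarrow> int \<Rightarrow> int" where
  "even_part \<chi> x = \<chi> x + \<chi> (- x)"

definition odd_part :: "(int \<Rightarrow> int) \<Rightarrow> int \<Rightarrow> int" where
  "odd_part \<chi> x = \<chi> x - \<chi> (- x)"

lemma parts_uminus [simp]:
  "even_part \<chi> (- x) = even_part \<chi> x" "odd_part \<chi> (- x) = - odd_part \<chi> x"
  by (simp_all add: even_part_def odd_part_def)

lemma parts_sum: "2 * \<chi> x = even_part \<chi> x + odd_part \<chi> x"
  by (simp add: even_part_def odd_part_def)

text \<open>The condition \<open>m dvd g\<close> keeps translated arguments off the multiples of \<open>m\<close>.\<close>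

lemma period_subgroup:
  fixes f :: "int \<Rightarrow> int"
  shows "int_subgroup {g. m dvd g \<and> (\<forall>x. \<not> m dvd x \<longrightarrow> f (x + g) = f x)}"
proof (rule int_subgroupI)
  fix g g' assume "g \<in> {g. m dvd g \<and> (\<forall>x. \<not> m dvd x \<longrightarrow> f (x + g) = f x)}"
    "g' \<in> {g. m dvd g \<and> (\<forall>x. \<not> m dvd x \<longrightarrow> f (x + g) = f x)}"
  then have g: "m dvd g" "\<And>x. \<not> m dvd x \<Longrightarrow> f (x + g) = f x" "m dvd g'" "\<And>x. \<not> m dvd x \<Longrightarrow> f (x + g') = f x"
    by auto
  have "f (x + (g + g')) = f x" if "\<not> m dvd x" for x
  proof -
    have "\<not> m dvd x + g" using that g(1) by (simp add: dvd_add_left_iff)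
    from g(4)[OF this] g(2)[OF that] show ?thesis by (simp add: add.assoc)
  qed
  then show "g + g' \<in> {g. m dvd g \<and> (\<forall>x. \<not> m dvd x \<longrightarrow> f (x + g) = f x)}" using g by simp
next
  fix g assume "g \<in> {g. m dvd g \<and> (\<forall>x. \<not> m dvd x \<longrightarrow> f (x + g) = f x)}"
  then have g: "m dvd g" "\<And>x. \<not> m dvd x \<Longrightarrow> f (x + g) = f x" by auto
  have "f (x + (- g)) = f x" if "\<not> m dvd x" for x
  proof -
    have "\<not> m dvd x - g" using that g(1) by (simp add: dvd_diff_left_iff)
    from g(2)[OF this] show ?thesis by simp
  qed
  then show "- g \<in> {g. m dvd g \<and> (\<forall>x. \<not> m dvd x \<longrightarrow> f (x + g) = f x)}" using g by simp
qed simp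

lemma period_multiple:
  fixes f :: "int \<Rightarrow> int"
  assumes "\<And>x. \<not> m dvd x \<Longrightarrow> f (x + d) = f x" "m dvd d" "d dvd g" "\<not> m dvd x"
  shows "f (x + g) = f x"
  using int_subgroup_Gcd[OF period_subgroup[of m f], of "{d}" g] assms by simp

text \<open>Balance is inherited by a point \<open>b\<close> at which the period \<open>k\<close> of the even part fails, for the shorter
length \<open>N - b\<close> and the larger set of multiples of \<open>m'\<close> to be avoided. Put \<open>b\<close> as an extra part into a
path: interior positions cancel because \<open>\<chi>\<close> has the period \<open>k\<close> off the multiples of \<open>m'\<close>, and the
two end positions carry opposite nonzero factors.\<close>

lemma balanced_shrink:
  assumes bal: "balanced \<chi> k N m" and m: "m' dvd m" "m dvd k" "m dvd N" "m' dvd b"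
    and b: "\<not> m dvd b" "0 < b" "b < N"
    and per: "\<And>w. \<not> m dvd w \<Longrightarrow> \<chi> (w + (k + N)) = \<chi> w"
    and perk: "\<And>w. \<not> m' dvd w \<Longrightarrow> \<chi> (w + k) = \<chi> w"
    and v: "odd_part \<chi> (b + k) = odd_part \<chi> b" and u: "even_part \<chi> (b + k) \<noteq> even_part \<chi> b"
  shows "balanced \<chi> b (N - b) m'"
  unfolding balanced_def
proof (intro allI impI)
  fix zs :: "int list" assume zs: "\<forall>z\<in>set zs. z > 0" "sum_list zs = N - b" and av: "avoiding m' zs"
  have ne: "zs \<noteq> []" using zs(2) b by auto
  have nb: "\<not> m dvd N - b" "\<not> m dvd - b" "\<not> m dvd - b - k"
    using b(1) m(2,3) by (simp_all add: dvd_diff_right_iff dvd_diff_left_iff)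
  have "avoiding m (b # zs)" using avoiding_Cons[OF av m(1,4) b(1)] nb(1) zs(2) by simp
  then have f1: "path_sum \<chi> k (b # zs) = path_sum \<chi> 0 (b # zs)"
    using bal zs b unfolding balanced_def by simp
  have f2: "path_sum \<chi> k (b # zs) - path_sum \<chi> 0 (b # zs) =
    (\<chi> (k + b) - \<chi> b) * path_sum \<chi> (k + b) zs + (\<chi> (k + (N - b)) - \<chi> (N - b)) * path_sum \<chi> k zs"
    using path_sum_Cons_diff[OF av ne m(4), of \<chi> k \<chi> 0] perk zs(2) by (simp add: add.commute)
  have f3: "path_sum \<chi> (k + b) zs = path_sum \<chi> b zs"
    using path_sum_cong[OF av m(4), of \<chi> k \<chi> 0] perk by (simp add: add.commute)
  have f4: "path_sum \<chi> k zs = path_sum \<chi> 0 zs"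
    using path_sum_cong[OF av, of 0 \<chi> k \<chi> 0] perk by (simp add: add.commute)
  have f5: "\<chi> (k + (N - b)) - \<chi> (N - b) = - (\<chi> (k + b) - \<chi> b)"
  proof -
    have e: "k + (N - b) = - b + (k + N)" "N - b = (- b - k) + (k + N)" by simp_all
    have "\<chi> (k + (N - b)) = \<chi> (- b)" unfolding e(1) by (rule per[OF nb(2)])
    moreover have "\<chi> (N - b) = \<chi> (- b - k)" by (subst e(2)) (rule per[OF nb(3)])
    moreover have "\<chi> (- (b + k)) = \<chi> (- b - k)" "\<chi> (b + k) = \<chi> (k + b)"
      by (simp_all add: add.commute)
    ultimately show ?thesis using v unfolding odd_part_def by linarith
  qed
  have "0 = (\<chi> (k + b) - \<chi> b) * path_sum \<chi> b zs + - (\<chi> (k + b) - \<chi> b) * path_sum \<chi> 0 zs"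
    using f2 unfolding f1 f3 f4 f5 diff_self .
  then have "(\<chi> (k + b) - \<chi> b) * (path_sum \<chi> b zs - path_sum \<chi> 0 zs) = 0"
    by (simp add: algebra_simps)
  moreover have "\<chi> (k + b) \<noteq> \<chi> b"
  proof
    assume "\<chi> (k + b) = \<chi> b"
    moreover have "\<chi> (b + k) = \<chi> (k + b)" by (simp add: add.commute)
    ultimately show False using u v unfolding even_part_def odd_part_def by linarith
  qed
  ultimately show "path_sum \<chi> b zs = path_sum \<chi> 0 zs" by auto
qed

definition defect :: "(int \<Rightarrow> int) \<Rightarrow> int \<Rightarrow> int \<Rightarrow> int" where
  "defect \<chi> k x = even_part \<chi> x - even_part \<chi> (x + k)"

text \<open>Balance for three parts in terms of the odd part and the defect of the even part: in the products of
the two visited values the terms quadratic in the odd part and those quadratic in the even part cancel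
after summation over the six arrangements.\<close>

lemma balanced_three:
  assumes bal: "balanced \<chi> k N m" and m: "m dvd k" "m dvd N"
    and xyz: "0 < x" "0 < y" "0 < z" "x + y + z = N"
    and nd: "\<not> m dvd x" "\<not> m dvd y" "\<not> m dvd x + y"
    and per: "\<And>w. \<not> m dvd w \<Longrightarrow> \<chi> (w + (k + N)) = \<chi> w"
    and vper: "\<And>w. \<not> m dvd w \<Longrightarrow> odd_part \<chi> (w + k) = odd_part \<chi> w"
    and ndx: "\<not> m dvd z" "\<not> m dvd x + z" "\<not> m dvd y + z"
  shows "odd_part \<chi> x * (defect \<chi> k y + defect \<chi> k z) + odd_part \<chi> y * (defect \<chi> k x + defect \<chi> k z) +
    odd_part \<chi> z * (defect \<chi> k x + defect \<chi> k y) = 0"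
proof -
  have "avoiding m [x, y, z]" using nd ndx by (intro avoiding_three) auto
  then have eq: "path_sum \<chi> k [x, y, z] = path_sum \<chi> 0 [x, y, z]"
    using bal xyz unfolding balanced_def by simp
  have c1: "\<chi> (k + s + t) = \<chi> (- r)" "\<chi> (s + t) = \<chi> (- r - k)" if "s + t + r = N" "\<not> m dvd r" for s t r
  proof -
    have nd: "\<not> m dvd - r" "\<not> m dvd - r - k" using that m by (simp_all add: dvd_diff_left_iff)
    have st: "s + t = N - r" using that by simp
    have e: "k + s + t = - r + (k + N)" "s + t = (- r - k) + (k + N)" using st by simp_all
    show "\<chi> (k + s + t) = \<chi> (- r)" unfolding e(1) by (rule per[OF nd(1)])
    show "\<chi> (s + t) = \<chi> (- r - k)" unfolding e(2) by (rule per[OF nd(2)])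
  qed
  have sums: "x + y + z = N" "x + z + y = N" "y + x + z = N" "y + z + x = N" "z + x + y = N" "z + y + x = N"
    using xyz(4) by simp_all
  have D: "\<chi> (- w - k) = \<chi> (k + w) - \<chi> w + \<chi> (- w)" if "\<not> m dvd w" for w
  proof -
    have "\<chi> (- (w + k)) = \<chi> (- w - k)" "\<chi> (w + k) = \<chi> (k + w)"
      by (intro arg_cong[of _ _ \<chi>], simp)+
    then show ?thesis using vper[OF that] unfolding odd_part_def by linarith
  qed
  have v: "odd_part \<chi> w = \<chi> w - \<chi> (- w)" for w by (simp add: odd_part_def)
  have d: "defect \<chi> k w = 2 * \<chi> w - 2 * \<chi> (k + w)" if "\<not> m dvd w" for w
  proof -
    have "\<chi> (- (w + k)) = \<chi> (- w - k)" "\<chi> (w + k) = \<chi> (k + w)"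
      by (intro arg_cong[of _ _ \<chi>], simp)+
    then show ?thesis using D[OF that] unfolding defect_def even_part_def by linarith
  qed
  show ?thesis
    using eq[unfolded path_sum_three add_0]
    unfolding c1[OF sums(1) ndx(1)] c1[OF sums(2) nd(2)] c1[OF sums(3) ndx(1)] c1[OF sums(4) nd(1)]
      c1[OF sums(5) nd(2)] c1[OF sums(6) nd(1)] D[OF nd(1)] D[OF nd(2)] D[OF ndx(1)]
      d[OF nd(1)] d[OF nd(2)] d[OF ndx(1)] v
    by (simp add: algebra_simps)
qed

text \<open>The outermost layer of a function \<open>\<chi>\<close>: the subgroup of multiples of \<open>h\<close> contains all points at which
the odd part is not yet understood, and \<open>l\<close> generates the subgroup of all periods of the odd part off the
multiples of \<open>h\<close>. The last assumption says that no point
outside the multiples of \<open>l\<close> is a period; it concerns the zeros of the odd part, the only points for which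
this is not clear by comparison with the value at \<open>0\<close>.\<close>

locale layer =
  fixes \<chi> :: "int \<Rightarrow> int" and n h l :: int
  assumes range: "\<chi> x = 0 \<or> \<chi> x = 1"
    and n_pos: "n > 0"
    and periodic: "\<chi> (x + n) = \<chi> x"
    and l_dvd_h: "l dvd h" and h_dvd_n: "h dvd n"
    and odd_periodic: "\<not> l dvd a \<Longrightarrow> l dvd g \<Longrightarrow> odd_part \<chi> (a + g) = odd_part \<chi> a"
    and odd_zero: "l dvd a \<Longrightarrow> \<not> h dvd a \<Longrightarrow> odd_part \<chi> a = 0"
    and separating: "\<not> l dvd a \<Longrightarrow> odd_part \<chi> a = 0 \<Longrightarrow>
       \<exists>p. \<not> l dvd p \<and> odd_part \<chi> p \<noteq> 0 \<and> odd_part \<chi> (a + p) \<noteq> odd_part \<chi> p"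
begin

abbreviation "u \<equiv> even_part \<chi>"
abbreviation "v \<equiv> odd_part \<chi>"

lemma u_eq_1: "v x \<noteq> 0 \<Longrightarrow> u x = 1"
  using range[of x] range[of "- x"] by (auto simp: even_part_def odd_part_def)

lemma u_cases: "v x = 0 \<Longrightarrow> u x = 0 \<or> u x = 2"
  using range[of x] range[of "- x"] by (auto simp: even_part_def odd_part_def)

lemma vper:
  assumes "m dvd h" "m dvd k" "l dvd m" "\<not> m dvd w"
  shows "v (w + k) = v w"
proof (cases "l dvd w")
  case True
  have "\<not> m dvd w + k" using assms(2,4) by (simp add: dvd_add_left_iff)
  then have "\<not> h dvd w" "\<not> h dvd w + k" using assms(1,4) dvd_trans by blast+
  moreover have "l dvd w + k" using True dvd_trans[OF assms(3,2)] by simp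
  ultimately show ?thesis using odd_zero True by simp
next
  case False
  then show ?thesis using odd_periodic assms(2,3) dvd_trans by blast
qed

lemma chi_period_from_parts:
  assumes "u (x + g) = u x" "v (x + g) = v x" shows "\<chi> (x + g) = \<chi> x"
  using parts_sum[of \<chi> x] parts_sum[of \<chi> "x + g"] assms by simp

end

text \<open>A balanced length \<open>N\<close> together with the fact that \<open>k + N\<close> is a period, so that \<open>x\<close>, \<open>y\<close>, \<open>z\<close> of total
\<open>N\<close> behave like three elements of total \<open>- k\<close>.\<close>

locale window = layer +
  fixes m k N :: int
  assumes bal: "balanced \<chi> k N m"
    and m_pos: "m > 0" and l_dvd_m: "l dvd m" and m_dvd_h: "m dvd h"
    and m_dvd_k: "m dvd k" and m_dvd_N: "m dvd N"
    and per: "\<not> m dvd w \<Longrightarrow> \<chi> (w + (k + N)) = \<chi> w"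
begin

abbreviation "\<Delta> \<equiv> defect \<chi> k"

lemma vper': "\<not> m dvd w \<Longrightarrow> v (w + k) = v w"
  using vper[OF m_dvd_h m_dvd_k l_dvd_m] by simp

lemma not_l_not_m: "\<not> l dvd x \<Longrightarrow> \<not> m dvd x"
  using l_dvd_m dvd_trans by blast

lemma u_per: "\<not> m dvd w \<Longrightarrow> u (w + (k + N)) = u w"
proof -
  assume w: "\<not> m dvd w"
  have kN: "m dvd k + N" using m_dvd_k m_dvd_N by simp
  then have "\<not> m dvd - w - (k + N)" using w by (simp add: dvd_diff_left_iff)
  from per[OF this] have "\<chi> (- w - (k + N)) = \<chi> (- w)" by simp
  moreover have "\<chi> (- (w + (k + N))) = \<chi> (- w - (k + N))" by (intro arg_cong[of _ _ \<chi>]) simp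
  ultimately show ?thesis using per[OF w] unfolding even_part_def by linarith
qed

text \<open>Reflection at the centre of the window reverses the defect because \<open>u\<close> is even.\<close>

lemma defect_reflect:
  assumes "\<not> m dvd a" shows "\<Delta> (N - a) = - \<Delta> a"
proof -
  have nd: "\<not> m dvd - a" "\<not> m dvd - a - k" using assms m_dvd_k by (simp_all add: dvd_diff_left_iff)
  have "u (N - a) = u (a + k)"
    using u_per[OF nd(2)] parts_uminus(1)[of \<chi> "a + k"] by (simp add: algebra_simps)
  moreover have "u (N - a + k) = u a"
    using u_per[OF nd(1)] parts_uminus(1)[of \<chi> "a"] by (simp add: algebra_simps)
  ultimately show ?thesis by (simp add: defect_def)
qed

lemma add_not_l:
  assumes "v a = 0" "v p \<noteq> 0" "\<not> l dvd p" shows "\<not> l dvd a + p"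
proof
  assume "l dvd a + p"
  then have "v (- p + (a + p)) = v (- p)" using odd_periodic[of "- p" "a + p"] assms(3) by simp
  then show False using assms by simp
qed

lemma defect_nonzero_odd:
  assumes "\<not> m dvd b" "\<Delta> b \<noteq> 0" shows "v b = 0"
  using assms u_eq_1[of b] u_eq_1[of "b + k"] vper'[OF assms(1)]
  by (cases "v b = 0") (auto simp: defect_def)

text \<open>Balance for the parts \<open>a\<close>, \<open>p\<close> and \<open>N - a - p\<close>, where \<open>\<chi>\<close> is symmetric at \<open>a\<close> and not at \<open>p\<close>.\<close>

lemma three_part_window:
  assumes a: "0 < a" "\<not> l dvd a" "v a = 0" and p: "0 < p" "\<not> l dvd p" "v p \<noteq> 0" and ap: "a + p < N"
  shows "v (a + p) = 0 \<Longrightarrow> \<Delta> (a + p) = \<Delta> a"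
    and "v (a + p) \<noteq> 0 \<Longrightarrow> \<Delta> a \<noteq> 0 \<Longrightarrow> v (a + p) = v p"
proof -
  define c where "c = N - a - p"
  have nap: "\<not> l dvd a + p" using add_not_l[OF a(3) p(3,2)] .
  have nd: "\<not> m dvd a" "\<not> m dvd p" "\<not> m dvd a + p"
    using not_l_not_m a(2) p(2) nap by blast+
  have c: "a + p + c = N" "0 < c" "c = N - (a + p)" "a + c = N - p" "p + c = N - a"
    using ap by (simp_all add: c_def)
  have ndc: "\<not> m dvd c" "\<not> m dvd a + c" "\<not> m dvd p + c"
    unfolding c(3,4,5) using nd m_dvd_N by (simp_all add: dvd_diff_right_iff)
  have eq: "v a * (\<Delta> p + \<Delta> c) + v p * (\<Delta> a + \<Delta> c) + v c * (\<Delta> a + \<Delta> p) = 0"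
    using balanced_three[OF bal m_dvd_k m_dvd_N a(1) p(1) c(2) c(1) nd per vper' ndc] by blast
  have dp: "\<Delta> p = 0" using defect_nonzero_odd[OF nd(2)] p(3) by blast
  have dc: "\<Delta> c = - \<Delta> (a + p)" unfolding c(3) by (rule defect_reflect[OF nd(3)])
  have "v c = - v (a + p)"
  proof -
    have nd': "\<not> m dvd - (a + p)" by (subst dvd_minus_iff) (rule nd(3))
    have "v c = v (- (a + p) + N)" by (intro arg_cong[of _ _ v]) (simp add: c_def)
    also have "\<dots> = v (- (a + p))" by (rule vper[OF m_dvd_h m_dvd_N l_dvd_m nd'])
    finally show ?thesis by (simp only: parts_uminus)
  qed
  then have eq': "v p * (\<Delta> a - \<Delta> (a + p)) - v (a + p) * \<Delta> a = 0" using eq a(3) dp dc by simp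
  show "\<Delta> (a + p) = \<Delta> a" if "v (a + p) = 0" using eq' that p(3) by simp
  show "v (a + p) = v p" if "v (a + p) \<noteq> 0" "\<Delta> a \<noteq> 0"
  proof -
    have "\<Delta> (a + p) = 0" using defect_nonzero_odd[OF nd(3)] that(1) by blast
    then have "(v p - v (a + p)) * \<Delta> a = 0" using eq' by (simp add: algebra_simps)
    then show ?thesis using that(2) by simp
  qed
qed

text \<open>Step from \<open>a\<close> to \<open>a + p\<close> and then, with \<open>m - p\<close> in place of \<open>p\<close>, to \<open>a + m\<close>: as long as these points
are symmetric, the defect does not change.\<close>

lemma defect_coset:
  assumes p: "0 < p" "p < m" "\<not> l dvd p" "v p \<noteq> 0"
    and b: "\<not> l dvd b" "v b = 0" "v (b + p) = 0"
    and j: "m dvd a - b" "0 < a" "a + int j * m < N"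
  shows "\<Delta> (a + int j * m) = \<Delta> a"
  using j(3)
proof (induction j)
  case (Suc j)
  define a' where "a' = a + int j * m"
  have a': "0 < a'" "a' + m < N" 
  proof -
    have "0 \<le> int j * m" "int (Suc j) * m = int j * m + m" using m_pos by (simp_all add: algebra_simps)
    then show "0 < a'" "a' + m < N" using j(2) Suc.prems unfolding a'_def by linarith+
  qed
  have "a' - b = (a - b) + int j * m" by (simp add: a'_def)
  then have "m dvd a' - b" using j(1) by (simp only: dvd_add_left_iff dvd_triv_right)
  then have l: "l dvd a' - b" using l_dvd_m dvd_trans by blast
  have va: "v a' = 0" "\<not> l dvd a'"
    using odd_periodic[OF b(1) l] b(2) dvd_diff[OF _ l, of a'] b(1) by auto
  have bp: "\<not> l dvd b + p" using add_not_l[OF b(2) p(4,3)] .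
  have vap: "v (a' + p) = 0" "\<not> l dvd a' + p"
    using odd_periodic[OF bp l] b(3) add_not_l[OF va(1) p(4,3)] by (simp_all add: algebra_simps)
  have p': "0 < m - p" "\<not> l dvd m - p" "v (m - p) \<noteq> 0"
    using p l_dvd_m odd_periodic[of "- p" m] by (simp_all add: dvd_diff_right_iff add.commute)
  have e: "a' + p + (m - p) = a' + m" by simp
  have vm: "v (a' + p + (m - p)) = 0" unfolding e using odd_periodic[OF va(2) l_dvd_m] va(1) by simp
  have "\<Delta> (a' + p) = \<Delta> a'"
    by (rule three_part_window(1)[OF a'(1) va(2,1) p(1,3,4) _ vap(1)]) (use a' p in linarith)
  moreover have "\<Delta> (a' + p + (m - p)) = \<Delta> (a' + p)"
    by (rule three_part_window(1)[OF _ vap(2,1) p' _ vm]) (use a' p in linarith)+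
  ultimately have "\<Delta> (a' + m) = \<Delta> a'" unfolding e by simp
  moreover have "\<Delta> a' = \<Delta> a" using Suc.IH a'(2) m_pos unfolding a'_def by simp
  ultimately show ?case by (simp add: a'_def algebra_simps)
qed simp

text \<open>A point that is not a period of \<open>v\<close> but has a nonzero defect is separated from the periods by some
\<open>p\<close>, and then \<open>b + p\<close> must be symmetric. The bounds leave room for a third part.\<close>

lemma bad_coset:
  assumes b: "0 < b" "2 * b < N" "\<not> l dvd b" "\<Delta> b \<noteq> 0" and N: "2 * m \<le> N"
  obtains p where "0 < p" "p < m" "\<not> l dvd p" "v p \<noteq> 0" "v b = 0" "v (b + p) = 0"
proof -
  have vb: "v b = 0" using defect_nonzero_odd[OF not_l_not_m[OF b(3)] b(4)] .
  obtain p0 where p0: "\<not> l dvd p0" "v p0 \<noteq> 0" "v (b + p0) \<noteq> v p0" using separating[OF b(3) vb] by blast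
  define p where "p = p0 mod m"
  define t where "t = (- (p0 div m)) * m"
  have pm: "p = p0 + t" by (simp add: p_def t_def minus_div_mult_eq_mod[symmetric])
  have lm: "l dvd t" using l_dvd_m by (simp add: t_def)
  have vp: "v p = v p0" "\<not> l dvd p"
    unfolding pm using odd_periodic[OF p0(1) lm] lm p0(1) by (simp_all add: dvd_add_left_iff)
  have "p \<noteq> 0" using vp(2) by auto
  then have pr: "0 < p" "p < m" using m_pos by (auto simp: p_def le_neq_trans)
  have "v (b + p) = v (b + p0)"
    using odd_periodic[OF add_not_l[OF vb p0(2,1)] lm] unfolding pm by (simp add: add.assoc)
  then have ne: "v (b + p) \<noteq> v p" using p0(3) vp by simp
  have bp: "b + p < N" using b(2) N pr by linarith
  have vp0: "v p \<noteq> 0" using vp(1) p0(2) by simp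
  have "v (b + p) = 0"
    using three_part_window(2)[OF b(1,3) vb pr(1) vp(2) vp0 bp _ b(4)] ne by blast
  then show thesis using that[OF pr vp(2) vp0 vb] by blast
qed

text \<open>By \<open>defect_reflect\<close> it suffices to look at the first half of the window; at its centre the defect is
its own negative.\<close>

lemma reflect_bad:
  assumes "\<And>b. 0 < b \<Longrightarrow> 2 * b < N \<Longrightarrow> \<not> m' dvd b \<Longrightarrow> \<Delta> b = 0" "m' dvd m"
    and a: "0 < a" "a < N" "\<not> m' dvd a"
  shows "\<Delta> a = 0"
proof -
  have ma: "\<not> m dvd a" using a(3) assms(2) dvd_trans by blast
  have r: "\<Delta> (N - a) = - \<Delta> a" by (rule defect_reflect[OF ma])
  consider "2 * a < N" | "2 * a = N" | "2 * a > N" by linarith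
  then show ?thesis
  proof cases
    case 2
    then have "N - a = a" by simp
    then show ?thesis using r by simp
  next
    case 3
    have "\<not> m' dvd N - a" using a(3) dvd_trans[OF assms(2) m_dvd_N] by (simp add: dvd_diff_right_iff)
    then show ?thesis using r assms(1)[of "N - a"] a 3 by simp
  qed (use assms(1) a in blast)
qed

end

section \<open>Adjoining failures of periodicity\<close>

text \<open>For an indicator function of a composition this says that the composition has the form \<open>\<sigma> \<circ> \<tau>\<close> with
\<open>\<tau>\<close> of size \<open>m\<close>.\<close>

definition periodic_off :: "(int \<Rightarrow> int) \<Rightarrow> int \<Rightarrow> bool" where
  "periodic_off \<chi> m \<longleftrightarrow> (\<forall>x g. \<not> m dvd x \<longrightarrow> m dvd g \<longrightarrow> \<chi> (x + g) = \<chi> x)"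

lemma mod_range:
  fixes b m :: int
  assumes "m > 0" "\<not> m dvd b" shows "0 < b mod m" "b mod m < m"
proof -
  have "b mod m \<noteq> 0" using assms(2) by (simp add: dvd_eq_mod_eq_0)
  then show "0 < b mod m" using pos_mod_sign[OF assms(1), of b] by linarith
qed (use assms in simp)

context layer
begin

lemma periodic_from_generators:
  assumes m: "l dvd m" "m dvd h" and X: "\<And>g. g \<in> X \<Longrightarrow> m dvd g"
    and per: "\<And>g x. g \<in> X \<Longrightarrow> \<not> m dvd x \<Longrightarrow> u (x + g) = u x"
    and g: "Gcd X dvd g" and x: "\<not> m dvd x"
  shows "\<chi> (x + g) = \<chi> x"
proof -
  have "X \<subseteq> {g. m dvd g \<and> (\<forall>x. \<not> m dvd x \<longrightarrow> u (x + g) = u x)}" using X per by blast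
  from int_subgroup_Gcd[OF period_subgroup this g] have "m dvd g" and u: "u (x + g) = u x" using x by auto
  from u vper[OF m(2) \<open>m dvd g\<close> m(1) x] show ?thesis by (rule chi_period_from_parts)
qed

lemma u_period:
  assumes "m dvd g" "\<And>x. \<not> m dvd x \<Longrightarrow> \<chi> (x + g) = \<chi> x" "\<not> m dvd x"
  shows "u (x + g) = u x"
proof -
  have "\<not> m dvd - x - g" using assms(1,3) by (simp add: dvd_diff_left_iff)
  from assms(2)[OF this] have "\<chi> (- x - g) = \<chi> (- x)" by simp
  moreover have "\<chi> (- (x + g)) = \<chi> (- x - g)" by (intro arg_cong[of _ _ \<chi>]) simp
  ultimately show ?thesis using assms(2)[OF assms(3)] unfolding even_part_def by linarith
qed

text \<open>The set \<open>X\<close> consists of the witnesses adjoined last, \<open>m'\<close> generates the subgroup before and \<open>m\<close> the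
subgroup after adjoining them, and \<open>\<chi>\<close> has the old period \<open>m'\<close> off the multiples of \<open>m\<close>. Each witness
comes with a balanced length greater than \<open>m'\<close>. Collect in \<open>Y\<close> the points at which some
\<open>k \<in> X\<close> fails to be a period of \<open>u\<close>. They are multiples of \<open>l\<close>: otherwise the defect of \<open>k\<close> would be
a nonzero constant on a coset of \<open>m\<close>, so that \<open>u\<close> would take values in arithmetic progression there,
although it only takes the values \<open>0\<close> and \<open>2\<close>. By \<open>balanced_shrink\<close> they satisfy the same assumptions, and
\<open>m\<close> strictly decreases unless \<open>Y\<close> adds nothing. Lengths never become too short: a point \<open>b\<close> is taken from
the first half of its window of length \<open>N > m'\<close>, and \<open>m' \<ge> 2 m\<close>, so that the new length \<open>N - b\<close> exceeds \<open>m\<close>.\<close>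

lemma closure_step:
  assumes "m > 0" "l dvd m" "m dvd h" "m dvd m'" "m' \<noteq> m" "m' > 0"
    and per: "\<And>x. \<not> m dvd x \<Longrightarrow> \<chi> (x + m') = \<chi> x"
    and gen: "m = Gcd (insert m' X)"
    and win: "\<And>k. k \<in> X \<Longrightarrow> \<exists>N>m'. m' dvd N + k \<and> balanced \<chi> k N m"
  shows "\<exists>d>0. l dvd d \<and> d dvd h \<and> periodic_off \<chi> d"
  using assms
proof (induction "nat m" arbitrary: m m' X rule: less_induct)
  case less
  note m = less.prems(1-6) and per = less.prems(7) and gen = less.prems(8) and win = less.prems(9)
  have m2: "2 * m \<le> m'"
  proof -
    obtain c where c: "m' = m * c" using m(4) by blast
    have "c > 0" using c m(1,6) by (simp add: zero_less_mult_iff)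
    moreover have "c \<noteq> 1" using c m(5) by simp
    ultimately have "2 \<le> c" by simp
    then show ?thesis using c m(1) by (simp add: mult.commute)
  qed
  have u_m': "u (x + m' * j) = u x" if "\<not> m dvd x" for x j
    by (rule period_multiple[of m u m' "m' * j", OF _ m(4) _ that])
      (use u_period[OF m(4) per] in \<open>simp_all\<close>)
  have mX: "m dvd k" if "k \<in> X" for k unfolding gen using that by (intro Gcd_dvd) simp
  have window: "window \<chi> n h l m k N" if k: "k \<in> X" and N: "m' dvd N + k" "balanced \<chi> k N m" for k N
  proof -
    have "m dvd N"
      using dvd_trans[OF m(4) N(1)] mX[OF k] by (simp add: dvd_add_left_iff)
    moreover have "\<chi> (w + (k + N)) = \<chi> w" if "\<not> m dvd w" for w
      by (rule period_multiple[of m \<chi> m', OF per m(4) _ that]) (use N(1) in \<open>simp_all add: add.commute\<close>)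
    ultimately show ?thesis
      using layer_axioms N(2) m(1-3) mX[OF k] unfolding window_def window_axioms_def by blast
  qed
  define Y where "Y = {b. \<not> m dvd b \<and> (\<exists>k\<in>X. \<exists>N>m'. m' dvd N + k \<and> balanced \<chi> k N m \<and>
     0 < b \<and> 2 * b < N \<and> defect \<chi> k b \<noteq> 0)}"
  have lY: "l dvd b" if "b \<in> Y" for b
  proof (rule ccontr)
    assume nl: "\<not> l dvd b"
    from that obtain k N where b: "\<not> m dvd b" and k: "k \<in> X" "N > m'" "m' dvd N + k" "balanced \<chi> k N m"
      and bN: "0 < b" "2 * b < N" "defect \<chi> k b \<noteq> 0" unfolding Y_def by blast
    interpret window \<chi> n h l m k N by (rule window[OF k(1,3,4)])
    obtain p where p: "0 < p" "p < m" "\<not> l dvd p" "v p \<noteq> 0" "v b = 0" "v (b + p) = 0"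
      by (rule bad_coset[OF bN(1,2) nl bN(3)]) (use m2 k(2) in linarith)
    define r where "r = b mod m"
    have r: "0 < r" "r < m" unfolding r_def by (rule mod_range[OF m(1) b])+
    have const: "\<Delta> a = \<Delta> r" if a: "m dvd a - b" for a
    proof -
      define a' where "a' = a mod m'"
      have aa: "a = a' + m' * (a div m')" by (simp add: a'_def)
      have nda: "\<not> m dvd a" using a b by (metis dvd_diff_right_iff)
      then have nda': "\<not> m dvd a'" using aa m(4) by (metis dvd_add_left_iff dvd_mult2)
      have "\<not> m' dvd a" using nda m(4) dvd_trans by blast
      then have a'r: "0 < a'" "a' < m'" unfolding a'_def by (rule mod_range[OF m(6)])+
      have ndk: "\<not> m dvd a' + k" using nda' m_dvd_k by (simp add: dvd_add_left_iff)
      have "u a = u a'" using arg_cong[OF aa, of u] u_m'[OF nda'] by simp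
      moreover have "a + k = a' + k + m' * (a div m')" using aa by linarith
      from arg_cong[OF this, of u] have "u (a + k) = u (a' + k)" unfolding u_m'[OF ndk] .
      ultimately have "\<Delta> a = \<Delta> a'" by (simp add: defect_def)
      moreover have "\<Delta> a' = \<Delta> r"
      proof -
        define j where "j = nat (a' div m)"
        have "m dvd a' - b" using a aa m(4)
          by (metis add_diff_eq diff_add_cancel dvd_add_left_iff dvd_mult2 add.commute)
        then have "a' mod m = r" unfolding r_def by (metis mod_eq_dvd_iff)
        then have e: "a' = r + int j * m"
          using a'r m(1) by (simp add: j_def pos_imp_zdiv_nonneg_iff) (metis mod_mult_div_eq mult.commute)
        have "m dvd r - b" by (metis mod_eq_dvd_iff mod_mod_trivial r_def)
        from defect_coset[OF p(1-4) nl p(5,6) this r(1), of j] a'r k(2)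
        show ?thesis unfolding e by simp
      qed
      ultimately show ?thesis by simp
    qed
    have bk: "m dvd (b + k) - b" using m_dvd_k by simp
    have "\<Delta> b = \<Delta> (b + k)" using const[OF bk] const[of b] by simp
    then have "u b - u (b + k) = u (b + k) - u (b + k + k)" by (simp add: defect_def)
    moreover have "v (b + k) = 0" "v (b + k + k) = 0"
      using vper'[OF b] vper'[of "b + k"] p(5) b m_dvd_k by (simp_all add: dvd_add_left_iff)
    then have "u b \<in> {0, 2}" "u (b + k) \<in> {0, 2}" "u (b + k + k) \<in> {0, 2}"
      using u_cases p(5) by auto
    moreover have "u b \<noteq> u (b + k)" using bN(3) by (simp add: defect_def)
    ultimately show False by auto
  qed
  define d where "d = Gcd (insert m Y)"
  have d: "d dvd m" "l dvd d"
    unfolding d_def using m(2) lY by (auto intro!: Gcd_greatest Gcd_dvd)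
  have dY: "d dvd b" if "b \<in> Y" for b unfolding d_def using that by (intro Gcd_dvd) simp
  have d0: "d > 0" using d(1) m(1) by (simp add: d_def order.strict_iff_order)
  have dh: "d dvd h" using d(1) m(3) dvd_trans by blast
  have perd: "\<chi> (x + g) = \<chi> x" if "\<not> d dvd x" "m dvd g" for x g
  proof (rule periodic_from_generators[OF d(2) dh, of "insert m' X"])
    show "d dvd g" if "g \<in> insert m' X" for g using that mX m(4) d(1) dvd_trans by blast
    show "Gcd (insert m' X) dvd g" using gen that(2) by simp
    show "\<not> d dvd x" by fact
    fix g x assume g: "g \<in> insert m' X" and x: "\<not> d dvd x"
    have mx: "\<not> m dvd x" using x d(1) dvd_trans by blast
    show "u (x + g) = u x"
    proof (cases "g = m'")
      case True
      then show ?thesis using u_period[OF m(4) per mx] by simp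
    next
      case False
      then have gX: "g \<in> X" using g by simp
      obtain N where N: "N > m'" "m' dvd N + g" "balanced \<chi> g N m" using win[OF gX] by blast
      interpret window \<chi> n h l m g N by (rule window[OF gX N(2,3)])
      define x' where "x' = x mod m'"
      have xx: "x = x' + m' * (x div m')" by (simp add: x'_def)
      have ndx: "\<not> d dvd x'" using x xx m(4) d(1) by (metis dvd_add_left_iff dvd_mult2 dvd_trans)
      then have mx': "\<not> m dvd x'" using d(1) dvd_trans by blast
      have "\<not> m' dvd x" using mx m(4) dvd_trans by blast
      then have x'r: "0 < x'" "x' < m'" unfolding x'_def by (rule mod_range[OF m(6)])+
      have "\<Delta> x' = 0"
      proof (rule reflect_bad[OF _ d(1)])
        show "\<Delta> b = 0" if "0 < b" "2 * b < N" "\<not> d dvd b" for b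
        proof (rule ccontr)
          assume "\<Delta> b \<noteq> 0"
          moreover have "\<not> m dvd b" using that(3) d(1) dvd_trans by blast
          ultimately have "b \<in> Y" unfolding Y_def using gX N that by blast
          then show False using dY that(3) by blast
        qed
      qed (use x'r N(1) ndx in auto)
      moreover have "\<not> m dvd x' + g" using mx' m_dvd_k by (simp add: dvd_add_left_iff)
      then have "u (x' + g + m' * (x div m')) = u (x' + g)" by (rule u_m')
      moreover have "u (x' + m' * (x div m')) = u x'" by (rule u_m'[OF mx'])
      moreover have "x + g = x' + g + m' * (x div m')" using xx by linarith
      from arg_cong[OF this, of u] have "u (x + g) = u (x' + g + m' * (x div m'))" .
      ultimately show ?thesis using arg_cong[OF xx, of u] unfolding defect_def by linarith
    qed
  qed
  show ?case
  proof (cases "d = m")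
    case True
    have "periodic_off \<chi> d" unfolding periodic_off_def using perd True by blast
    then show ?thesis using d0 d(2) dh by blast
  next
    case False
    have "d < m" using d(1) m(1) False zdvd_imp_le by fastforce
    show ?thesis
    proof (rule less.hyps[of d m Y])
      show "nat d < nat m" using \<open>d < m\<close> d0 by simp
      show "\<chi> (x + m) = \<chi> x" if "\<not> d dvd x" for x using perd that by simp
      fix b assume "b \<in> Y"
      then obtain k N where b: "\<not> m dvd b" and k: "k \<in> X" "N > m'" "m' dvd N + k" "balanced \<chi> k N m"
        and bN: "0 < b" "2 * b < N" "defect \<chi> k b \<noteq> 0" unfolding Y_def by blast
      interpret window \<chi> n h l m k N by (rule window[OF k(1,3,4)])
      have perk: "\<chi> (w + k) = \<chi> w" if "\<not> d dvd w" for w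
        by (rule perd[OF that m_dvd_k])
      have ne: "u (b + k) \<noteq> u b" using bN(3) by (simp add: defect_def)
      have lt: "b < N" using bN(1,2) by linarith
      have "balanced \<chi> b (N - b) d"
        by (rule balanced_shrink[OF bal d(1) m_dvd_k m_dvd_N dY[OF \<open>b \<in> Y\<close>] b bN(1) lt per perk vper'[OF b] ne])
      moreover have "N - b > m" using bN m2 k(2) by linarith
      ultimately show "\<exists>N>m. m dvd N + b \<and> balanced \<chi> b N d"
        using m_dvd_N by (intro exI[of _ "N - b"]) simp
    qed (rule d0 d dh m(1) d_def False[symmetric])+
  qed
qed

lemma v_n: "v (x + n) = v x"
proof -
  have "\<chi> (- (x + n)) = \<chi> (- x - n)" by (intro arg_cong[of _ _ \<chi>]) simp
  then show ?thesis using periodic[of x] periodic[of "- x - n"] by (simp add: odd_part_def)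
qed

lemma u_n: "u (x + n) = u x"
proof -
  have "\<chi> (- (x + n)) = \<chi> (- x - n)" by (intro arg_cong[of _ _ \<chi>]) simp
  then show ?thesis using periodic[of x] periodic[of "- x - n"] by (simp add: even_part_def)
qed

lemma parts_n_multiple: "u (x + j * n) = u x" "v (x + j * n) = v x"
proof -
  have 1: "u (x + int i * n) = u x \<and> v (x + int i * n) = v x" for i x
  proof (induction i)
    case (Suc i)
    have "x + int (Suc i) * n = x + int i * n + n" by (simp add: algebra_simps)
    then show ?case using Suc u_n v_n by metis
  qed simp
  have "u (x + j * n) = u x \<and> v (x + j * n) = v x"
  proof (cases "j \<ge> 0")
    case True
    then show ?thesis using 1[of x "nat j"] by simp
  next
    case False
    then show ?thesis using 1[of "x + j * n" "nat (- j)"] by simp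
  qed
  then show "u (x + j * n) = u x" "v (x + j * n) = v x" by simp_all
qed

end

lemma sum_lessThan_add: "sum f {..<a + b} = sum f {..<a} + (\<Sum>j<b. f (a + j))" for f :: "nat \<Rightarrow> int"
  by (induction b) simp_all

text \<open>Both sides compare the total of \<open>f\<close> over \<open>{0..<s + t}\<close> with the total over the rotated sequence.\<close>

lemma cyclic_shift:
  fixes f :: "nat \<Rightarrow> int"
  assumes "\<And>j. j < s \<Longrightarrow> f j - f (j + t) = \<delta>" "\<And>j. j < t \<Longrightarrow> f j - f (j + s) = \<delta>'"
  shows "int s * \<delta> = int t * \<delta>'"
proof -
  have "(\<Sum>j<s. f (t + j)) = (\<Sum>j<s. f j - \<delta>)"
    by (intro sum.cong) (use assms(1) in \<open>auto simp: algebra_simps\<close>)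
  moreover have "(\<Sum>j<t. f (s + j)) = (\<Sum>j<t. f j - \<delta>')"
    by (intro sum.cong) (use assms(2) in \<open>auto simp: algebra_simps\<close>)
  ultimately show ?thesis
    using sum_lessThan_add[of f t s] sum_lessThan_add[of f s t]
    by (simp add: sum_subtractf add.commute[of t s])
qed

context layer
begin

text \<open>The first step differs from \<open>closure_step\<close> in that the balanced lengths \<open>n - q\<close> are shorter than the
period \<open>n\<close>, so that one window does not see a whole coset. Here the windows of \<open>q\<close> and of \<open>n - q\<close>
together cover it: a nonzero constant defect in the first one forces, by summation around the circle
(\<open>cyclic_shift\<close>), the windows to have the same length \<open>q = n - q\<close>, but \<open>\<chi>\<close> is symmetric at \<open>n / 2\<close>.\<close>

theorem periodic_off_exists:
  assumes h0: "h > 0" and Q: "Q \<noteq> {}" "\<And>q. q \<in> Q \<Longrightarrow> v q \<noteq> 0" "\<And>q. q \<in> Q \<Longrightarrow> - q \<in> Q"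
    "\<And>q j. q \<in> Q \<Longrightarrow> q + j * n \<in> Q"
    and gen: "h = Gcd (insert n Q)"
    and win: "\<And>q. q \<in> Q \<Longrightarrow> 0 < q \<Longrightarrow> q < n \<Longrightarrow> balanced \<chi> q (n - q) h"
  shows "\<exists>d>0. l dvd d \<and> d dvd h \<and> periodic_off \<chi> d"
proof -
  have hQ: "h dvd q" if "q \<in> Q" for q unfolding gen using that by (intro Gcd_dvd) simp
  have window: "window \<chi> n h l h q (n - q)" if q: "q \<in> Q" "0 < q" "q < n" for q
    using layer_axioms win[OF q] h0 hQ[OF q(1)] h_dvd_n l_dvd_h periodic
    unfolding window_def window_axioms_def by simp
  have compl: "n - q \<in> Q" if "q \<in> Q" for q using Q(4)[OF Q(3)[OF that], of 1] by simp
  \<comment> \<open>an odd periodic function vanishes at half the period\<close>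
  have half: "n \<noteq> 2 * q" if "q \<in> Q" for q
  proof
    assume "n = 2 * q"
    then have "v q = v (- q + n)" by simp
    then show False using Q(2)[OF that] by (simp only: v_n) simp
  qed
  define Y where "Y = {b. \<not> h dvd b \<and> (\<exists>q\<in>Q. 0 < q \<and> q < n \<and> 2 * h \<le> n - q \<and>
     0 < b \<and> 2 * b < n - q \<and> defect \<chi> q b \<noteq> 0)}"
  have lY: "l dvd b" if "b \<in> Y" for b
  proof (rule ccontr)
    assume nl: "\<not> l dvd b"
    from that obtain q where b: "\<not> h dvd b" and q: "q \<in> Q" "0 < q" "q < n" "2 * h \<le> n - q"
      and bN: "0 < b" "2 * b < n - q" "defect \<chi> q b \<noteq> 0" unfolding Y_def by blast
    interpret W: window \<chi> n h l h q "n - q" by (rule window[OF q(1-3)])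
    interpret W': window \<chi> n h l h "n - q" "n - (n - q)" by (rule window) (use compl q in auto)
    obtain p where p: "0 < p" "p < h" "\<not> l dvd p" "v p \<noteq> 0" "v b = 0" "v (b + p) = 0"
      by (rule W.bad_coset[OF bN(1,2) nl bN(3) q(4)])
    define r where "r = b mod h"
    have r: "0 < r" "r < h" unfolding r_def by (rule mod_range[OF h0 b])+
    have rb: "h dvd r - b" unfolding r_def by (metis mod_eq_dvd_iff mod_mod_trivial)
    obtain t where "q = h * t" using hQ[OF q(1)] by blast
    moreover from this have "t > 0" using q(2) h0 by (simp add: zero_less_mult_iff)
    ultimately obtain t where t: "q = h * int t" "t > 0" by (metis zero_less_imp_eq_int)
    obtain s where "n - q = h * s" using W.m_dvd_N by blast
    moreover from this have "0 < h * s" using q(3) by linarith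
    then have "s > 0" using h0 by (simp add: zero_less_mult_iff)
    ultimately obtain s where s: "n - q = h * int s" "s > 0" by (metis zero_less_imp_eq_int)
    define f where "f j = u (r + int j * h)" for j
    have below: "r + int j * h < h * int c" if "j < c" for j c
    proof -
      have "h * (int j + 1) \<le> h * int c" using that h0 by (intro mult_left_mono) auto
      then show ?thesis using r by (simp add: algebra_simps)
    qed
    have f1: "f j - f (j + t) = defect \<chi> q r" if "j < s" for j
    proof -
      have "r + int (j + t) * h = r + int j * h + q" using t(1) by (simp add: algebra_simps)
      then show ?thesis
        using W.defect_coset[OF p(1-4) nl p(5,6) rb r(1), of j] below[OF that] s(1)
        unfolding f_def defect_def by (simp add: add.assoc)
    qed
    have f2: "f j - f (j + s) = defect \<chi> (n - q) r" if "j < t" for j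
    proof -
      have "r + int (j + s) * h = r + int j * h + (n - q)" using s(1) by (simp add: algebra_simps)
      then show ?thesis
        using W'.defect_coset[OF p(1-4) nl p(5,6) rb r(1), of j] below[OF that] t(1)
        unfolding f_def defect_def by (simp add: add.assoc)
    qed
    have "defect \<chi> q b = defect \<chi> q r"
    proof -
      have bd: "b = r + int (nat (b div h)) * h"
        using bN(1) h0 by (simp add: r_def pos_imp_zdiv_nonneg_iff)
      show ?thesis
        using W.defect_coset[OF p(1-4) nl p(5,6) rb r(1), of "nat (b div h)"] bd bN(1,2) by simp
    qed
    then have \<delta>: "defect \<chi> q r \<noteq> 0" using bN(3) by simp
    have vr: "v r = 0" "\<not> h dvd r"
    proof -
      have "l dvd r - b" using rb l_dvd_h dvd_trans by blast
      then show "v r = 0" using odd_periodic[OF nl, of "r - b"] p(5) by simp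
      show "\<not> h dvd r" using rb b by (metis dvd_diff_right_iff)
    qed
    have "u r \<in> {0, 2}" "u (r + q) \<in> {0, 2}" "u (r + (n - q)) \<in> {0, 2}"
      using u_cases[of r] u_cases[of "r + q"] u_cases[of "r + (n - q)"] W.vper'[OF vr(2)] W'.vper'[OF vr(2)] vr(1)
      by auto
    then have "defect \<chi> q r \<in> {- 2, 0, 2}" "defect \<chi> (n - q) r \<in> {- 2, 0, 2}"
      by (auto simp: defect_def)
    moreover have "int s * defect \<chi> q r = int t * defect \<chi> (n - q) r"
      by (rule cyclic_shift[of s f t]) (use f1 f2 in auto)
    ultimately have "s = t" using \<delta> s(2) t(2) by auto
    then show False using half[OF q(1)] s(1) t(1) by simp
  qed
  define d where "d = Gcd (insert h Y)"
  have d: "d dvd h" "l dvd d"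
    unfolding d_def using l_dvd_h lY by (auto intro!: Gcd_greatest Gcd_dvd)
  have dY: "d dvd b" if "b \<in> Y" for b unfolding d_def using that by (intro Gcd_dvd) simp
  have d0: "d > 0" using d(1) h0 by (simp add: d_def order.strict_iff_order)
  have long: "u (x + q) = u x" if q: "q \<in> Q" "0 < q" "q < n" "2 * h \<le> n - q" and x: "0 < x" "x < n - q" "\<not> d dvd x" for q x
  proof -
    interpret window \<chi> n h l h q "n - q" by (rule window[OF q(1-3)])
    have "defect \<chi> q x = 0"
    proof (rule reflect_bad[OF _ d(1)])
      show "defect \<chi> q b = 0" if "0 < b" "2 * b < n - q" "\<not> d dvd b" for b
      proof (rule ccontr)
        assume "defect \<chi> q b \<noteq> 0"
        moreover have "\<not> h dvd b" using that(3) d(1) dvd_trans by blast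
        ultimately have "b \<in> Y" unfolding Y_def using q that by blast
        then show False using dY that(3) by blast
      qed
    qed (use x in auto)
    then show ?thesis by (simp add: defect_def)
  qed
  have short: "u (x + q) = u x" if q: "q \<in> Q" "0 < q" "q < n" and x: "0 < x" "x < n - q" "\<not> d dvd x" for q x
  proof (cases "2 * h \<le> n - q")
    case True
    then show ?thesis using long q x by blast
  next
    case False
    obtain c where c: "n - q = h * c" using hQ[OF compl[OF q(1)]] by blast
    have "0 < h * c" using c q(3) by linarith
    then have "c > 0" using h0 by (simp add: zero_less_mult_iff)
    moreover have "c < 2" using False c h0 by (simp add: mult.commute)
    \<comment> \<open>here the window consists of a single step, and \<open>h\<close> itself, an element of \<open>Q\<close>, has a long window\<close>
    ultimately have nq: "n - q = h" using c by simp
    have hq: "h \<in> Q" using compl[OF q(1)] nq by simp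
    obtain e where e: "n = h * e" using h_dvd_n by blast
    have "e > 1"
    proof (rule ccontr)
      assume "\<not> e > 1"
      then have "h * e \<le> h * 1" using h0 by (intro mult_left_mono) auto
      then show False using e nq q(2) by simp
    qed
    moreover have "e \<noteq> 2" using half[OF hq] e by simp
    ultimately have e3: "e \<ge> 3" by simp
    have hn: "2 * h \<le> n - h" "h < n"
    proof -
      have "h * 3 \<le> n" unfolding e using e3 h0 by (intro mult_left_mono) auto
      then show "2 * h \<le> n - h" "h < n" using h0 by simp_all
    qed
    have chain: "u (x + int j * h) = u x" if "int j * h \<le> n - h" for j
      using that
    proof (induction j)
      case (Suc j)
      have js: "int (Suc j) * h = int j * h + h" by (simp add: algebra_simps)
      have "d dvd int j * h" using d(1) by simp
      then have nd: "\<not> d dvd x + int j * h" using x(3) by (simp add: dvd_add_left_iff)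
      have "0 \<le> int j * h" using h0 by simp
      then have b: "0 < x + int j * h" "x + int j * h < n - h" "int j * h \<le> n - h"
        using Suc.prems js x nq h0 by linarith+
      have "u (x + int j * h + h) = u (x + int j * h)"
        by (rule long[OF hq h0 hn(2,1) b(1,2) nd])
      moreover have "x + int (Suc j) * h = x + int j * h + h" unfolding js by simp
      ultimately show ?case using Suc.IH[OF b(3)] by (simp only:)
    qed simp
    define i where "i = nat (e - 1)"
    have i: "e = int i + 1" using e3 by (simp add: i_def)
    have "int i * h = n - h" unfolding e i by (simp add: algebra_simps)
    moreover have "q = n - h" using nq by simp
    ultimately show ?thesis using chain[of i] by simp
  qed
  have perd: "\<chi> (x + g) = \<chi> x" if "\<not> d dvd x" "h dvd g" for x g
  proof (rule periodic_from_generators[OF d(2,1), of "insert n Q"])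
    show "d dvd g" if "g \<in> insert n Q" for g
      using that hQ h_dvd_n d(1) dvd_trans by blast
    show "Gcd (insert n Q) dvd g" using gen that(2) by simp
    show "\<not> d dvd x" by fact
    fix g x assume g: "g \<in> insert n Q" and x: "\<not> d dvd x"
    show "u (x + g) = u x"
    proof (cases "g = n")
      case True
      then show ?thesis by (simp add: u_n)
    next
      case False
      then have "g \<in> Q" using g by simp
      define q where "q = g mod n"
      define x' where "x' = x mod n"
      have dn: "d dvd n" using d(1) h_dvd_n dvd_trans by blast
      have gq: "g = q + (g div n) * n" and xx: "x = x' + (x div n) * n" by (simp_all add: q_def x'_def)
      have qQ: "q \<in> Q"
        using Q(4)[OF \<open>g \<in> Q\<close>, of "- (g div n)"] by (simp add: q_def minus_div_mult_eq_mod[symmetric])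
      have "\<not> n dvd q"
      proof
        assume "n dvd q"
        then obtain j where "q = n * j" by blast
        then have "q = 0 + j * n" by (simp add: mult.commute)
        then have "v q = v 0" using parts_n_multiple(2)[of 0 j] by simp
        then show False using Q(2)[OF qQ] by (simp add: odd_part_def)
      qed
      then have q: "0 < q" "q < n" using mod_range[OF n_pos, of g] by (auto simp: q_def dvd_eq_mod_eq_0)
      have ndx: "\<not> d dvd x'" using x dn by (simp add: x'_def dvd_mod_iff)
      have "\<not> n dvd x" using x dn dvd_trans by blast
      from mod_range[OF n_pos this] have x': "0 < x'" "x' < n" by (simp_all add: x'_def)
      have "u (x' + q) = u x'"
      proof (cases "x' < n - q")
        case True
        then show ?thesis using short[OF qQ q] x' ndx by blast
      next
        case False
        have dnq: "d dvd n - q" using hQ[OF compl[OF qQ]] d(1) dvd_trans by blast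
        define y where "y = x' - (n - q)"
        have ndy: "\<not> d dvd y" using ndx dvd_diff_left_iff[OF dnq, of x'] unfolding y_def by blast
        then have y: "0 < y" "y < n - (n - q)" using False x' q unfolding y_def
          by (auto simp: order.strict_iff_order)
        have "u (y + (n - q)) = u y"
          by (rule short[OF compl[OF qQ] _ _ y ndy]) (use q in auto)
        moreover have "y + (n - q) = x'" "x' + q = y + n" by (simp_all add: y_def)
        ultimately show ?thesis using u_n[of y] by simp
      qed
      moreover have "u (x + g) = u (x' + q)"
      proof -
        have "(x div n + g div n) * n = (x div n) * n + (g div n) * n" by (rule distrib_right)
        then have "x + g = (x' + q) + (x div n + g div n) * n" using gq xx by linarith
        from arg_cong[OF this, of u] show ?thesis unfolding parts_n_multiple(1) .
      qed
      moreover have "u x = u x'" using arg_cong[OF xx, of u] unfolding parts_n_multiple(1) .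
      ultimately show ?thesis by simp
    qed
  qed
  show ?thesis
  proof (cases "d = h")
    case True
    have "periodic_off \<chi> d"
      unfolding periodic_off_def
    proof (intro allI impI)
      fix x g assume "\<not> d dvd x" "d dvd g"
      then show "\<chi> (x + g) = \<chi> x" using perd[of x g] True by simp
    qed
    then show ?thesis using d0 d by blast
  next
    case False
    show ?thesis
    proof (rule closure_step[of d h Y])
      show "\<chi> (x + h) = \<chi> x" if "\<not> d dvd x" for x using perd that by simp
      fix b assume "b \<in> Y"
      then obtain q where b: "\<not> h dvd b" and q: "q \<in> Q" "0 < q" "q < n" "2 * h \<le> n - q"
        and bN: "0 < b" "2 * b < n - q" "defect \<chi> q b \<noteq> 0" unfolding Y_def by blast
      interpret window \<chi> n h l h q "n - q" by (rule window[OF q(1-3)])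
      have perk: "\<chi> (w + q) = \<chi> w" if "\<not> d dvd w" for w
        by (rule perd[OF that m_dvd_k])
      have ne: "u (b + q) \<noteq> u b" using bN(3) by (simp add: defect_def)
      have lt: "b < n - q" using bN(1,2) by linarith
      have "balanced \<chi> b (n - q - b) d"
        by (rule balanced_shrink[OF bal d(1) m_dvd_k m_dvd_N dY[OF \<open>b \<in> Y\<close>] b bN(1) lt per perk vper'[OF b] ne])
      moreover have "n - q - b > h" using bN q(4) by linarith
      ultimately show "\<exists>N>h. h dvd N + b \<and> balanced \<chi> b N d"
        using m_dvd_N by (intro exI[of _ "n - q - b"]) simp
    qed (rule d0 d h0 d_def False[symmetric])+
  qed
qed

end

section \<open>Two functions with the same path sums\<close>

definition zero_one_periodic :: "int \<Rightarrow> (int \<Rightarrow> int) \<Rightarrow> bool" where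
  "zero_one_periodic n \<chi> \<longleftrightarrow> n > 0 \<and> \<chi> 0 = 0 \<and> (\<forall>x. \<chi> x = 0 \<or> \<chi> x = 1) \<and> (\<forall>x j. \<chi> (x + j * n) = \<chi> x)"

definition same_path_sums :: "int \<Rightarrow> (int \<Rightarrow> int) \<Rightarrow> (int \<Rightarrow> int) \<Rightarrow> bool" where
  "same_path_sums n \<chi> \<chi>' \<longleftrightarrow>
    (\<forall>zs. (\<forall>z\<in>set zs. z > 0) \<longrightarrow> sum_list zs = n \<longrightarrow> path_sum \<chi> 0 zs = path_sum \<chi>' 0 zs)"

lemma zero_one_periodic_uminus:
  assumes "zero_one_periodic n \<chi>" shows "zero_one_periodic n (\<lambda>x. \<chi> (- x))"
proof -
  have "\<chi> (- (x + j * n)) = \<chi> (- x)" for x j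
  proof -
    have "- (x + j * n) = - x + (- j) * n" by simp
    from arg_cong[OF this, of \<chi>] show ?thesis
      using assms unfolding zero_one_periodic_def by (simp only:)
  qed
  then show ?thesis using assms by (simp add: zero_one_periodic_def)
qed

text \<open>The indicator functions of two equivalent compositions of \<open>n\<close>.\<close>

locale two_functions =
  fixes n :: int and \<chi> \<chi>' :: "int \<Rightarrow> int"
  assumes \<chi>: "zero_one_periodic n \<chi>" and \<chi>': "zero_one_periodic n \<chi>'"
    and same: "same_path_sums n \<chi> \<chi>'"
begin

abbreviation "v \<equiv> odd_part \<chi>"
abbreviation "w \<equiv> odd_part \<chi>'"
abbreviation "u \<equiv> even_part \<chi>"

lemma n_pos: "n > 0" using \<chi> by (simp add: zero_one_periodic_def)

lemma shift: "\<chi> (x + j * n) = \<chi> x" "\<chi>' (x + j * n) = \<chi>' x"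
  using \<chi> \<chi>' unfolding zero_one_periodic_def by blast+

lemma shift_parts: "even_part \<chi> (x + j * n) = even_part \<chi> x" "even_part \<chi>' (x + j * n) = even_part \<chi>' x"
  "v (x + j * n) = v x" "w (x + j * n) = w x"
proof -
  have e: "- (x + j * n) = - x + (- j) * n" by simp
  show "even_part \<chi> (x + j * n) = even_part \<chi> x" "even_part \<chi>' (x + j * n) = even_part \<chi>' x"
    "v (x + j * n) = v x" "w (x + j * n) = w x"
    unfolding even_part_def odd_part_def e shift by simp_all
qed

lemma mod_shift: "x mod n = x + (- (x div n)) * n"
  by (simp add: minus_div_mult_eq_mod[symmetric])

lemma multiple_zero: "n dvd x \<Longrightarrow> \<chi> x = 0 \<and> \<chi>' x = 0"
proof -
  assume "n dvd x"
  then obtain j where "x = n * j" by blast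
  then have "x = 0 + j * n" by simp
  then show ?thesis using shift[of 0 j] \<chi> \<chi>' by (simp add: zero_one_periodic_def)
qed

lemma even_eq: "even_part \<chi>' x = u x"
proof (cases "n dvd x")
  case True
  then show ?thesis using multiple_zero[of x] multiple_zero[of "- x"] by (simp add: even_part_def)
next
  case False
  define a where "a = x mod n"
  have a: "0 < a" "a < n" unfolding a_def by (rule mod_range[OF n_pos False])+
  have "path_sum \<chi> 0 [a, n - a] = path_sum \<chi>' 0 [a, n - a]"
    using same a unfolding same_path_sums_def by simp
  moreover have "\<chi> (n - a) = \<chi> (- a)" "\<chi>' (n - a) = \<chi>' (- a)" using shift[of "- a" 1] by simp_all
  ultimately have "even_part \<chi>' a = u a" by (simp add: path_sum_two even_part_def)
  then show ?thesis unfolding a_def mod_shift shift_parts .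
qed

lemma v_range: "v x = 0 \<or> v x = 1 \<or> v x = - 1"
proof -
  have "\<chi> y = 0 \<or> \<chi> y = 1" for y using \<chi> unfolding zero_one_periodic_def by blast
  from this[of x] this[of "- x"] show ?thesis by (auto simp: odd_part_def)
qed

lemma w_eq: "w x = v x \<or> w x = - v x"
proof -
  have "\<chi> y = 0 \<or> \<chi> y = 1" "\<chi>' y = 0 \<or> \<chi>' y = 1" for y
    using \<chi> \<chi>' unfolding zero_one_periodic_def by blast+
  from this[of x] this[of "- x"] even_eq[of x] show ?thesis
    by (auto simp: odd_part_def even_part_def)
qed

lemma w_zero: "v x = 0 \<Longrightarrow> w x = 0"
  using w_eq[of x] by auto

lemma triple_range:
  assumes "0 < x" "0 < y" "0 < z" "x + y + z = n"
  shows "v x * v y + v y * v z + v x * v z = w x * w y + w y * w z + w x * w z"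
proof -
  have *: "2 * path_sum f 0 [x, y, z] =
      even_part f x * even_part f y + even_part f y * even_part f z + even_part f x * even_part f z -
      (odd_part f x * odd_part f y + odd_part f y * odd_part f z + odd_part f x * odd_part f z)"
    if per: "\<And>a. f (a + n) = f a" for f :: "int \<Rightarrow> int"
  proof -
    have "f (x + y) = f (- z)" "f (y + x) = f (- z)" "f (x + z) = f (- y)" "f (z + x) = f (- y)"
      "f (y + z) = f (- x)" "f (z + y) = f (- x)"
    proof -
      have g: "f (s + t) = f (- r)" if "s + t + r = n" for s t r
      proof -
        have "s + t = - r + n" using that by linarith
        then show ?thesis using per[of "- r"] by simp
      qed
      show "f (x + y) = f (- z)" "f (y + x) = f (- z)" "f (x + z) = f (- y)" "f (z + x) = f (- y)"
        "f (y + z) = f (- x)" "f (z + y) = f (- x)"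
        by (rule g, use assms(4) in linarith)+
    qed
    then show ?thesis
      unfolding path_sum_three add_0 even_part_def odd_part_def by (simp add: algebra_simps)
  qed
  have "path_sum \<chi> 0 [x, y, z] = path_sum \<chi>' 0 [x, y, z]"
    using same assms unfolding same_path_sums_def by simp
  moreover have "\<chi> (a + n) = \<chi> a" "\<chi>' (a + n) = \<chi>' a" for a using shift[of a 1] by simp_all
  ultimately show ?thesis using *[of \<chi>] *[of \<chi>'] even_eq by simp
qed

text \<open>Three elements of total \<open>0\<close> modulo \<open>n\<close> have representatives between \<open>0\<close> and \<open>n\<close> of total \<open>n\<close> or
\<open>2 n\<close>; negation exchanges the two cases and leaves products of two odd values unchanged.\<close>

lemma triple:
  assumes nd: "\<not> n dvd x" "\<not> n dvd y" "\<not> n dvd z" and sum: "n dvd x + y + z"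
  shows "v x * v y + v y * v z + v x * v z = w x * w y + w y * w z + w x * w z"
proof -
  define a b c where "a = x mod n" and "b = y mod n" and "c = z mod n"
  have r: "0 < a" "a < n" "0 < b" "b < n" "0 < c" "c < n"
    unfolding a_def b_def c_def by (rule mod_range[OF n_pos] nd)+
  have e: "v a = v x" "w a = w x" "v b = v y" "w b = w y" "v c = v z" "w c = w z"
    unfolding a_def b_def c_def mod_shift shift_parts by simp_all
  have "(x + y + z) - (a + b + c) = n * (x div n) + n * (y div n) + n * (z div n)"
    unfolding a_def b_def c_def by (simp add: minus_mod_eq_mult_div[symmetric])
  then have "n dvd (x + y + z) - (a + b + c)" by simp
  then have "n dvd a + b + c" using sum dvd_diff_right_iff[of n "x + y + z" "a + b + c"] by simp
  then obtain k where k: "a + b + c = n * k" by blast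
  have "0 < n * k" "n * k < n * 3" using k r by linarith+
  then have "0 < k" "k < 3" using n_pos by (simp_all add: zero_less_mult_iff)
  then consider "a + b + c = n" | "a + b + c = 2 * n" using k by (cases "k = 1") auto
  then show ?thesis
  proof cases
    case 1
    then show ?thesis using triple_range[of a b c] r e by simp
  next
    case 2
    have neg: "v (n - t) = - v t" "w (n - t) = - w t" for t
      using shift_parts(3,4)[of "- t" 1] by simp_all
    have "(n - a) + (n - b) + (n - c) = n" using 2 by simp
    then show ?thesis using triple_range[of "n - a" "n - b" "n - c"] r unfolding neg e by simp
  qed
qed

definition "P = {x. v x \<noteq> 0 \<and> w x = v x}"
definition "Q = {x. v x \<noteq> 0 \<and> w x = - v x}"

text \<open>Everything reduces to the identity of \<open>triple\<close> for \<open>p\<close>, \<open>q\<close> and \<open>- (p + q)\<close>, evaluated at signs.\<close>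

lemma absorption: "absorption P Q v n"
proof
  show "n > 0" by (rule n_pos)
  show "\<And>x. x \<in> P \<Longrightarrow> - x \<in> P" "\<And>x. x \<in> Q \<Longrightarrow> - x \<in> Q" by (simp_all add: P_def Q_def)
  show per: "\<And>x k. x \<in> P \<Longrightarrow> x + k * n \<in> P" "\<And>x k. x \<in> Q \<Longrightarrow> x + k * n \<in> Q"
    by (simp_all add: P_def Q_def shift_parts)
  show "0 \<notin> P" "0 \<notin> Q" by (simp_all add: P_def Q_def odd_part_def)
  show disj: "\<And>x. x \<in> P \<Longrightarrow> x \<notin> Q" by (simp add: P_def Q_def)
  show "v (- x) = - v x" for x by simp
  show "\<And>x. x \<in> P \<Longrightarrow> v x \<noteq> 0" "\<And>x. x \<in> Q \<Longrightarrow> v x \<noteq> 0" by (simp_all add: P_def Q_def)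
  fix p q assume p: "p \<in> P" and q: "q \<in> Q"
  have nd: "\<not> n dvd p + q"
  proof
    assume "n dvd p + q"
    then obtain k where "p + q = n * k" by blast
    then have "q = - p + k * n" by (simp add: algebra_simps)
    moreover have "- p + k * n \<in> P" using p by (intro per) (simp add: P_def)
    ultimately show False using disj q by simp
  qed
  have ndp: "\<not> n dvd p" "\<not> n dvd q" "\<not> n dvd - (p + q)"
  proof -
    have z: "v x = 0" if "n dvd x" for x
      using multiple_zero[OF that] multiple_zero[of "- x"] that by (simp add: odd_part_def)
    show "\<not> n dvd p" "\<not> n dvd q" using z p q by (auto simp: P_def Q_def)
    show "\<not> n dvd - (p + q)" using nd by (subst dvd_minus_iff)
  qed
  define r where "r = v (p + q)"
  define r' where "r' = w (p + q)"
  have e: "v (- (p + q)) = - r" "w (- (p + q)) = - r'" unfolding r_def r'_def by (rule parts_uminus)+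
  have eq: "v p * v q - v q * r - v p * r = - (v p * v q) + v q * r' - v p * r'"
    using triple[OF ndp] p q unfolding e by (simp add: P_def Q_def)
  have vr: "v p = 1 \<or> v p = - 1" "v q = 1 \<or> v q = - 1" "r = 0 \<or> r = 1 \<or> r = - 1" "r' = r \<or> r' = - r"
    using v_range[of p] v_range[of q] v_range[of "p + q"] w_eq[of "p + q"] p q
    by (auto simp: P_def Q_def r_def r'_def)
  have "r \<noteq> 0 \<and> (r' = r \<and> r = v p \<or> r' = - r \<and> r = v q)"
    using eq vr by auto
  then show "p + q \<in> P \<and> v (p + q) = v p \<or> p + q \<in> Q \<and> v (p + q) = v q"
    unfolding P_def Q_def r_def r'_def by auto
qed

lemma chi_eq: "w x = v x \<Longrightarrow> \<chi>' x = \<chi> x"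
  using parts_sum[of \<chi> x] parts_sum[of \<chi>' x] even_eq[of x] by simp

lemma chi_eq_neg: "w x = - v x \<Longrightarrow> \<chi>' x = \<chi> (- x)"
  using parts_sum[of \<chi> "- x"] parts_sum[of \<chi>' x] even_eq[of x] by simp

text \<open>Off the multiples of \<open>h\<close> the two functions agree, because a point of \<open>Q\<close> is a multiple of \<open>h\<close>. The periods
of the odd part there form a subgroup containing \<open>Q\<close>, by absorption; it is proper because a
nonzero value cannot be moved to \<open>0\<close>.\<close>

lemma top_layer:
  assumes Q: "Q \<noteq> {}" and p0: "p0 \<in> P" "\<not> Gcd (insert n Q) dvd p0"
  shows "\<exists>d. 1 < d \<and> d < n \<and> d dvd n \<and> periodic_off \<chi> d \<and> (\<forall>x. \<not> d dvd x \<longrightarrow> \<chi>' x = \<chi> x)"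
proof -
  interpret absorption P Q v n by (rule absorption)
  define h where "h = Gcd (insert n Q)"
  have hn: "h dvd n" unfolding h_def by (rule Gcd_dvd) simp
  have hQ: "h dvd q" if "q \<in> Q" for q unfolding h_def by (rule Gcd_dvd) (simp add: that)
  have h0: "h > 0" using hn n_pos by (simp add: h_def order.strict_iff_order)
  define P' where "P' = {p. v p \<noteq> 0 \<and> \<not> h dvd p}"
  have P'P: "p \<in> P" if "p \<in> P'" for p
    using that w_eq[of p] hQ[of p] by (auto simp: P'_def P_def Q_def)
  have P'_uminus: "- p \<in> P'" if "p \<in> P'" for p using that by (simp add: P'_def)
  define L where "L = {g. \<forall>p\<in>P'. p + g \<in> P' \<and> v (p + g) = v p}"
  have L_minus: "- g \<in> L" if "g \<in> L" for g
  proof -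
    have "p - g \<in> P' \<and> v (p - g) = v p" if p: "p \<in> P'" for p
    proof -
      have m: "- p + g \<in> P'" "v (- p + g) = v (- p)" using \<open>g \<in> L\<close> P'_uminus[OF p] by (auto simp: L_def)
      have e: "p - g = - (- p + g)" by simp
      show ?thesis unfolding e using P'_uminus[OF m(1)] m(2) by (simp only: parts_uminus) simp
    qed
    then show ?thesis by (simp add: L_def)
  qed
  have sub: "int_subgroup L"
  proof (rule int_subgroupI)
    fix x y assume "x \<in> L" "y \<in> L"
    then show "x + y \<in> L" by (simp add: L_def add.assoc[symmetric])
  qed (use L_minus in \<open>auto simp: L_def\<close>)
  define l where "l = Gcd L"
  have lL: "l dvd g \<longleftrightarrow> g \<in> L" for g
    using int_subgroup_Gcd[OF sub, of L g] by (auto simp: l_def intro: Gcd_dvd)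
  have "insert n Q \<subseteq> L"
  proof -
    have "n \<in> L" using shift_parts(3)[of _ 1] hn by (simp add: L_def P'_def dvd_add_left_iff)
    moreover have "q \<in> L" if q: "q \<in> Q" for q
    proof -
      have "p + q \<in> P' \<and> v (p + q) = v p" if p: "p \<in> P'" for p
      proof -
        have nh: "\<not> h dvd p + q" using p hQ[OF q] by (simp add: P'_def dvd_add_left_iff)
        then have "v (p + q) = v p" using absorb[OF P'P[OF p] q] hQ by blast
        then show ?thesis using p nh by (simp add: P'_def)
      qed
      then show ?thesis by (simp add: L_def)
    qed
    ultimately show ?thesis by blast
  qed
  then have lh: "l dvd h" unfolding lL h_def by (rule int_subgroup_Gcd[OF sub]) (rule dvd_refl)
  have zero: "v a = 0" if "l dvd a" "\<not> h dvd a" for a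
  proof (rule ccontr)
    assume "v a \<noteq> 0"
    then have "a \<in> P'" using that(2) by (simp add: P'_def)
    moreover have "- a \<in> L" using that(1) by (simp add: lL[symmetric])
    ultimately have "a + - a \<in> P'" unfolding L_def by blast
    then show False by (simp add: P'_def)
  qed
  have odd_per: "v (a + g) = v a" if "\<not> l dvd a" "l dvd g" for a g
  proof (cases "v a = 0")
    case False
    have "\<not> h dvd a" using that(1) lh dvd_trans by blast
    then have "a \<in> P'" using False by (simp add: P'_def)
    then show ?thesis using that(2) unfolding lL L_def by blast
  next
    case True
    show ?thesis
    proof (rule ccontr)
      assume "v (a + g) \<noteq> v a"
      moreover have "\<not> l dvd a + g" using that by (simp add: dvd_add_left_iff)
      then have "\<not> h dvd a + g" using lh dvd_trans by blast
      ultimately have "a + g \<in> P'" using True by (simp add: P'_def)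
      moreover have "- g \<in> L" using that(2) by (simp add: lL[symmetric])
      ultimately have "a + g + - g \<in> P'" unfolding L_def by blast
      then show False using True by (simp add: P'_def)
    qed
  qed
  have sep: "\<exists>p. \<not> l dvd p \<and> v p \<noteq> 0 \<and> v (a + p) \<noteq> v p" if a: "\<not> l dvd a" "v a = 0" for a
  proof (rule ccontr)
    assume "\<not> (\<exists>p. \<not> l dvd p \<and> v p \<noteq> 0 \<and> v (a + p) \<noteq> v p)"
    then have all: "v (a + p) = v p" if "\<not> l dvd p" "v p \<noteq> 0" for p using that by blast
    have "p + a \<in> P' \<and> v (p + a) = v p" if p: "p \<in> P'" for p
    proof -
      have np: "\<not> l dvd p" "v p \<noteq> 0" using p zero by (auto simp: P'_def)
      have vpa: "v (p + a) = v p" using all[OF np] by (simp add: add.commute)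
      have "\<not> h dvd p + a"
      proof
        assume "h dvd p + a"
        then have "l dvd p + a" using lh dvd_trans by blast
        moreover have "\<not> l dvd - p" using np(1) by simp
        ultimately have "v (- p + (p + a)) = v (- p)" using odd_per by blast
        then show False using a(2) np(2) by simp
      qed
      then show ?thesis using vpa np(2) by (simp add: P'_def)
    qed
    then have "a \<in> L" by (simp add: L_def)
    then show False using a(1) lL by blast
  qed
  have rng: "\<chi> x = 0 \<or> \<chi> x = 1" for x using \<chi> unfolding zero_one_periodic_def by blast
  have lay: "layer \<chi> n h l"
    by unfold_locales (use rng n_pos shift(1)[of _ 1] lh hn odd_per zero sep in auto)
  have agree: "\<chi>' x = \<chi> x" if "\<not> h dvd x" for x
  proof (rule chi_eq)
    show "w x = v x"
    proof (cases "v x = 0")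
      case True
      then show ?thesis using w_zero by simp
    next
      case False
      then have "x \<in> P" using that by (intro P'P) (simp add: P'_def)
      then show ?thesis by (simp add: P_def)
    qed
  qed
  have win: "balanced \<chi> q (n - q) h" if q: "q \<in> Q" "0 < q" "q < n" for q
  proof (rule balanced_start[where \<chi>' = \<chi>' and d = "v q"])
    show "path_sum \<chi> 0 zs = path_sum \<chi>' 0 zs" if "\<forall>z\<in>set zs. 0 < z" "sum_list zs = n" for zs
      using same that unfolding same_path_sums_def by blast
    show "\<chi> x = \<chi>' x" if "\<not> h dvd x" for x using agree[OF that] by simp
    have "w q = - v q" using q(1) by (simp add: Q_def)
    from chi_eq_neg[OF this] chi_eq_neg[of "- q"] this
    have e: "\<chi>' q = \<chi> (- q)" "\<chi>' (- q) = \<chi> q" by simp_all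
    show "\<chi> q - \<chi>' q = v q" unfolding e odd_part_def ..
    have "\<chi> (n - q) = \<chi> (- q)" "\<chi>' (n - q) = \<chi>' (- q)" using shift[of "- q" 1] by simp_all
    then show "\<chi> (n - q) - \<chi>' (n - q) = - v q" by (simp add: e odd_part_def)
    show "v q \<noteq> 0" using q(1) by (simp add: Q_def)
  qed (use hQ q in auto)
  obtain d where d: "d > 0" "l dvd d" "d dvd h" "periodic_off \<chi> d"
    using layer.periodic_off_exists[OF lay h0 Q nonzero_Q uminus_Q periodic_Q h_def win] by blast
  have "d dvd n" using d(3) hn dvd_trans by blast
  moreover have "d < n"
  proof -
    obtain q where q: "q \<in> Q" using Q by blast
    have "\<not> n dvd q"
    proof
      assume nq: "n dvd q"
      then have "v q = 0" using multiple_zero[of q] multiple_zero[of "- q"] by (simp add: odd_part_def)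
      then show False using q by (simp add: Q_def)
    qed
    from mod_range[OF n_pos this] have r: "0 < q mod n" "q mod n < n" .
    have "h dvd q mod n" using hQ[OF q] hn by (simp add: dvd_mod_iff)
    then have "d dvd q mod n" using d(3) dvd_trans by blast
    then show ?thesis using r zdvd_imp_le[of d "q mod n"] by linarith
  qed
  moreover have "d \<noteq> 1"
  proof
    assume "d = 1"
    then have "l dvd p0" using d(2) dvd_trans[of l 1 p0] by (simp only: one_dvd)
    then show False using zero[of p0] p0 by (simp add: P_def h_def)
  qed
  moreover have "\<forall>x. \<not> d dvd x \<longrightarrow> \<chi>' x = \<chi> x" using agree d(3) dvd_trans by blast
  ultimately show ?thesis using d(1,4) by (intro exI[of _ d]) simp
qed

end

text \<open>Passing to \<open>\<lambda>x. \<chi>' (- x)\<close> exchanges the roles of \<open>P\<close> and \<open>Q\<close>.\<close>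

theorem same_path_sums_cases:
  assumes "zero_one_periodic n \<chi>" "zero_one_periodic n \<chi>'"
    "same_path_sums n \<chi> \<chi>'" "same_path_sums n \<chi> (\<lambda>x. \<chi>' (- x))"
  shows "\<chi>' = \<chi> \<or> (\<lambda>x. \<chi>' (- x)) = \<chi> \<or>
    (\<exists>d. 1 < d \<and> d < n \<and> d dvd n \<and> periodic_off \<chi> d \<and>
      ((\<forall>x. \<not> d dvd x \<longrightarrow> \<chi>' x = \<chi> x) \<or> (\<forall>x. \<not> d dvd x \<longrightarrow> \<chi>' (- x) = \<chi> x)))"
proof -
  interpret A: two_functions n \<chi> \<chi>' by unfold_locales (fact assms)+
  interpret B: two_functions n \<chi> "\<lambda>x. \<chi>' (- x)"
    by unfold_locales (use assms zero_one_periodic_uminus in auto)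
  have wB: "odd_part (\<lambda>x. \<chi>' (- x)) x = - odd_part \<chi>' x" for x by (simp add: odd_part_def)
  have PQ: "B.P = A.Q" "B.Q = A.P"
    unfolding A.P_def A.Q_def B.P_def B.Q_def wB by auto
  show ?thesis
  proof (cases "A.Q = {} \<or> A.P = {}")
    case True
    then show ?thesis
    proof
      assume Q: "A.Q = {}"
      have "odd_part \<chi>' x = odd_part \<chi> x" for x
        using Q A.w_eq[of x] unfolding A.Q_def by auto
      then have "\<chi>' = \<chi>" using A.chi_eq by auto
      then show ?thesis by blast
    next
      assume P: "A.P = {}"
      have "odd_part \<chi>' x = - odd_part \<chi> x" for x
        using P A.w_eq[of x] unfolding A.P_def by auto
      then have "(\<lambda>x. \<chi>' (- x)) = \<chi>" using B.chi_eq wB by auto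
      then show ?thesis by blast
    qed
  next
    case False
    then have ne: "A.Q \<noteq> {}" "A.P \<noteq> {}" by auto
    from absorption.not_mutually_generated[OF A.absorption ne(2)] show ?thesis
    proof
      assume "\<exists>p\<in>A.P. \<not> Gcd (insert n A.Q) dvd p"
      then show ?thesis using A.top_layer[OF ne(1)] by blast
    next
      assume "\<exists>q\<in>A.Q. \<not> Gcd (insert n A.P) dvd q"
      then show ?thesis using B.top_layer ne(2) unfolding PQ by blast
    qed
  qed
qed

section \<open>Equivalent compositions have matching factorizations\<close>

lemma partial_sums_coarsening:
  assumes "[] \<notin> set bs" shows "partial_sums (map sum_list bs) \<subseteq> partial_sums (concat bs)"
  using assms
proof (induction bs)
  case (Cons b bs)
  show ?case
  proof (cases "bs = []")
    case False
    then obtain b' bs' where b: "bs = b' # bs'" by (cases bs) auto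
    have ne: "concat bs \<noteq> []" "b \<noteq> []" using Cons.prems b by auto
    have "partial_sums (map sum_list (b # bs)) =
        insert (sum_list b) ((+) (sum_list b) ` partial_sums (map sum_list bs))"
      using False by (simp add: partial_sums_Cons)
    also have "\<dots> \<subseteq> insert (sum_list b) ((+) (sum_list b) ` partial_sums (concat bs))"
      using Cons by (intro insert_mono image_mono) simp
    also have "\<dots> \<subseteq> partial_sums (concat (b # bs))"
      using partial_sums_append[OF ne(2,1)] by auto
    finally show ?thesis .
  qed simp
qed simp

lemma coarsening_of_partial_sums:
  assumes "composition \<alpha>" "composition \<beta>" "sum_list \<alpha> = sum_list \<beta>" "partial_sums \<alpha> \<subseteq> partial_sums \<beta>"
  shows "coarsening \<alpha> \<beta>"
  using assms
proof (induction \<alpha> arbitrary: \<beta>)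
  case Nil
  from Nil.prems(2,3) have "\<beta> = []" by (cases \<beta>) auto
  then show ?case by simp
next
  case (Cons a as)
  show ?case
  proof (cases "as = []")
    case True
    have "\<beta> \<noteq> []" using Cons.prems(1,3) by auto
    then show ?thesis
      unfolding coarsening_def using True Cons.prems(3) by (intro exI[of _ "[\<beta>]"]) simp
  next
    case False
    have "a \<in> partial_sums \<beta>" using Cons.prems(4) partial_sums_Cons[OF False, of a] by auto
    then obtain i where i: "0 < i" "i < length \<beta>" "a = sum_list (take i \<beta>)"
      unfolding partial_sums_def by auto
    define \<beta>1 \<beta>2 where "\<beta>1 = take i \<beta>" and "\<beta>2 = drop i \<beta>"
    have \<beta>: "\<beta> = \<beta>1 @ \<beta>2" "\<beta>1 \<noteq> []" "\<beta>2 \<noteq> []" "a = sum_list \<beta>1"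
      using i by (auto simp: \<beta>1_def \<beta>2_def)
    have comp: "composition \<beta>1" "composition \<beta>2" "composition as"
      using Cons.prems(1,2) \<beta>(1) by simp_all
    have ps: "partial_sums \<beta> = partial_sums \<beta>1 \<union> {a} \<union> (+) a ` partial_sums \<beta>2"
      using partial_sums_append[OF \<beta>(2,3)] \<beta>(1,4) by simp
    have "partial_sums as \<subseteq> partial_sums \<beta>2"
    proof
      fix s assume s: "s \<in> partial_sums as"
      then have s0: "s > 0" using partial_sums_bounds[OF comp(3)] by auto
      have "a + s \<in> partial_sums \<beta>" using Cons.prems(4) partial_sums_Cons[OF False, of a] s by auto
      moreover have "a + s \<notin> partial_sums \<beta>1" using partial_sums_bounds[OF comp(1)] \<beta>(4) by auto
      ultimately show "s \<in> partial_sums \<beta>2" using s0 unfolding ps by auto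
    qed
    moreover have "sum_list as = sum_list \<beta>2" using Cons.prems(3) \<beta>(1,4) by simp
    ultimately obtain bs where "[] \<notin> set bs" "concat bs = \<beta>2" "map sum_list bs = as"
      using Cons.IH[OF comp(3,2)] unfolding coarsening_def by blast
    then show ?thesis
      unfolding coarsening_def using \<beta> by (intro exI[of _ "\<beta>1 # bs"]) auto
  qed
qed

lemma coarsening_iff_partial_sums:
  assumes "composition \<alpha>" "composition \<beta>" "sum_list \<alpha> = sum_list \<beta>"
  shows "coarsening \<alpha> \<beta> \<longleftrightarrow> partial_sums \<alpha> \<subseteq> partial_sums \<beta>"
proof
  assume "coarsening \<alpha> \<beta>"
  then obtain bs where "[] \<notin> set bs" "concat bs = \<beta>" "map sum_list bs = \<alpha>"
    unfolding coarsening_def by blast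
  then show "partial_sums \<alpha> \<subseteq> partial_sums \<beta>" using partial_sums_coarsening by blast
qed (rule coarsening_of_partial_sums[OF assms])

definition indicator_of :: "nat list \<Rightarrow> int \<Rightarrow> int" where
  "indicator_of \<beta> x = of_bool (nat (x mod int (sum_list \<beta>)) \<in> partial_sums \<beta>)"

lemma indicator_of_nat:
  "x < sum_list \<beta> \<Longrightarrow> indicator_of \<beta> (int x) = of_bool (x \<in> partial_sums \<beta>)"
  by (simp add: indicator_of_def)

lemma zero_not_partial_sum: "composition \<beta> \<Longrightarrow> 0 \<notin> partial_sums \<beta>"
  using partial_sums_bounds[of \<beta>] by auto

lemma zero_one_periodic_indicator:
  assumes "pos_composition \<beta>"
  shows "zero_one_periodic (int (sum_list \<beta>)) (indicator_of \<beta>)"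
  using pos_compositionD[OF assms] zero_not_partial_sum[of \<beta>]
  by (simp add: zero_one_periodic_def indicator_of_def)

lemma indicator_of_inject:
  assumes "pos_composition \<beta>" "pos_composition \<gamma>" "sum_list \<beta> = sum_list \<gamma>"
    "indicator_of \<beta> = indicator_of \<gamma>"
  shows "\<beta> = \<gamma>"
proof (rule pos_composition_eqI[OF assms(1-3)])
  fix x assume "0 < x" "x < sum_list \<beta>"
  then have "of_bool (x \<in> partial_sums \<beta>) = (of_bool (x \<in> partial_sums \<gamma>) :: int)"
    using indicator_of_nat[of x \<beta>] indicator_of_nat[of x \<gamma>] assms(3,4) by metis
  then show "x \<in> partial_sums \<beta> \<longleftrightarrow> x \<in> partial_sums \<gamma>" by (simp add: of_bool_eq_iff)
qed

lemma indicator_of_rev: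
  assumes "pos_composition \<beta>" shows "indicator_of (rev \<beta>) x = indicator_of \<beta> (- x)"
proof -
  define n where "n = sum_list \<beta>"
  have n: "n > 0" using pos_compositionD[OF assms] by (simp add: n_def)
  show ?thesis
  proof (cases "int n dvd x")
    case True
    then have "x mod int n = 0" "(- x) mod int n = 0" by simp_all
    then show ?thesis
      using zero_not_partial_sum[of \<beta>] zero_not_partial_sum[of "rev \<beta>"] pos_compositionD(2)[OF assms]
      by (simp add: indicator_of_def n_def[symmetric])
  next
    case False
    have r: "0 < x mod int n" "x mod int n < int n" using mod_range[OF _ False] n by simp_all
    define s where "s = nat (x mod int n)"
    have s: "0 < s" "s < n" "x mod int n = int s" using r by (simp_all add: s_def)
    have m: "(- x) mod int n = int n - int s" using s False by (simp add: zmod_zminus1_eq_if dvd_eq_mod_eq_0)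
    have "indicator_of (rev \<beta>) x = of_bool (s \<in> partial_sums (rev \<beta>))"
      by (simp add: indicator_of_def n_def[symmetric] s(3))
    also have "\<dots> = of_bool (n - s \<in> partial_sums \<beta>)"
      using partial_sums_rev_iff[OF pos_compositionD(2)[OF assms] s(1)] s(2) by (simp add: n_def)
    also have "\<dots> = indicator_of \<beta> (- x)"
      using s(2) by (simp add: indicator_of_def n_def[symmetric] m nat_diff_distrib')
    finally show ?thesis .
  qed
qed

lemma arrangements_map: "arrangements (map f zs) = map (map f) (arrangements zs)"
proof (induction zs)
  case (Cons a zs)
  have "insertions (f a) (map f ys) = map (map f) (insertions a ys)" for ys
    by (simp add: insertions_def take_map drop_map del: upt_Suc)
  then show ?case by (simp add: Cons.IH map_concat o_def)
qed simp

lemma path_sum_map: "path_sum \<chi> 0 (map f zs) = (\<Sum>ys\<leftarrow>arrangements zs. path \<chi> 0 (map f ys))"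
  by (simp add: path_sum_def arrangements_map o_def)

lemma path_indicator:
  assumes "composition ys" "composition \<beta>" "sum_list ys = sum_list \<beta>"
  shows "path (indicator_of \<beta>) 0 (map int ys) = of_bool (coarsening ys \<beta>)"
proof -
  have int_sum: "sum_list (map int xs) = int (sum_list xs)" for xs by (induction xs) auto
  have "path (indicator_of \<beta>) 0 (map int ys) =
      (\<Prod>i\<in>{0<..<length ys}. of_bool (sum_list (take i ys) \<in> partial_sums \<beta>))"
    unfolding path_def length_map
  proof (intro prod.cong refl)
    fix i assume i: "i \<in> {0<..<length ys}"
    then have "sum_list (take i ys) \<in> partial_sums ys" by (auto simp: partial_sums_def)
    then have "sum_list (take i ys) < sum_list \<beta>" using partial_sums_bounds[OF assms(1)] assms(3) by auto
    then show "indicator_of \<beta> (0 + sum_list (take i (map int ys))) =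
        of_bool (sum_list (take i ys) \<in> partial_sums \<beta>)"
      by (simp add: take_map int_sum indicator_of_nat)
  qed
  also have "\<dots> = of_bool (\<forall>i\<in>{0<..<length ys}. sum_list (take i ys) \<in> partial_sums \<beta>)"
  proof (cases "\<forall>i\<in>{0<..<length ys}. sum_list (take i ys) \<in> partial_sums \<beta>")
    case False
    then have "\<exists>i\<in>{0<..<length ys}. of_bool (sum_list (take i ys) \<in> partial_sums \<beta>) = (0::int)" by auto
    then show ?thesis using False by (simp add: prod_zero_iff)
  qed simp
  also have "\<dots> = of_bool (partial_sums ys \<subseteq> partial_sums \<beta>)"
    by (simp add: partial_sums_def image_subset_iff)
  also have "\<dots> = of_bool (coarsening ys \<beta>)"
    using coarsening_iff_partial_sums[OF assms] by simp
  finally show ?thesis .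
qed

lemma count_map_upt: "count (mset (map f [0..<k])) y = (\<Sum>j<k. of_bool (f j = y))"
  by (induction k) auto

lemma sum_of_bool_nth: "(\<Sum>j<length ys. of_bool (ys ! j = a)) = count (mset ys) a"
proof (induction ys)
  case (Cons y ys)
  have "(\<Sum>j<length (y # ys). of_bool ((y # ys) ! j = a)) =
      of_bool (y = a) + (\<Sum>j<length ys. of_bool (ys ! j = a))"
    by (simp only: length_Cons sum.lessThan_Suc_shift nth_Cons_0 nth_Cons_Suc)
  also have "\<dots> = count (mset (y # ys)) a" unfolding Cons.IH by simp
  finally show ?case .
qed simp

lemma insertion_eq_iff:
  assumes "length ys = Suc (length w)" "j \<le> length w"
  shows "take j w @ a # drop j w = ys \<longleftrightarrow> ys ! j = a \<and> take j ys @ drop (Suc j) ys = w"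
proof
  assume "take j w @ a # drop j w = ys"
  then have ys: "ys = take j w @ a # drop j w" by simp
  have "length (take j w) = j" using assms(2) by simp
  then have "ys ! j = a" "take j ys = take j w" "drop (Suc j) ys = drop j w"
    unfolding ys by (simp_all add: nth_append)
  then show "ys ! j = a \<and> take j ys @ drop (Suc j) ys = w" by simp
next
  assume *: "ys ! j = a \<and> take j ys @ drop (Suc j) ys = w"
  have j: "j < length ys" using assms by simp
  have "take j w = take j ys" "drop j w = drop (Suc j) ys"
    unfolding conjunct2[OF *, symmetric] using j by simp_all
  then show "take j w @ a # drop j w = ys" using conjunct1[OF *] id_take_nth_drop[OF j] by simp
qed

text \<open>An arrangement of \<open>a # zs\<close> arises once for each position of an entry \<open>a\<close> in it, from an arrangement of
\<open>zs\<close>; the number of such positions depends only on the multiset.\<close>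

lemma count_arrangements:
  "\<exists>c. \<forall>ys. count (mset (arrangements zs)) ys = (if mset ys = mset zs then c else 0)"
proof (induction zs)
  case Nil
  show ?case by (intro exI[of _ 1]) auto
next
  case (Cons a zs)
  then obtain c where c: "count (mset (arrangements zs)) ys = (if mset ys = mset zs then c else 0)" for ys
    by blast
  have "count (mset (arrangements (a # zs))) ys =
      (if mset ys = mset (a # zs) then count (mset (a # zs)) a * c else 0)" for ys
  proof (cases "length ys = Suc (length zs)")
    case False
    then have "ys \<notin> set (arrangements (a # zs))" "mset ys \<noteq> mset (a # zs)"
      using length_arrangements[of ys "a # zs"] mset_eq_length[of ys "a # zs"] by auto
    then show ?thesis by (simp add: count_mset_0_iff del: arrangements.simps)
  next
    case True
    let ?r = "\<lambda>j. take j ys @ drop (Suc j) ys"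
    have ins: "count (mset (insertions a w)) ys =
        (\<Sum>j<length ys. of_bool (ys ! j = a) * of_bool (?r j = w))" if "length w = length zs" for w
    proof -
      have len: "length ys = Suc (length w)" using that True by simp
      show ?thesis
        unfolding insertions_def count_map_upt len
      proof (rule sum.cong[OF refl])
        fix j assume "j \<in> {..<Suc (length w)}"
        then show "of_bool (take j w @ a # drop j w = ys) = (of_bool (ys ! j = a) * of_bool (?r j = w) :: nat)"
          using insertion_eq_iff[OF len, of j a] by simp
      qed
    qed
    have cc: "count (mset (concat (map (insertions a) ws))) ys =
        (\<Sum>j<length ys. of_bool (ys ! j = a) * count (mset ws) (?r j))"
      if "\<And>w. w \<in> set ws \<Longrightarrow> length w = length zs" for ws
      using that
    proof (induction ws)
      case (Cons w ws)
      have "count (mset (concat (map (insertions a) (w # ws)))) ys =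
          (\<Sum>j<length ys. of_bool (ys ! j = a) * of_bool (?r j = w)) +
          (\<Sum>j<length ys. of_bool (ys ! j = a) * count (mset ws) (?r j))"
        using Cons ins[of w] by simp
      also have "\<dots> = (\<Sum>j<length ys. of_bool (ys ! j = a) * count (mset (w # ws)) (?r j))"
        unfolding sum.distrib[symmetric] by (intro sum.cong refl) auto
      finally show ?case .
    qed simp
    have r: "mset (?r j) = mset zs \<longleftrightarrow> mset ys = mset (a # zs)" if "j < length ys" "ys ! j = a" for j
    proof -
      have "mset ys = add_mset a (mset (?r j))"
        using arg_cong[OF id_take_nth_drop[OF that(1)], of mset] that(2) by simp
      then show ?thesis by simp
    qed
    have "count (mset (arrangements (a # zs))) ys =
        (\<Sum>j<length ys. of_bool (ys ! j = a) * count (mset (arrangements zs)) (?r j))"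
      using cc[of "arrangements zs", OF length_arrangements] by (simp only: arrangements.simps)
    also have "\<dots> = (\<Sum>j<length ys. of_bool (ys ! j = a) * (if mset ys = mset (a # zs) then c else 0))"
    proof (rule sum.cong[OF refl])
      fix j assume "j \<in> {..<length ys}"
      then show "of_bool (ys ! j = a) * count (mset (arrangements zs)) (?r j) =
          of_bool (ys ! j = a) * (if mset ys = mset (a # zs) then c else 0)"
        using r[of j] unfolding c by (cases "ys ! j = a") simp_all
    qed
    also have "\<dots> = count (mset ys) a * (if mset ys = mset (a # zs) then c else 0)"
      unfolding sum_distrib_right[symmetric] sum_of_bool_nth ..
    finally show ?thesis by (simp del: arrangements.simps)
  qed
  then show ?case by blast
qed

lemma sum_list_of_bool_count:
  assumes "distinct ws" shows "(\<Sum>y\<leftarrow>xs. of_bool (y \<in> set ws)) = (\<Sum>w\<leftarrow>ws. int (count (mset xs) w))"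
proof (induction xs)
  case (Cons x xs)
  have "(\<Sum>w\<leftarrow>ws. int (count (mset (x # xs)) w)) = (\<Sum>w\<leftarrow>ws. of_bool (w = x) + int (count (mset xs) w))"
    by (intro sum_list_map_cong_set) auto
  also have "\<dots> = (\<Sum>w\<leftarrow>ws. of_bool (w = x)) + (\<Sum>w\<leftarrow>ws. int (count (mset xs) w))"
    by (rule sum_list_addf)
  also have "(\<Sum>w\<leftarrow>ws. of_bool (w = x)) = (of_bool (x \<in> set ws) :: int)"
    using assms by (induction ws) auto
  finally show ?case using Cons by simp
qed simp

lemma path_sum_coarsenings:
  assumes "\<exists>c. \<forall>ys. count (mset (arrangements zs)) ys = (if mset ys = mset zs then c else 0)"
    and "composition zs" "composition \<beta>" "sum_list zs = sum_list \<beta>"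
  shows "path_sum (indicator_of \<beta>) 0 (map int zs) =
    coarsening_sum (\<lambda>\<alpha>. int (count (mset (arrangements zs)) \<alpha>)) \<beta>"
proof -
  have "path_sum (indicator_of \<beta>) 0 (map int zs) =
      (\<Sum>ys\<leftarrow>arrangements zs. of_bool (ys \<in> set (coarsenings \<beta>)))"
    unfolding path_sum_map
  proof (rule sum_list_map_cong_set)
    fix ys assume "ys \<in> set (arrangements zs)"
    then have m: "mset ys = mset zs" by (rule mset_arrangements)
    then have "composition ys" "sum_list ys = sum_list \<beta>"
      using composition_mset_cong[OF m] assms(2,4) by (simp_all flip: sum_mset_sum_list)
    then show "path (indicator_of \<beta>) 0 (map int ys) = of_bool (ys \<in> set (coarsenings \<beta>))"
      using path_indicator assms(3) by (simp add: set_coarsenings)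
  qed
  then show ?thesis using sum_list_of_bool_count[OF distinct_coarsenings[OF assms(3)]] by simp
qed

lemma coarsening_shapes_sum:
  assumes "coarsening_shapes \<beta> = coarsening_shapes \<gamma>" shows "sum_list \<beta> = sum_list \<gamma>"
proof -
  have "mset \<beta> \<in># coarsening_shapes \<gamma>"
    using self_in_coarsenings[of \<beta>] unfolding assms[symmetric] by (simp add: coarsening_shapes_def)
  then obtain \<alpha> where "\<alpha> \<in> set (coarsenings \<gamma>)" "mset \<beta> = mset \<alpha>"
    by (auto simp: coarsening_shapes_def)
  then show ?thesis using coarsenings_props(1)[of \<alpha> \<gamma>] by (metis sum_mset_sum_list)
qed

lemma same_path_sums_of_shapes:
  assumes "composition \<beta>" "composition \<gamma>" and eq: "coarsening_shapes \<beta> = coarsening_shapes \<gamma>"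
  shows "same_path_sums (int (sum_list \<beta>)) (indicator_of \<beta>) (indicator_of \<gamma>)"
  unfolding same_path_sums_def
proof (intro allI impI)
  fix zs :: "int list" assume zs: "\<forall>z\<in>set zs. z > 0" "sum_list zs = int (sum_list \<beta>)"
  define ws where "ws = map nat zs"
  have z: "zs = map int ws" unfolding ws_def map_map by (rule map_idI[symmetric]) (use zs(1) in auto)
  have ws: "composition ws" using zs(1) unfolding composition_def ws_def by auto
  have int_sum: "sum_list (map int xs) = int (sum_list xs)" for xs by (induction xs) auto
  have sum: "sum_list ws = sum_list \<beta>" "sum_list ws = sum_list \<gamma>"
    using zs(2) coarsening_shapes_sum[OF eq] unfolding z int_sum by simp_all
  obtain c where c: "count (mset (arrangements ws)) ys = (if mset ys = mset ws then c else 0)" for ys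
    using count_arrangements by blast
  have "coarsening_sum (\<lambda>\<alpha>. int (count (mset (arrangements ws)) \<alpha>)) \<beta> =
      coarsening_sum (\<lambda>\<alpha>. int (count (mset (arrangements ws)) \<alpha>)) \<gamma>"
    by (rule coarsening_sum_symmetric[OF eq, where G = "\<lambda>Y. int (if Y = mset ws then c else 0)"])
      (simp_all only: c)
  then show "path_sum (indicator_of \<beta>) 0 zs = path_sum (indicator_of \<gamma>) 0 zs"
    unfolding z using path_sum_coarsenings[OF count_arrangements ws] assms(1,2) sum by simp
qed

lemma same_path_sums_scale:
  assumes "same_path_sums (d * n) \<chi> \<chi>'" "d > 0"
  shows "same_path_sums n (\<lambda>x. \<chi> (d * x)) (\<lambda>x. \<chi>' (d * x))"
  unfolding same_path_sums_def
proof (intro allI impI)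
  fix zs :: "int list" assume zs: "\<forall>z\<in>set zs. z > 0" "sum_list zs = n"
  have "path_sum \<chi> 0 (map ((*) d) zs) = path_sum \<chi>' 0 (map ((*) d) zs)"
    using assms zs unfolding same_path_sums_def by (simp add: sum_list_const_mult)
  moreover have "path_sum f 0 (map ((*) d) zs) = path_sum (\<lambda>x. f (d * x)) 0 zs" for f
    unfolding path_sum_map unfolding path_sum_def
    by (intro sum_list_map_cong_set) (simp add: path_def take_map sum_list_const_mult)
  ultimately show "path_sum (\<lambda>x. \<chi> (d * x)) 0 zs = path_sum (\<lambda>x. \<chi>' (d * x)) 0 zs" by simp
qed

definition has_cut :: "nat \<Rightarrow> nat list \<Rightarrow> bool" where
  "has_cut d \<beta> \<longleftrightarrow> d > 0 \<and> d dvd sum_list \<beta> \<and> periodic_off (indicator_of \<beta>) (int d)"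

text \<open>The two factors of a composition that is cut at \<open>d\<close>: the partial sums divisible by \<open>d\<close>, rescaled, and
those below \<open>d\<close>.\<close>

definition quotient_part :: "nat \<Rightarrow> nat list \<Rightarrow> nat list" where
  "quotient_part d \<beta> = (THE \<sigma>. pos_composition \<sigma> \<and> sum_list \<sigma> = sum_list \<beta> div d \<and>
     partial_sums \<sigma> = {j. d * j \<in> partial_sums \<beta>})"

definition remainder_part :: "nat \<Rightarrow> nat list \<Rightarrow> nat list" where
  "remainder_part d \<beta> = (THE \<tau>. pos_composition \<tau> \<and> sum_list \<tau> = d \<and>
     partial_sums \<tau> = {j \<in> partial_sums \<beta>. j < d})"

lemma the_composition:
  assumes "n > 0" "S \<subseteq> {0<..<n}"
  shows "pos_composition (THE \<alpha>. pos_composition \<alpha> \<and> sum_list \<alpha> = n \<and> partial_sums \<alpha> = S)"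
    "sum_list (THE \<alpha>. pos_composition \<alpha> \<and> sum_list \<alpha> = n \<and> partial_sums \<alpha> = S) = n"
    "partial_sums (THE \<alpha>. pos_composition \<alpha> \<and> sum_list \<alpha> = n \<and> partial_sums \<alpha> = S) = S"
proof -
  have "\<exists>!\<alpha>. pos_composition \<alpha> \<and> sum_list \<alpha> = n \<and> partial_sums \<alpha> = S"
  proof (rule ex_ex1I)
    show "\<exists>\<alpha>. pos_composition \<alpha> \<and> sum_list \<alpha> = n \<and> partial_sums \<alpha> = S"
      by (rule composition_exists[OF assms])
  qed (auto intro: pos_composition_eqI)
  from theI'[OF this] show "pos_composition (THE \<alpha>. pos_composition \<alpha> \<and> sum_list \<alpha> = n \<and> partial_sums \<alpha> = S)"
    "sum_list (THE \<alpha>. pos_composition \<alpha> \<and> sum_list \<alpha> = n \<and> partial_sums \<alpha> = S) = n"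
    "partial_sums (THE \<alpha>. pos_composition \<alpha> \<and> sum_list \<alpha> = n \<and> partial_sums \<alpha> = S) = S"
    by simp_all
qed

lemma quotient_part_props:
  assumes "pos_composition \<beta>" "d > 0" "d dvd sum_list \<beta>"
  shows "pos_composition (quotient_part d \<beta>)" "sum_list (quotient_part d \<beta>) = sum_list \<beta> div d"
    "partial_sums (quotient_part d \<beta>) = {j. d * j \<in> partial_sums \<beta>}"
proof -
  have n: "sum_list \<beta> > 0" and c: "composition \<beta>" using pos_compositionD[OF assms(1)] by simp_all
  have pos: "0 < sum_list \<beta> div d" using n assms(2,3) by (simp add: div_greater_zero_iff dvd_imp_le)
  obtain k where k: "sum_list \<beta> = d * k" using assms(3) by blast
  have sub: "{j. d * j \<in> partial_sums \<beta>} \<subseteq> {0<..<sum_list \<beta> div d}"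
  proof
    fix j assume "j \<in> {j. d * j \<in> partial_sums \<beta>}"
    then have "0 < d * j" "d * j < d * k" using partial_sums_bounds[OF c] k by auto
    then show "j \<in> {0<..<sum_list \<beta> div d}" using assms(2) k by simp
  qed
  show "pos_composition (quotient_part d \<beta>)" "sum_list (quotient_part d \<beta>) = sum_list \<beta> div d"
    "partial_sums (quotient_part d \<beta>) = {j. d * j \<in> partial_sums \<beta>}"
    unfolding quotient_part_def by (rule the_composition[OF pos sub])+
qed

lemma remainder_part_props:
  assumes "pos_composition \<beta>" "d > 0"
  shows "pos_composition (remainder_part d \<beta>)" "sum_list (remainder_part d \<beta>) = d"
    "partial_sums (remainder_part d \<beta>) = {j \<in> partial_sums \<beta>. j < d}"
proof -
  have sub: "{j \<in> partial_sums \<beta>. j < d} \<subseteq> {0<..<d}"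
    using partial_sums_bounds[OF pos_compositionD(2)[OF assms(1)]] by auto
  show "pos_composition (remainder_part d \<beta>)" "sum_list (remainder_part d \<beta>) = d"
    "partial_sums (remainder_part d \<beta>) = {j \<in> partial_sums \<beta>. j < d}"
    unfolding remainder_part_def by (rule the_composition[OF assms(2) sub])+
qed

text \<open>The second factor \<open>\<tau>\<close> is left open so that the same \<open>\<tau>\<close> can be used for two compositions that agree off the
multiples of \<open>d\<close>.\<close>

lemma comp_circ_of_cut:
  assumes \<beta>: "pos_composition \<beta>" "has_cut d \<beta>"
    and \<tau>: "pos_composition \<tau>" "sum_list \<tau> = d" "\<And>x. \<not> d dvd x \<Longrightarrow> x < d \<Longrightarrow> x \<in> partial_sums \<tau> \<longleftrightarrow> x \<in> partial_sums \<beta>"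
  shows "\<beta> = quotient_part d \<beta> \<circ>\<^sub>c \<tau>"
proof (rule pos_composition_eqI)
  have d: "d > 0" "d dvd sum_list \<beta>" "periodic_off (indicator_of \<beta>) (int d)" using \<beta>(2) by (simp_all add: has_cut_def)
  note q = quotient_part_props[OF \<beta>(1) d(1,2)]
  show "pos_composition \<beta>" by fact
  show "pos_composition (quotient_part d \<beta> \<circ>\<^sub>c \<tau>)" by (rule comp_circ_props(1)[OF q(1) \<tau>(1)])
  show "sum_list \<beta> = sum_list (quotient_part d \<beta> \<circ>\<^sub>c \<tau>)"
    using comp_circ_props(2)[OF q(1) \<tau>(1)] q(2) \<tau>(2) d(2) by simp
  fix x assume x: "0 < x" "x < sum_list \<beta>"
  then have x': "x < sum_list (quotient_part d \<beta>) * sum_list \<tau>" using q(2) \<tau>(2) d(2) by simp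
  show "x \<in> partial_sums \<beta> \<longleftrightarrow> x \<in> partial_sums (quotient_part d \<beta> \<circ>\<^sub>c \<tau>)"
  proof (cases "d dvd x")
    case True
    then show ?thesis
      unfolding partial_sums_comp_circ_iff[OF q(1) \<tau>(1) x'] \<tau>(2) q(3) by simp
  next
    case False
    have nd: "\<not> d dvd x mod d" using False by (simp add: dvd_mod_iff)
    have "\<not> int d dvd int (x mod d)" using nd by (simp only: int_dvd_int_iff not_False_eq_True)
    moreover have "int d dvd int (d * (x div d))" by simp
    ultimately have "indicator_of \<beta> (int (x mod d) + int (d * (x div d))) = indicator_of \<beta> (int (x mod d))"
      using d(3) unfolding periodic_off_def by blast
    moreover have "int (x mod d) + int (d * (x div d)) = int x"
      by (metis mod_mult_div_eq of_nat_add)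
    ultimately have "indicator_of \<beta> (int x) = indicator_of \<beta> (int (x mod d))" by simp
    moreover have "x mod d \<le> x" by simp
    ultimately have "x \<in> partial_sums \<beta> \<longleftrightarrow> x mod d \<in> partial_sums \<beta>"
      using x(2) by (simp add: indicator_of_nat of_bool_eq_iff)
    then show ?thesis
      unfolding partial_sums_comp_circ_iff[OF q(1) \<tau>(1) x'] \<tau>(2)
      using False \<tau>(3)[OF nd] d(1) by simp
  qed
qed

lemma indicator_quotient_part:
  assumes "pos_composition \<beta>" "d > 0" "d dvd sum_list \<beta>"
  shows "indicator_of (quotient_part d \<beta>) x = indicator_of \<beta> (int d * x)"
proof -
  note q = quotient_part_props[OF assms]
  have "int (sum_list \<beta>) = int d * int (sum_list \<beta> div d)"
    using assms(3) by (metis dvd_mult_div_cancel of_nat_mult)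
  then have "nat ((int d * x) mod int (sum_list \<beta>)) = d * nat (x mod int (sum_list \<beta> div d))"
    by (simp add: nat_mult_distrib)
  then show ?thesis unfolding indicator_of_def q(2,3) by simp
qed

text \<open>The hypothesis for \<open>rev \<gamma>\<close> is carried along because the cut may fit \<open>\<gamma>\<close> only after
reversal. Restricting to multiples of the cut, both hypotheses pass to the first factors.\<close>

theorem rev_choice_of_same_path_sums:
  assumes "pos_composition \<beta>" "pos_composition \<gamma>" "sum_list \<beta> = sum_list \<gamma>"
    "same_path_sums (int (sum_list \<beta>)) (indicator_of \<beta>) (indicator_of \<gamma>)"
    "same_path_sums (int (sum_list \<beta>)) (indicator_of \<beta>) (indicator_of (rev \<gamma>))"
  shows "\<exists>\<beta>s \<gamma>s. \<beta>s \<noteq> [] \<and> (\<forall>\<alpha>\<in>set \<beta>s. pos_composition \<alpha>) \<and>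
    \<beta> = circ_list \<beta>s \<and> \<gamma> = circ_list \<gamma>s \<and> rev_choice \<beta>s \<gamma>s"
  using assms
proof (induction "sum_list \<beta>" arbitrary: \<beta> \<gamma> rule: less_induct)
  case less
  note \<beta> = less.prems(1) and \<gamma> = less.prems(2) and sum = less.prems(3)
  let ?n = "int (sum_list \<beta>)"
  have main: "\<exists>\<beta>s \<gamma>s. \<beta>s \<noteq> [] \<and> (\<forall>\<alpha>\<in>set \<beta>s. pos_composition \<alpha>) \<and>
      \<beta> = circ_list \<beta>s \<and> \<gamma> = circ_list \<gamma>s \<and> rev_choice \<beta>s \<gamma>s"
    if \<gamma>: "pos_composition \<gamma>" and sum: "sum_list \<beta> = sum_list \<gamma>"
      and same: "same_path_sums ?n (indicator_of \<beta>) (indicator_of \<gamma>)"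
        "same_path_sums ?n (indicator_of \<beta>) (indicator_of (rev \<gamma>))"
      and d: "1 < d" "d < ?n" "d dvd ?n" "periodic_off (indicator_of \<beta>) d"
        "\<forall>x. \<not> d dvd x \<longrightarrow> indicator_of \<gamma> x = indicator_of \<beta> x" for \<gamma> d
  proof -
    define e where "e = nat d"
    have e: "e > 1" "e < sum_list \<beta>" "e dvd sum_list \<beta>" "d = int e"
      using d(1-3) by (simp_all add: e_def nat_less_iff) (metis int_dvd_int_iff int_nat_eq less_imp_le order_less_trans zero_less_one)
    have per\<gamma>: "periodic_off (indicator_of \<gamma>) (int e)"
      unfolding periodic_off_def
    proof (intro allI impI)
      fix x g assume x: "\<not> int e dvd x" "int e dvd g"
      then have "\<not> int e dvd x + g" by (simp add: dvd_add_left_iff)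
      then show "indicator_of \<gamma> (x + g) = indicator_of \<gamma> x"
        using d(4,5) x unfolding e(4) periodic_off_def by simp
    qed
    have cut: "has_cut e \<beta>" "has_cut e \<gamma>"
      using e d(4) per\<gamma> sum by (simp_all add: has_cut_def)
    define \<tau> where "\<tau> = remainder_part e \<beta>"
    have e0: "e > 0" using e(1) by simp
    note \<tau> = remainder_part_props[OF \<beta> e0, folded \<tau>_def]
    have B: "\<beta> = quotient_part e \<beta> \<circ>\<^sub>c \<tau>"
      by (rule comp_circ_of_cut[OF \<beta> cut(1) \<tau>(1,2)]) (simp add: \<tau>(3))
    have C: "\<gamma> = quotient_part e \<gamma> \<circ>\<^sub>c \<tau>"
    proof (rule comp_circ_of_cut[OF \<gamma> cut(2) \<tau>(1,2)])
      fix x assume x: "\<not> e dvd x" "x < e"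
      have "\<not> int e dvd int x" using x(1) by simp
      then have "indicator_of \<gamma> (int x) = indicator_of \<beta> (int x)" using d(5) e(4) by blast
      then show "x \<in> partial_sums \<tau> \<longleftrightarrow> x \<in> partial_sums \<gamma>"
        using x e(2) sum by (simp add: \<tau>(3) indicator_of_nat of_bool_eq_iff)
    qed
    have e\<gamma>: "e dvd sum_list \<gamma>" using e(3) sum by simp
    note qb = quotient_part_props[OF \<beta> e0 e(3)] and qc = quotient_part_props[OF \<gamma> e0 e\<gamma>]
    have n: "?n = int e * int (sum_list (quotient_part e \<beta>))"
      unfolding qb(2) using e(3) by (metis dvd_mult_div_cancel of_nat_mult)
    have ib: "indicator_of (quotient_part e \<beta>) = (\<lambda>x. indicator_of \<beta> (int e * x))"
      "indicator_of (quotient_part e \<gamma>) = (\<lambda>x. indicator_of \<gamma> (int e * x))"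
      using indicator_quotient_part[OF \<beta> e0 e(3)] indicator_quotient_part[OF \<gamma> e0 e\<gamma>] by auto
    have ir: "indicator_of (rev (quotient_part e \<gamma>)) = (\<lambda>x. indicator_of (rev \<gamma>) (int e * x))"
      using indicator_of_rev[OF qc(1)] indicator_of_rev[OF \<gamma>] ib(2) by auto
    have lt: "sum_list (quotient_part e \<beta>) < sum_list \<beta>"
      unfolding qb(2) using e pos_compositionD(3)[OF \<beta>] by simp
    have "\<exists>\<beta>s \<gamma>s. \<beta>s \<noteq> [] \<and> (\<forall>\<alpha>\<in>set \<beta>s. pos_composition \<alpha>) \<and>
      quotient_part e \<beta> = circ_list \<beta>s \<and> quotient_part e \<gamma> = circ_list \<gamma>s \<and> rev_choice \<beta>s \<gamma>s"
    proof (rule less.hyps[OF lt qb(1) qc(1)])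
      show "sum_list (quotient_part e \<beta>) = sum_list (quotient_part e \<gamma>)" using qb(2) qc(2) sum by simp
      show "same_path_sums (int (sum_list (quotient_part e \<beta>)))
          (indicator_of (quotient_part e \<beta>)) (indicator_of (quotient_part e \<gamma>))"
        unfolding ib by (rule same_path_sums_scale[OF same(1)[unfolded n]]) (use e0 in simp)
      show "same_path_sums (int (sum_list (quotient_part e \<beta>)))
          (indicator_of (quotient_part e \<beta>)) (indicator_of (rev (quotient_part e \<gamma>)))"
        unfolding ib(1) ir by (rule same_path_sums_scale[OF same(2)[unfolded n]]) (use e0 in simp)
    qed
    then obtain \<beta>s \<gamma>s where s: "\<beta>s \<noteq> []" "\<forall>\<alpha>\<in>set \<beta>s. pos_composition \<alpha>"
      "quotient_part e \<beta> = circ_list \<beta>s" "quotient_part e \<gamma> = circ_list \<gamma>s" "rev_choice \<beta>s \<gamma>s"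
      by blast
    have pos\<gamma>: "\<forall>\<alpha>\<in>set \<gamma>s. pos_composition \<alpha>" by (rule rev_choice_pos[OF s(5,2)])
    have "\<beta> = circ_list (\<beta>s @ [\<tau>])" "\<gamma> = circ_list (\<gamma>s @ [\<tau>])"
      using B C s(2-4) pos\<gamma> \<tau>(1) by (simp_all add: circ_list_append)
    moreover have "rev_choice (\<beta>s @ [\<tau>]) (\<gamma>s @ [\<tau>])" using s(5) by (simp add: list_all2_appendI)
    moreover have "\<forall>\<alpha>\<in>set (\<beta>s @ [\<tau>]). pos_composition \<alpha>" using s(2) \<tau>(1) by simp
    ultimately show ?thesis by blast
  qed
  have r: "indicator_of (rev \<gamma>) = (\<lambda>x. indicator_of \<gamma> (- x))" using indicator_of_rev[OF \<gamma>] by auto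
  have z: "zero_one_periodic ?n (indicator_of \<beta>)" "zero_one_periodic ?n (indicator_of \<gamma>)"
    using zero_one_periodic_indicator[OF \<beta>] zero_one_periodic_indicator[OF \<gamma>] sum by simp_all
  consider (same) "indicator_of \<gamma> = indicator_of \<beta>" | (rev) "indicator_of (rev \<gamma>) = indicator_of \<beta>"
    | (cut) d where "1 < d" "d < ?n" "d dvd ?n" "periodic_off (indicator_of \<beta>) d"
        "\<forall>x. \<not> d dvd x \<longrightarrow> indicator_of \<gamma> x = indicator_of \<beta> x"
    | (cut_rev) d where "1 < d" "d < ?n" "d dvd ?n" "periodic_off (indicator_of \<beta>) d"
        "\<forall>x. \<not> d dvd x \<longrightarrow> indicator_of (rev \<gamma>) x = indicator_of \<beta> x"
    using same_path_sums_cases[OF z less.prems(4) less.prems(5)[unfolded r]] unfolding r by blast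
  then show ?case
  proof cases
    case same
    then have "\<gamma> = \<beta>" using indicator_of_inject[OF \<gamma> \<beta>] sum by simp
    then show ?thesis using \<beta> by (intro exI[of _ "[\<beta>]"]) simp
  next
    case rev
    then have "rev \<gamma> = \<beta>" using indicator_of_inject[of "rev \<gamma>" \<beta>] \<gamma> \<beta> sum by simp
    then have "\<gamma> = rev \<beta>" by auto
    then show ?thesis using \<beta> by (intro exI[of _ "[\<beta>]"] exI[of _ "[rev \<beta>]"]) simp
  next
    case (cut d)
    then show ?thesis using main[OF \<gamma> sum less.prems(4,5)] by blast
  next
    case (cut_rev d)
    have "\<exists>\<beta>s \<gamma>s. \<beta>s \<noteq> [] \<and> (\<forall>\<alpha>\<in>set \<beta>s. pos_composition \<alpha>) \<and>
      \<beta> = circ_list \<beta>s \<and> rev \<gamma> = circ_list \<gamma>s \<and> rev_choice \<beta>s \<gamma>s"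
      by (rule main[of "rev \<gamma>" d]) (use \<gamma> sum less.prems(4,5) cut_rev in simp_all)
    then obtain \<beta>s \<gamma>s where s: "\<beta>s \<noteq> []" "\<forall>\<alpha>\<in>set \<beta>s. pos_composition \<alpha>"
      "\<beta> = circ_list \<beta>s" "rev \<gamma> = circ_list \<gamma>s" "rev_choice \<beta>s \<gamma>s" by blast
    have "\<gamma> = circ_list (map rev \<gamma>s)"
      using rev_circ_list[OF rev_choice_pos[OF s(5,2)]] s(4) by (metis rev_rev_ident)
    then show ?thesis using s rev_choice_map_rev[OF s(5)] by blast
  qed
qed

section \<open>Cuts of a composition\<close>

(* Sizes of compositions are treated as atomic positive numbers in divisibility arguments. *)

declare sum_list_eq_0_iff [simp del]

abbreviation sum_int :: "nat list \<Rightarrow> int" where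
  "sum_int \<alpha> \<equiv> int (sum_list \<alpha>)"

lemma sum_int_pos: "pos_composition \<alpha> \<Longrightarrow> sum_int \<alpha> > 0"
  using pos_compositionD(3) by simp

lemma sum_int_comp_circ:
  "pos_composition \<sigma> \<Longrightarrow> pos_composition \<tau> \<Longrightarrow> sum_int (\<sigma> \<circ>\<^sub>c \<tau>) = sum_int \<sigma> * sum_int \<tau>"
  by (simp add: comp_circ_props(2))

lemma sum_int_eq_1: "pos_composition \<alpha> \<Longrightarrow> sum_int \<alpha> = 1 \<longleftrightarrow> \<alpha> = [1]"
proof
  assume \<alpha>: "pos_composition \<alpha>" "sum_int \<alpha> = 1"
  have "{0<..<1::nat} = {}" by auto
  then have "partial_sums \<alpha> = {}"
    using partial_sums_bounds[OF pos_compositionD(2)[OF \<alpha>(1)]] \<alpha>(2) by simp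
  then show "\<alpha> = [1]"
    using \<alpha> by (intro pos_composition_eqI) simp_all
qed simp

lemma indicator_comp_circ_on:
  assumes "pos_composition \<sigma>" "pos_composition \<tau>"
  shows "indicator_of (\<sigma> \<circ>\<^sub>c \<tau>) (sum_int \<tau> * x) = indicator_of \<sigma> x"
proof -
  define y where "y = nat (x mod sum_int \<sigma>)"
  have pos: "sum_list \<sigma> > 0" "sum_list \<tau> > 0" using assms pos_compositionD by simp_all
  have y: "x mod sum_int \<sigma> = int y" "y < sum_list \<sigma>" using pos(1) by (simp_all add: y_def nat_less_iff)
  have "(sum_int \<tau> * x) mod sum_int (\<sigma> \<circ>\<^sub>c \<tau>) = sum_int \<tau> * int y"
    unfolding sum_int_comp_circ[OF assms] y(1)[symmetric]
    using mult_mod_right[of "sum_int \<tau>" x "sum_int \<sigma>"] by (simp only: mult.commute)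
  then have e: "nat ((sum_int \<tau> * x) mod sum_int (\<sigma> \<circ>\<^sub>c \<tau>)) = sum_list \<tau> * y"
    by (simp add: nat_mult_distrib)
  have "sum_list \<tau> * y < sum_list \<sigma> * sum_list \<tau>" using y(2) pos(2) by simp
  from partial_sums_comp_circ_iff[OF assms this] show ?thesis
    unfolding indicator_of_def e y(1) using pos(2) by simp
qed

lemma indicator_comp_circ_off:
  assumes "pos_composition \<sigma>" "pos_composition \<tau>" "\<not> sum_int \<tau> dvd x"
  shows "indicator_of (\<sigma> \<circ>\<^sub>c \<tau>) x = indicator_of \<tau> x"
proof -
  have pos: "sum_list \<sigma> > 0" "sum_list \<tau> > 0" using assms(1,2) pos_compositionD by simp_all
  define y where "y = nat (x mod sum_int (\<sigma> \<circ>\<^sub>c \<tau>))"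
  have n: "sum_int (\<sigma> \<circ>\<^sub>c \<tau>) > 0" by (rule sum_int_pos[OF comp_circ_props(1)[OF assms(1,2)]])
  have d: "sum_int \<tau> dvd sum_int (\<sigma> \<circ>\<^sub>c \<tau>)" unfolding sum_int_comp_circ[OF assms(1,2)] by simp
  have y: "x mod sum_int (\<sigma> \<circ>\<^sub>c \<tau>) = int y" using n by (simp add: y_def)
  then have "int y < sum_int (\<sigma> \<circ>\<^sub>c \<tau>)" using n by (metis pos_mod_bound)
  then have lt: "y < sum_list \<sigma> * sum_list \<tau>"
    by (simp only: of_nat_less_iff comp_circ_props(2)[OF assms(1,2)])
  have "x mod sum_int \<tau> = int y mod sum_int \<tau>"
    unfolding y[symmetric] using d by (simp add: mod_mod_cancel)
  then have m: "x mod sum_int \<tau> = int (y mod sum_list \<tau>)" by (simp add: zmod_int)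
  then have "\<not> sum_list \<tau> dvd y" using assms(3) by (simp add: dvd_eq_mod_eq_0)
  then show ?thesis
    using partial_sums_comp_circ_iff[OF assms(1,2) lt] unfolding indicator_of_def y m by simp
qed

lemma indicator_shift:
  assumes "pos_composition \<alpha>" "sum_int \<alpha> dvd g" shows "indicator_of \<alpha> (x + g) = indicator_of \<alpha> x"
proof -
  obtain j where "g = sum_int \<alpha> * j" using assms(2) by blast
  then show ?thesis
    using zero_one_periodic_indicator[OF assms(1)] unfolding zero_one_periodic_def by (simp add: mult.commute)
qed

lemma indicator_multiple:
  assumes "pos_composition \<alpha>" "sum_int \<alpha> dvd x" shows "indicator_of \<alpha> x = 0"
  using indicator_shift[OF assms, of 0] zero_one_periodic_indicator[OF assms(1)]
  unfolding zero_one_periodic_def by simp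

lemma indicator_range: "indicator_of \<alpha> x \<in> {0, 1}"
  by (simp add: indicator_of_def)

lemma periodic_off_comp_circ:
  assumes "pos_composition \<sigma>" "pos_composition \<tau>"
  shows "periodic_off (indicator_of (\<sigma> \<circ>\<^sub>c \<tau>)) (sum_int \<tau>)"
  unfolding periodic_off_def
proof (intro allI impI)
  fix x g assume x: "\<not> sum_int \<tau> dvd x" and g: "sum_int \<tau> dvd g"
  then have "\<not> sum_int \<tau> dvd x + g" by (simp add: dvd_add_left_iff)
  then show "indicator_of (\<sigma> \<circ>\<^sub>c \<tau>) (x + g) = indicator_of (\<sigma> \<circ>\<^sub>c \<tau>) x"
    using indicator_comp_circ_off[OF assms] indicator_shift[OF assms(2) g] x by simp
qed

lemma comp_circ_of_has_cut:
  assumes "pos_composition \<beta>" "has_cut d \<beta>"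
  shows "\<beta> = quotient_part d \<beta> \<circ>\<^sub>c remainder_part d \<beta>"
proof -
  have d: "d > 0" using assms(2) by (simp add: has_cut_def)
  note r = remainder_part_props[OF assms(1) d]
  show ?thesis by (rule comp_circ_of_cut[OF assms r(1,2)]) (simp add: r(3))
qed

lemma periodic_off_gcd:
  assumes "periodic_off f m" "periodic_off f m'" shows "periodic_off f (gcd m m')"
  unfolding periodic_off_def
proof (intro allI impI)
  fix x h assume x: "\<not> gcd m m' dvd x" and h: "gcd m m' dvd h"
  have "{m, m'} \<subseteq> {h. gcd m m' dvd h \<and> (\<forall>x. \<not> gcd m m' dvd x \<longrightarrow> f (x + h) = f x)}"
  proof -
    have "f (x + m) = f x \<and> f (x + m') = f x" if "\<not> gcd m m' dvd x" for x
    proof -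
      have "\<not> m dvd x" "\<not> m' dvd x" using that by (meson dvd_trans gcd_dvd1 gcd_dvd2)+
      then show ?thesis using assms unfolding periodic_off_def by simp
    qed
    then show ?thesis by simp
  qed
  from int_subgroup_Gcd[OF period_subgroup this, of h] h x show "f (x + h) = f x" by simp
qed

lemma periodic_off_lcm:
  assumes "periodic_off f m" "periodic_off f m'" shows "periodic_off f (lcm m m')"
  unfolding periodic_off_def
proof (intro allI impI)
  fix x h assume x: "\<not> lcm m m' dvd x" and h: "lcm m m' dvd h"
  have "m dvd h" "m' dvd h" using h by (simp_all add: lcm_least_iff)
  moreover have "\<not> m dvd x \<or> \<not> m' dvd x" using x by (simp add: lcm_least_iff)
  ultimately show "f (x + h) = f x" using assms unfolding periodic_off_def by blast
qed

text \<open>Write \<open>x = a m + b m'\<close>. If \<open>x\<close> is not a multiple of \<open>m\<close>, move it by multiples of \<open>m\<close> to \<open>m + b m'\<close>, and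
then, since this is not a multiple of \<open>m'\<close>, by multiples of \<open>m'\<close> to \<open>m + m'\<close>.\<close>

lemma constant_between_cuts:
  fixes m m' :: int
  assumes m: "periodic_off f m" "periodic_off f m'" and inc: "\<not> m dvd m'" "\<not> m' dvd m"
    and x: "gcd m m' dvd x" "\<not> lcm m m' dvd x"
  shows "f x = f (m + m')"
proof -
  obtain a0 b0 where ab0: "a0 * m + b0 * m' = gcd m m'" using bezout_int by blast
  obtain k where "x = gcd m m' * k" using x(1) by blast
  then have "x = (a0 * k) * m + (b0 * k) * m'" unfolding ab0[symmetric] by (simp add: algebra_simps)
  then obtain a b where ab: "x = a * m + b * m'" by blast
  have sh: "f (y + k * m) = f y" if "\<not> m dvd y" for y k
    using m(1) that unfolding periodic_off_def by simp
  have sh': "f (y + k * m') = f y" if "\<not> m' dvd y" for y k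
    using m(2) that unfolding periodic_off_def by simp
  have "\<not> m dvd x \<or> \<not> m' dvd x" using x(2) by (simp add: lcm_least_iff)
  then show ?thesis
  proof
    assume nx: "\<not> m dvd x"
    have "f x = f (x + (1 - a) * m)" using sh[OF nx] by simp
    also have "x + (1 - a) * m = m + b * m'" unfolding ab by (simp add: algebra_simps)
    also have "f (m + b * m') = f m" by (rule sh'[OF inc(2)])
    also have "f m = f (m + 1 * m')" by (rule sh'[OF inc(2), symmetric])
    finally show ?thesis by simp
  next
    assume nx: "\<not> m' dvd x"
    have "f x = f (x + (1 - b) * m')" using sh'[OF nx] by simp
    also have "x + (1 - b) * m' = m' + a * m" unfolding ab by (simp add: algebra_simps)
    also have "f (m' + a * m) = f m'" by (rule sh[OF inc(1)])
    also have "f m' = f (m' + 1 * m)" by (rule sh[OF inc(1), symmetric])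
    finally show ?thesis by (simp add: add.commute)
  qed
qed

text \<open>Constant \<open>0\<close> means a single part and constant \<open>1\<close> means that all parts are \<open>1\<close>; with these two types
the three cases of a trivial factorization can be treated alike. The composition \<open>[1]\<close> has every type.\<close>

definition has_constant_type :: "nat list \<Rightarrow> int \<Rightarrow> bool" where
  "has_constant_type \<alpha> c \<longleftrightarrow> (\<forall>x. \<not> sum_int \<alpha> dvd x \<longrightarrow> indicator_of \<alpha> x = c)"

lemma has_constant_typeI_nat:
  assumes "pos_composition \<alpha>"
    and "\<And>x. 0 < x \<Longrightarrow> x < sum_list \<alpha> \<Longrightarrow> of_bool (x \<in> partial_sums \<alpha>) = c"
  shows "has_constant_type \<alpha> c"
  unfolding has_constant_type_def
proof (intro allI impI)
  fix x assume x: "\<not> sum_int \<alpha> dvd x"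
  have r: "0 < x mod sum_int \<alpha>" "x mod sum_int \<alpha> < sum_int \<alpha>"
    by (rule mod_range[OF sum_int_pos[OF assms(1)] x])+
  then show "indicator_of \<alpha> x = c"
    unfolding indicator_of_def using assms(2)[of "nat (x mod sum_int \<alpha>)"] by (simp add: nat_less_iff)
qed

lemma has_constant_typeD_nat:
  assumes "has_constant_type \<alpha> c" "0 < x" "x < sum_list \<alpha>"
  shows "of_bool (x \<in> partial_sums \<alpha>) = c"
proof -
  have "\<not> sum_list \<alpha> dvd x" using assms(2,3) by (simp add: nat_dvd_not_less)
  then show ?thesis
    using assms(1) indicator_of_nat[OF assms(3)] unfolding has_constant_type_def
    by (metis int_dvd_int_iff)
qed

lemma constant_type_0_iff:
  assumes "pos_composition \<alpha>" shows "has_constant_type \<alpha> 0 \<longleftrightarrow> length \<alpha> = 1"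
proof
  assume c: "has_constant_type \<alpha> 0"
  have "\<alpha> = [sum_list \<alpha>]"
  proof (rule pos_composition_eqI)
    show "pos_composition [sum_list \<alpha>]"
      using pos_compositionD(3)[OF assms] by (simp add: pos_composition_def)
    show "x \<in> partial_sums \<alpha> \<longleftrightarrow> x \<in> partial_sums [sum_list \<alpha>]" if "0 < x" "x < sum_list \<alpha>" for x
      using has_constant_typeD_nat[OF c that] by simp
  qed (use assms in simp_all)
  then obtain k where "\<alpha> = [k]" by blast
  then show "length \<alpha> = 1" by simp
next
  assume "length \<alpha> = 1"
  then have "partial_sums \<alpha> = {}" by (simp add: partial_sums_empty_iff)
  then show "has_constant_type \<alpha> 0" by (intro has_constant_typeI_nat assms) simp
qed

lemma partial_sums_ones: "partial_sums (replicate n 1) = {0<..<n}"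
proof -
  have "sum_list (take i (replicate n 1)) = i" if "i \<in> {0<..<n}" for i
    using that by (simp add: take_replicate sum_list_replicate)
  then show ?thesis unfolding partial_sums_def by simp
qed

lemma constant_type_1_iff:
  assumes "pos_composition \<alpha>" shows "has_constant_type \<alpha> 1 \<longleftrightarrow> (\<forall>x\<in>set \<alpha>. x = 1)"
proof
  assume c: "has_constant_type \<alpha> 1"
  have "\<alpha> = replicate (sum_list \<alpha>) 1"
  proof (rule pos_composition_eqI)
    show "pos_composition (replicate (sum_list \<alpha>) 1)"
      using pos_compositionD(3)[OF assms] by (auto simp: pos_composition_def composition_def)
    show "x \<in> partial_sums \<alpha> \<longleftrightarrow> x \<in> partial_sums (replicate (sum_list \<alpha>) 1)"
      if "0 < x" "x < sum_list \<alpha>" for x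
      unfolding partial_sums_ones using has_constant_typeD_nat[OF c that] that by (simp split: if_splits)
  qed (use assms in \<open>simp_all add: sum_list_replicate\<close>)
  then obtain k where "\<alpha> = replicate k 1" by blast
  then show "\<forall>x\<in>set \<alpha>. x = 1" by simp
next
  assume "\<forall>x\<in>set \<alpha>. x = 1"
  then have "replicate (length \<alpha>) 1 = \<alpha>" by (rule replicate_length_same)
  then obtain k where r: "\<alpha> = replicate k 1" by (blast intro: sym)
  have "sum_list \<alpha> = k" "partial_sums \<alpha> = {0<..<k}"
    unfolding r using partial_sums_ones[of k] by (simp_all add: sum_list_replicate)
  then show "has_constant_type \<alpha> 1" by (intro has_constant_typeI_nat assms) simp
qed

lemma trivial_pair_iff:
  assumes "pos_composition \<alpha>" "pos_composition \<beta>"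
  shows "trivial_pair \<alpha> \<beta> \<longleftrightarrow> \<alpha> = [1] \<or> \<beta> = [1] \<or>
    (\<exists>c\<in>{0, 1}. has_constant_type \<alpha> c \<and> has_constant_type \<beta> c)"
  unfolding trivial_pair_def
  using constant_type_0_iff[OF assms(1)] constant_type_0_iff[OF assms(2)]
    constant_type_1_iff[OF assms(1)] constant_type_1_iff[OF assms(2)] by auto

lemma constant_type_comp_circ:
  assumes "pos_composition \<sigma>" "pos_composition \<tau>" "has_constant_type \<sigma> c" "has_constant_type \<tau> c"
  shows "has_constant_type (\<sigma> \<circ>\<^sub>c \<tau>) c"
  unfolding has_constant_type_def
proof (intro allI impI)
  fix x assume x: "\<not> sum_int (\<sigma> \<circ>\<^sub>c \<tau>) dvd x"
  show "indicator_of (\<sigma> \<circ>\<^sub>c \<tau>) x = c"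
  proof (cases "sum_int \<tau> dvd x")
    case True
    then obtain y where y: "x = sum_int \<tau> * y" by blast
    then have "\<not> sum_int \<sigma> dvd y" using x sum_int_comp_circ[OF assms(1,2)] by (auto simp: mult.commute)
    then show ?thesis
      using assms(3) indicator_comp_circ_on[OF assms(1,2)] unfolding y has_constant_type_def by simp
  next
    case False
    then show ?thesis
      using assms(4) indicator_comp_circ_off[OF assms(1,2)] unfolding has_constant_type_def by simp
  qed
qed

lemma constant_type_comp_circD:
  assumes "pos_composition \<sigma>" "pos_composition \<tau>" "has_constant_type (\<sigma> \<circ>\<^sub>c \<tau>) c"
  shows "has_constant_type \<sigma> c" "has_constant_type \<tau> c"
proof -
  note w = sum_int_comp_circ[OF assms(1,2)]
  have t0: "sum_int \<tau> \<noteq> 0" using sum_int_pos[OF assms(2)] by simp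
  show "has_constant_type \<sigma> c"
    unfolding has_constant_type_def
  proof (intro allI impI)
    fix x assume "\<not> sum_int \<sigma> dvd x"
    then have "\<not> sum_int (\<sigma> \<circ>\<^sub>c \<tau>) dvd sum_int \<tau> * x"
      unfolding w using t0 by (simp add: mult.commute[of "sum_int \<sigma>"])
    then have "indicator_of (\<sigma> \<circ>\<^sub>c \<tau>) (sum_int \<tau> * x) = c"
      using assms(3) unfolding has_constant_type_def by blast
    then show "indicator_of \<sigma> x = c" unfolding indicator_comp_circ_on[OF assms(1,2)] .
  qed
  show "has_constant_type \<tau> c"
    unfolding has_constant_type_def
  proof (intro allI impI)
    fix x assume x: "\<not> sum_int \<tau> dvd x"
    then have "\<not> sum_int (\<sigma> \<circ>\<^sub>c \<tau>) dvd x" unfolding w using dvd_mult_right by blast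
    then show "indicator_of \<tau> x = c"
      using assms(3) indicator_comp_circ_off[OF assms(1,2) x] unfolding has_constant_type_def by simp
  qed
qed

lemma constant_type_only_trivial:
  assumes "has_constant_type \<alpha> c" "c \<in> {0, 1}" shows "only_trivial_factorizations \<alpha>"
  unfolding only_trivial_factorizations_def
proof (intro allI impI)
  fix \<beta> \<gamma> assume *: "pos_composition \<beta> \<and> pos_composition \<gamma> \<and> \<alpha> = \<beta> \<circ>\<^sub>c \<gamma>"
  then show "trivial_pair \<beta> \<gamma>"
    using constant_type_comp_circD[of \<beta> \<gamma> c] assms trivial_pair_iff[of \<beta> \<gamma>] by blast
qed

lemma constant_type_unique:
  assumes "pos_composition \<alpha>" "\<alpha> \<noteq> [1]" "has_constant_type \<alpha> c" "has_constant_type \<alpha> c'" shows "c = c'"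
proof -
  have "sum_int \<alpha> \<noteq> 1" "sum_int \<alpha> > 0" using assms(1,2) sum_int_eq_1 sum_int_pos by simp_all
  then have "\<not> sum_int \<alpha> dvd 1" by simp
  then show ?thesis using assms(3,4) unfolding has_constant_type_def by metis
qed

text \<open>This is why merging factors of a trivial pair does not interfere with reversals.\<close>

lemma constant_type_rev:
  assumes "pos_composition \<alpha>" "has_constant_type \<alpha> c" shows "rev \<alpha> = \<alpha>"
proof (rule indicator_of_inject)
  show "indicator_of (rev \<alpha>) = indicator_of \<alpha>"
  proof
    fix x
    show "indicator_of (rev \<alpha>) x = indicator_of \<alpha> x"
    proof (cases "sum_int \<alpha> dvd x")
      case True
      then show ?thesis
        using indicator_multiple[OF assms(1)] indicator_of_rev[OF assms(1)] by simp
    next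
      case False
      then have "\<not> sum_int \<alpha> dvd - x" by simp
      then show ?thesis
        using False assms(2) indicator_of_rev[OF assms(1)] unfolding has_constant_type_def by simp
    qed
  qed
qed (use assms in simp_all)

text \<open>A proper cut yields a factorization without the factor \<open>[1]\<close>; if it is trivial, both factors have the
same constant type.\<close>

lemma only_trivial_cut_constant:
  assumes \<alpha>: "pos_composition \<alpha>" "only_trivial_factorizations \<alpha>"
    and e: "0 < e" "e dvd sum_int \<alpha>" "e \<noteq> 1" "e \<noteq> sum_int \<alpha>"
    and per: "periodic_off (indicator_of \<alpha>) e"
  shows "\<exists>c. has_constant_type \<alpha> c"
proof -
  define d where "d = nat e"
  have d: "d > 0" "int d = e" using e(1) by (simp_all add: d_def)
  then have dd: "d dvd sum_list \<alpha>" using e(2) by (simp only: d(2)[symmetric] int_dvd_int_iff)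
  have cut: "has_cut d \<alpha>" using d per dd by (simp add: has_cut_def)
  note q = quotient_part_props[OF \<alpha>(1) d(1) dd] and r = remainder_part_props[OF \<alpha>(1) d(1)]
  have eq: "\<alpha> = quotient_part d \<alpha> \<circ>\<^sub>c remainder_part d \<alpha>" by (rule comp_circ_of_has_cut[OF \<alpha>(1) cut])
  have "trivial_pair (quotient_part d \<alpha>) (remainder_part d \<alpha>)"
    using \<alpha>(2) eq q(1) r(1) unfolding only_trivial_factorizations_def by blast
  moreover have "remainder_part d \<alpha> \<noteq> [1]"
  proof
    assume "remainder_part d \<alpha> = [1]"
    then have "d = 1" using r(2) by simp
    then show False using d(2) e(3) by simp
  qed
  moreover have "quotient_part d \<alpha> \<noteq> [1]"
  proof
    assume "quotient_part d \<alpha> = [1]"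
    then have "sum_list \<alpha> = d" using q(2) dd by (metis dvd_div_mult_self mult_1 sum_list_simps add_0_right One_nat_def sum_list.Cons sum_list.Nil)
    then show False using d(2) e(4) by simp
  qed
  ultimately obtain c where "has_constant_type (quotient_part d \<alpha>) c" "has_constant_type (remainder_part d \<alpha>) c"
    using trivial_pair_iff[OF q(1) r(1)] by blast
  from constant_type_comp_circ[OF q(1) r(1) this] show ?thesis unfolding eq[symmetric] by blast
qed

section \<open>Uniqueness of the irreducible factorization\<close>

definition irreducible_list :: "nat list list \<Rightarrow> bool" where
  "irreducible_list \<alpha>s \<longleftrightarrow> (\<forall>\<alpha>\<in>set \<alpha>s. pos_composition \<alpha> \<and> only_trivial_factorizations \<alpha>) \<and>
     successively (\<lambda>\<alpha> \<beta>. \<not> trivial_pair \<alpha> \<beta>) \<alpha>s"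

lemma is_irreducible_factorization_iff:
  "is_irreducible_factorization \<alpha>s \<alpha> \<longleftrightarrow> \<alpha>s \<noteq> [] \<and> irreducible_list \<alpha>s \<and> \<alpha> = circ_list \<alpha>s"
  unfolding is_irreducible_factorization_def irreducible_list_def successively_conv_nth by auto

lemma irreducible_list_Cons:
  "irreducible_list (\<alpha> # \<alpha>s) \<longleftrightarrow> pos_composition \<alpha> \<and> only_trivial_factorizations \<alpha> \<and>
    irreducible_list \<alpha>s \<and> (\<alpha>s = [] \<or> \<not> trivial_pair \<alpha> (hd \<alpha>s))"
  unfolding irreducible_list_def successively_Cons by auto

lemma irreducible_list_no_unit:
  "irreducible_list (\<alpha> # \<alpha>' # \<alpha>s) \<Longrightarrow> \<alpha> \<noteq> [1] \<and> \<alpha>' \<noteq> [1]"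
  by (auto simp: irreducible_list_Cons trivial_pair_def)

lemma irreducible_list_pos: "irreducible_list \<alpha>s \<Longrightarrow> pos_composition (circ_list \<alpha>s)"
  by (rule circ_list_pos) (simp add: irreducible_list_def)

lemma constant_type_of_composite:
  assumes "pos_composition \<sigma>" "pos_composition \<tau>"
    and "\<And>x. sum_int \<tau> dvd x \<Longrightarrow> \<not> sum_int (\<sigma> \<circ>\<^sub>c \<tau>) dvd x \<Longrightarrow> indicator_of (\<sigma> \<circ>\<^sub>c \<tau>) x = c"
  shows "has_constant_type \<sigma> c"
  unfolding has_constant_type_def
proof (intro allI impI)
  fix x assume x: "\<not> sum_int \<sigma> dvd x"
  have "sum_int \<tau> \<noteq> 0" using sum_int_pos[OF assms(2)] by simp
  then have "\<not> sum_int (\<sigma> \<circ>\<^sub>c \<tau>) dvd sum_int \<tau> * x"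
    unfolding sum_int_comp_circ[OF assms(1,2)] using x by (simp add: mult.commute[of "sum_int \<sigma>"])
  then have "indicator_of (\<sigma> \<circ>\<^sub>c \<tau>) (sum_int \<tau> * x) = c" by (intro assms(3)) simp_all
  then show "indicator_of \<sigma> x = c" unfolding indicator_comp_circ_on[OF assms(1,2)] .
qed

lemma composite_cut_constant:
  assumes \<sigma>: "pos_composition \<sigma>" "only_trivial_factorizations \<sigma>" and \<tau>: "pos_composition \<tau>"
    and l: "sum_int \<tau> dvd l" "l dvd sum_int (\<sigma> \<circ>\<^sub>c \<tau>)" "l > 0" "l \<noteq> sum_int \<tau>" "l \<noteq> sum_int (\<sigma> \<circ>\<^sub>c \<tau>)"
    and per: "\<And>x g. \<not> l dvd x \<Longrightarrow> l dvd g \<Longrightarrow> indicator_of (\<sigma> \<circ>\<^sub>c \<tau>) (x + g) = indicator_of (\<sigma> \<circ>\<^sub>c \<tau>) x"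
  shows "\<exists>c. has_constant_type \<sigma> c"
proof -
  have t: "sum_int \<tau> > 0" by (rule sum_int_pos[OF \<tau>])
  obtain e where e: "l = sum_int \<tau> * e" using l(1) by blast
  have e0: "e > 0" using e l(3) t by (simp add: zero_less_mult_iff)
  note w = sum_int_comp_circ[OF \<sigma>(1) \<tau>]
  show ?thesis
  proof (rule only_trivial_cut_constant[OF \<sigma> e0])
    show "e dvd sum_int \<sigma>" using l(2) t unfolding w e by (simp add: mult.commute[of "sum_int \<sigma>"])
    show "e \<noteq> 1" using l(4) e by auto
    show "e \<noteq> sum_int \<sigma>" using l(5) e unfolding w by auto
    show "periodic_off (indicator_of \<sigma>) e"
      unfolding periodic_off_def
    proof (intro allI impI)
      fix x g assume "\<not> e dvd x" "e dvd g"
      then have "\<not> l dvd sum_int \<tau> * x" "l dvd sum_int \<tau> * g" using t unfolding e by simp_all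
      from per[OF this] show "indicator_of \<sigma> (x + g) = indicator_of \<sigma> x"
        unfolding distrib_left[symmetric] indicator_comp_circ_on[OF \<sigma>(1) \<tau>] .
    qed
  qed
qed

text \<open>Suppose \<open>f\<close> is constant with value \<open>c\<close> on the multiples of a cut \<open>g\<close> strictly below the first cut \<open>m\<close>. Then the
first factor \<open>\<alpha>\<close> has constant type \<open>c\<close>. Comparing \<open>g\<close> with the second cut \<open>k\<close> through their lcm \<open>l\<close> shows
that the second factor has constant type \<open>c\<close> as well, contrary to irreducibility: either \<open>g\<close> divides \<open>k\<close>, or
\<open>g\<close> and \<open>k\<close> are incomparable with lcm \<open>m\<close>, so that \<open>f\<close> is constant between them, or \<open>l\<close> is a proper cut of
the second factor.\<close>

lemma first_cut_extremal:
  assumes irr: "irreducible_list (\<alpha> # \<alpha>s)"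
    and f: "f = indicator_of (circ_list (\<alpha> # \<alpha>s))" and n: "n = sum_int (circ_list (\<alpha> # \<alpha>s))"
    and m: "m = sum_int (circ_list \<alpha>s)"
    and g: "periodic_off f g" "g dvd m" "g \<noteq> m" "g > 0"
    and const: "\<And>x. g dvd x \<Longrightarrow> \<not> n dvd x \<Longrightarrow> f x = c"
  shows False
proof -
  have "\<alpha>s \<noteq> []"
  proof
    assume "\<alpha>s = []"
    then have "g dvd 1" using g(2) m by simp
    then have "g = 1" using g(4) by simp
    then show False using g(3) m \<open>\<alpha>s = []\<close> by simp
  qed
  then obtain \<beta> \<beta>s where s: "\<alpha>s = \<beta> # \<beta>s" by (cases \<alpha>s) auto
  note irr = irr[unfolded s]
  have pos: "pos_composition \<alpha>" "pos_composition \<beta>" "only_trivial_factorizations \<beta>"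
    "\<not> trivial_pair \<alpha> \<beta>" "irreducible_list \<beta>s"
    using irr by (simp_all add: irreducible_list_Cons)
  have ne: "\<alpha> \<noteq> [1]" "\<beta> \<noteq> [1]" using irreducible_list_no_unit[OF irr] by simp_all
  define \<rho> where "\<rho> = circ_list \<beta>s"
  have \<rho>: "pos_composition \<rho>" unfolding \<rho>_def by (rule irreducible_list_pos[OF pos(5)])
  have c1: "circ_list \<alpha>s = \<beta> \<circ>\<^sub>c \<rho>" unfolding s \<rho>_def by (rule circ_list_Cons[OF pos(2)])
  have c2: "circ_list (\<alpha> # \<alpha>s) = \<alpha> \<circ>\<^sub>c (\<beta> \<circ>\<^sub>c \<rho>)" unfolding c1[symmetric] by (rule circ_list_Cons[OF pos(1)])
  have p1: "pos_composition (\<beta> \<circ>\<^sub>c \<rho>)" by (rule comp_circ_props(1)[OF pos(2) \<rho>])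
  define k where "k = sum_int \<rho>"
  have k0: "k > 0" unfolding k_def by (rule sum_int_pos[OF \<rho>])
  have m: "m = sum_int \<beta> * k" "m = sum_int (\<beta> \<circ>\<^sub>c \<rho>)"
    unfolding k_def using m c1 sum_int_comp_circ[OF pos(2) \<rho>] by simp_all
  have n: "n = sum_int \<alpha> * m" unfolding m(2) using n c2 sum_int_comp_circ[OF pos(1) p1] by simp
  have f: "f = indicator_of (\<alpha> \<circ>\<^sub>c (\<beta> \<circ>\<^sub>c \<rho>))" using f c2 by simp
  have m0: "m > 0" unfolding m(2) by (rule sum_int_pos[OF p1])
  have wa: "sum_int \<alpha> \<noteq> 1" "sum_int \<beta> \<noteq> 1" using sum_int_eq_1 pos ne by simp_all
  have nm: "\<not> n dvd m" using n wa(1) m0 sum_int_pos[OF pos(1)] by simp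
  have fm: "f x = indicator_of (\<beta> \<circ>\<^sub>c \<rho>) x" if "\<not> m dvd x" for x
    unfolding f by (rule indicator_comp_circ_off[OF pos(1) p1]) (use that m(2) in simp)
  have c01: "c \<in> {0, 1}" using const[OF g(2) nm] indicator_range unfolding f by metis
  have ca: "has_constant_type \<alpha> c"
  proof (rule constant_type_of_composite[OF pos(1) p1])
    fix x assume x: "sum_int (\<beta> \<circ>\<^sub>c \<rho>) dvd x" "\<not> sum_int (\<alpha> \<circ>\<^sub>c (\<beta> \<circ>\<^sub>c \<rho>)) dvd x"
    have "g dvd x" using g(2) x(1) m(2) dvd_trans by blast
    moreover have "\<not> n dvd x" using x(2) n m(2) sum_int_comp_circ[OF pos(1) p1] by simp
    ultimately show "indicator_of (\<alpha> \<circ>\<^sub>c (\<beta> \<circ>\<^sub>c \<rho>)) x = c" using const unfolding f by blast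
  qed
  have constm: "f x = c" if "g dvd x" "\<not> m dvd x" for x
    using const[OF that(1)] that(2) n dvd_mult_right by blast
  \<comment> \<open>it suffices to show that the second factor has the constant type \<open>c\<close> of the first\<close>
  have finish: False if cb: "\<And>x. k dvd x \<Longrightarrow> \<not> m dvd x \<Longrightarrow> f x = c"
  proof -
    have "has_constant_type \<beta> c"
    proof (rule constant_type_of_composite[OF pos(2) \<rho>])
      fix x assume x: "sum_int \<rho> dvd x" "\<not> sum_int (\<beta> \<circ>\<^sub>c \<rho>) dvd x"
      then have "f x = c" using cb m(2) k_def by simp
      then show "indicator_of (\<beta> \<circ>\<^sub>c \<rho>) x = c" using fm x(2) m(2) by simp
    qed
    then show False using ca c01 pos(4) trivial_pair_iff[OF pos(1,2)] by blast
  qed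
  have perk: "periodic_off f k"
    unfolding f k_def comp_circ_assoc[OF pos(1,2) \<rho>, symmetric]
    by (rule periodic_off_comp_circ[OF comp_circ_props(1)[OF pos(1,2)] \<rho>])
  have km: "k dvd m" using m(1) by simp
  have mk: "m \<noteq> k" using m(1) wa(2) k0 by simp
  have mg: "\<not> m dvd g" using g(2-4) m0 zdvd_antisym_nonneg[of m g] by auto
  define l where "l = lcm g k"
  have l: "g dvd l" "k dvd l" "l dvd m" using g(2) km by (simp_all add: l_def)
  have l0: "l > 0" unfolding l_def using g(4) k0 by (simp add: lcm_pos_int)
  have perl: "periodic_off f l" unfolding l_def by (rule periodic_off_lcm[OF g(1) perk])
  consider "l = k" | "l = m" "l \<noteq> k" | "l \<noteq> k" "l \<noteq> m" by blast
  then show False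
  proof cases
    case 1
    then have "g dvd k" using l(1) by simp
    then show False using finish constm dvd_trans by blast
  next
    case 2
    have "\<not> g dvd k" using 2(2) k0 unfolding l_def by (auto simp: lcm_proj2_if_dvd_int)
    moreover have "\<not> k dvd g" using 2(1) g(3,4) unfolding l_def by (auto simp: lcm_proj1_if_dvd_int)
    ultimately have cst: "f x = f (g + k)" if "gcd g k dvd x" "\<not> m dvd x" for x
      using constant_between_cuts[OF g(1) perk] that 2(1) unfolding l_def by blast
    have "f (g + k) = c" using cst[of g] mg constm[of g] by simp
    then show False using finish cst by (metis dvd_trans gcd_dvd2)
  next
    case 3
    have "\<exists>c. has_constant_type \<beta> c"
    proof (rule composite_cut_constant[OF pos(2,3) \<rho>])
      show "sum_int \<rho> dvd l" "l dvd sum_int (\<beta> \<circ>\<^sub>c \<rho>)" "l > 0" "l \<noteq> sum_int \<rho>" "l \<noteq> sum_int (\<beta> \<circ>\<^sub>c \<rho>)"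
        using l l0 3 m(2) k_def by simp_all
      fix x y assume xy: "\<not> l dvd x" "l dvd y"
      then have "\<not> l dvd x + y" by (simp add: dvd_add_left_iff)
      then have "\<not> m dvd x" "\<not> m dvd x + y" using l(3) xy(1) dvd_trans by blast+
      moreover have "f (x + y) = f x" using perl xy unfolding periodic_off_def by blast
      ultimately show "indicator_of (\<beta> \<circ>\<^sub>c \<rho>) (x + y) = indicator_of (\<beta> \<circ>\<^sub>c \<rho>) x"
        using fm[of x] fm[of "x + y"] by simp
    qed
    then obtain c' where c': "has_constant_type \<beta> c'" by blast
    have fc': "f x = c'" if x: "k dvd x" "\<not> m dvd x" for x
    proof -
      obtain y where y: "x = sum_int \<rho> * y" using x(1) k_def by blast
      have "\<not> sum_int \<beta> dvd y" using x(2) m(1) y k_def by (auto simp: mult.commute)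
      then have "indicator_of (\<beta> \<circ>\<^sub>c \<rho>) x = c'"
        using c' unfolding y indicator_comp_circ_on[OF pos(2) \<rho>] has_constant_type_def by blast
      then show ?thesis using fm x(2) by simp
    qed
    have "\<not> m dvd l" using l(3) l0 m0 3(2) zdvd_antisym_nonneg[of m l] by auto
    then have "c' = c" using fc'[OF l(2)] constm[OF l(1)] by simp
    then show False using finish fc' by blast
  qed
qed

lemma composite_constant_value:
  assumes "pos_composition \<sigma>" "pos_composition \<tau>" "has_constant_type \<sigma> c"
    "sum_int \<tau> dvd x" "\<not> sum_int (\<sigma> \<circ>\<^sub>c \<tau>) dvd x"
  shows "indicator_of (\<sigma> \<circ>\<^sub>c \<tau>) x = c"
proof -
  obtain y where y: "x = sum_int \<tau> * y" using assms(4) by blast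
  have "\<not> sum_int \<sigma> dvd y" using assms(5) sum_int_comp_circ[OF assms(1,2)] y by (auto simp: mult.commute)
  then show ?thesis
    using assms(3) unfolding y indicator_comp_circ_on[OF assms(1,2)] has_constant_type_def by blast
qed

text \<open>If the first cuts \<open>m\<close> and \<open>m'\<close> of two irreducible factorizations were different, \<open>f\<close> would be constant on the
multiples of their gcd: between the two cuts, and, by irreducibility of the first factors, also between
their lcm and \<open>n\<close>. This contradicts \<open>first_cut_extremal\<close>.\<close>

lemma first_cut_unique:
  assumes irr: "irreducible_list (\<alpha> # \<alpha>s)" "irreducible_list (\<beta> # \<beta>s)"
    and eq: "circ_list (\<alpha> # \<alpha>s) = circ_list (\<beta> # \<beta>s)"
  shows "sum_list (circ_list \<alpha>s) = sum_list (circ_list \<beta>s)"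
proof (rule ccontr)
  define \<rho> \<rho>' where "\<rho> = circ_list \<alpha>s" and "\<rho>' = circ_list \<beta>s"
  define f where "f = indicator_of (circ_list (\<alpha> # \<alpha>s))"
  define n where "n = sum_int (circ_list (\<alpha> # \<alpha>s))"
  define m m' where "m = sum_int \<rho>" and "m' = sum_int \<rho>'"
  assume "sum_list (circ_list \<alpha>s) \<noteq> sum_list (circ_list \<beta>s)"
  then have mm: "m \<noteq> m'" by (simp add: m_def m'_def \<rho>_def \<rho>'_def)
  have pos: "pos_composition \<alpha>" "only_trivial_factorizations \<alpha>" "pos_composition \<rho>"
    "pos_composition \<beta>" "only_trivial_factorizations \<beta>" "pos_composition \<rho>'"
    using irr irreducible_list_pos by (simp_all add: irreducible_list_Cons \<rho>_def \<rho>'_def)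
  have c: "circ_list (\<alpha> # \<alpha>s) = \<alpha> \<circ>\<^sub>c \<rho>" "circ_list (\<alpha> # \<alpha>s) = \<beta> \<circ>\<^sub>c \<rho>'"
    using circ_list_Cons[OF pos(1)] circ_list_Cons[OF pos(4)] eq by (simp_all add: \<rho>_def \<rho>'_def)
  have f: "f = indicator_of (\<alpha> \<circ>\<^sub>c \<rho>)" "f = indicator_of (\<beta> \<circ>\<^sub>c \<rho>')" using c by (simp_all add: f_def)
  have n: "n = sum_int (\<alpha> \<circ>\<^sub>c \<rho>)" "n = sum_int (\<beta> \<circ>\<^sub>c \<rho>')" using c by (simp_all add: n_def)
  have per: "periodic_off f m" "periodic_off f m'"
    using periodic_off_comp_circ[OF pos(1,3)] periodic_off_comp_circ[OF pos(4,6)] f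
    by (simp_all add: m_def m'_def)
  have p: "m > 0" "m' > 0" using sum_int_pos pos by (simp_all add: m_def m'_def)
  have n0: "n > 0" unfolding n(1) by (rule sum_int_pos[OF comp_circ_props(1)[OF pos(1,3)]])
  have d: "m dvd n" "m' dvd n"
    unfolding m_def m'_def
    by (simp add: n(1) sum_int_comp_circ[OF pos(1,3)], simp add: n(2) sum_int_comp_circ[OF pos(4,6)])
  define g where "g = gcd m m'"
  have g: "g dvd m" "g dvd m'" "g > 0" "periodic_off f g"
    using p periodic_off_gcd[OF per] by (simp_all add: g_def)
  have const_alpha: "\<exists>c. \<forall>x. m dvd x \<longrightarrow> \<not> n dvd x \<longrightarrow> f x = c"
    if l: "m dvd l" "l dvd n" "l > 0" "l \<noteq> m" "l \<noteq> n" "periodic_off f l" for l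
  proof -
    have "\<exists>c. has_constant_type \<alpha> c"
      by (rule composite_cut_constant[OF pos(1,2,3), of l])
        (use l in \<open>simp_all add: m_def n(1)[symmetric] f(1)[symmetric] periodic_off_def\<close>)
    then show ?thesis using composite_constant_value[OF pos(1,3)] unfolding f(1) n(1) m_def by blast
  qed
  have const_beta: "\<exists>c. \<forall>x. m' dvd x \<longrightarrow> \<not> n dvd x \<longrightarrow> f x = c"
    if l: "m' dvd l" "l dvd n" "l > 0" "l \<noteq> m'" "l \<noteq> n" "periodic_off f l" for l
  proof -
    have "\<exists>c. has_constant_type \<beta> c"
      by (rule composite_cut_constant[OF pos(4,5,6), of l])
        (use l in \<open>simp_all add: m'_def n(2)[symmetric] f(2)[symmetric] periodic_off_def\<close>)
    then show ?thesis using composite_constant_value[OF pos(4,6)] unfolding f(2) n(2) m'_def by blast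
  qed
  have unit: "\<alpha>s = [] \<or> m \<noteq> n" "\<beta>s = [] \<or> m' \<noteq> n"
  proof -
    have "m \<noteq> n" if "\<alpha>s \<noteq> []"
    proof -
      have "\<alpha> \<noteq> [1]" using irr(1) that irreducible_list_no_unit by (cases \<alpha>s) auto
      then show ?thesis
        using sum_int_eq_1[OF pos(1)] sum_int_comp_circ[OF pos(1,3)] n(1) p(1) by (simp add: m_def)
    qed
    then show "\<alpha>s = [] \<or> m \<noteq> n" by blast
    have "m' \<noteq> n" if "\<beta>s \<noteq> []"
    proof -
      have "\<beta> \<noteq> [1]" using irr(2) that irreducible_list_no_unit by (cases \<beta>s) auto
      then show ?thesis
        using sum_int_eq_1[OF pos(4)] sum_int_comp_circ[OF pos(4,6)] n(2) p(2) by (simp add: m'_def)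
    qed
    then show "\<beta>s = [] \<or> m' \<noteq> n" by blast
  qed
  have m1: "m \<noteq> 1 \<Longrightarrow> m \<noteq> n" "m' \<noteq> 1 \<Longrightarrow> m' \<noteq> n"
    using unit by (auto simp: m_def m'_def \<rho>_def \<rho>'_def)
  have const: "\<exists>c. \<forall>x. g dvd x \<longrightarrow> \<not> n dvd x \<longrightarrow> f x = c"
  proof -
    consider "m dvd m'" | "m' dvd m" | "\<not> m dvd m'" "\<not> m' dvd m" by blast
    then show ?thesis
    proof cases
      case 1
      then have "g = m" using p by (simp add: g_def gcd_proj1_if_dvd_int)
      moreover have "m' \<noteq> 1" using 1 mm p by auto
      ultimately show ?thesis using const_alpha[OF 1 d(2) p(2)] mm m1(2) per(2) by auto
    next
      case 2
      then have "g = m'" using p by (simp add: g_def gcd_proj2_if_dvd_int)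
      moreover have "m \<noteq> 1" using 2 mm p by auto
      ultimately show ?thesis using const_beta[OF 2 d(1) p(1)] mm m1(1) per(1) by auto
    next
      case 3
      define l where "l = lcm m m'"
      have ml: "m dvd l" "m' dvd l" by (simp_all add: l_def)
      have l: "m dvd l" "m' dvd l" "l dvd n" "l > 0" "l \<noteq> m" "l \<noteq> m'" "periodic_off f l"
        using d p 3 periodic_off_lcm[OF per] ml
        by (simp_all add: l_def lcm_pos_int) (metis dvd_lcm1 dvd_lcm2)+
      have gl: "f x = f (m + m')" if "g dvd x" "\<not> l dvd x" for x
        using constant_between_cuts[OF per 3] that unfolding g_def l_def by blast
      show ?thesis
      proof (cases "l = n")
        case True
        then show ?thesis using gl by blast
      next
        case False
        obtain c where c: "\<And>x. m dvd x \<Longrightarrow> \<not> n dvd x \<Longrightarrow> f x = c"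
          using const_alpha[OF l(1,3,4,5) False l(7)] by blast
        have nl: "\<not> l dvd m" using l(2) 3(2) dvd_trans by blast
        then have "\<not> n dvd m" using l(3) dvd_trans by blast
        then have "f (m + m') = c" using gl[OF g(1) nl] c[of m] by simp
        then have "f x = c" if "g dvd x" "\<not> n dvd x" for x
          using gl[OF that(1)] c[OF _ that(2)] l(1) dvd_trans[of m l x] by (cases "l dvd x") auto
        then show ?thesis by blast
      qed
    qed
  qed
  then obtain c where cst: "\<And>x. g dvd x \<Longrightarrow> \<not> n dvd x \<Longrightarrow> f x = c" by blast
  have "g \<noteq> m \<or> g \<noteq> m'" using mm by auto
  then show False
  proof
    assume "g \<noteq> m"
    then show False
      using first_cut_extremal[OF irr(1) f_def n_def _ g(4,1) _ g(3) cst] by (simp add: m_def \<rho>_def)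
  next
    assume "g \<noteq> m'"
    then show False
      using first_cut_extremal[OF irr(2) f_def[unfolded eq] n_def[unfolded eq] _ g(4,2) _ g(3) cst]
      by (simp add: m'_def \<rho>'_def)
  qed
qed

lemma comp_circ_cancel:
  assumes pos: "pos_composition \<sigma>" "pos_composition \<tau>" "pos_composition \<sigma>'" "pos_composition \<tau>'"
    and eq: "\<sigma> \<circ>\<^sub>c \<tau> = \<sigma>' \<circ>\<^sub>c \<tau>'" and sum: "sum_list \<tau> = sum_list \<tau>'"
  shows "\<sigma> = \<sigma>'" "\<tau> = \<tau>'"
proof -
  note w = comp_circ_props(2)[OF pos(1,2)] comp_circ_props(2)[OF pos(3,4)]
  have "sum_list \<sigma> * sum_list \<tau> = sum_list \<sigma>' * sum_list \<tau>'"
    by (rule trans[OF w(1)[symmetric] trans[OF arg_cong[OF eq, of sum_list] w(2)]])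
  then have "sum_list \<sigma> * sum_list \<tau> = sum_list \<sigma>' * sum_list \<tau>" by (simp only: sum)
  then have "sum_list \<sigma> = sum_list \<sigma>'" using pos_compositionD(3)[OF pos(2)] by simp
  moreover have "indicator_of \<sigma> = indicator_of \<sigma>'"
  proof
    fix x
    show "indicator_of \<sigma> x = indicator_of \<sigma>' x"
      using indicator_comp_circ_on[OF pos(1,2), of x] indicator_comp_circ_on[OF pos(3,4), of x] eq sum by simp
  qed
  ultimately show "\<sigma> = \<sigma>'" using indicator_of_inject[OF pos(1,3)] by blast
  have "indicator_of \<tau> = indicator_of \<tau>'"
  proof
    fix x
    show "indicator_of \<tau> x = indicator_of \<tau>' x"
    proof (cases "sum_int \<tau> dvd x")
      case True
      then show ?thesis using indicator_multiple[OF pos(2)] indicator_multiple[OF pos(4)] sum by simp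
    next
      case False
      then show ?thesis
        using indicator_comp_circ_off[OF pos(1,2), of x] indicator_comp_circ_off[OF pos(3,4), of x] eq sum by simp
    qed
  qed
  then show "\<tau> = \<tau>'" using indicator_of_inject[OF pos(2,4)] sum by blast
qed

theorem irreducible_list_unique:
  assumes "irreducible_list \<alpha>s" "irreducible_list \<beta>s" "\<alpha>s \<noteq> []" "\<beta>s \<noteq> []" "circ_list \<alpha>s = circ_list \<beta>s"
  shows "\<alpha>s = \<beta>s"
  using assms
proof (induction \<alpha>s arbitrary: \<beta>s)
  case (Cons \<alpha> \<alpha>s)
  obtain \<beta> \<beta>s' where b: "\<beta>s = \<beta> # \<beta>s'" using Cons.prems(4) by (cases \<beta>s) auto
  have irr: "irreducible_list \<alpha>s" "irreducible_list \<beta>s'" "pos_composition \<alpha>" "pos_composition \<beta>"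
    using Cons.prems(1,2) unfolding b irreducible_list_Cons by simp_all
  note p = irreducible_list_pos[OF irr(1)] irreducible_list_pos[OF irr(2)]
  have s: "sum_list (circ_list \<alpha>s) = sum_list (circ_list \<beta>s')"
    by (rule first_cut_unique) (use Cons.prems b in simp_all)
  have e: "\<alpha> \<circ>\<^sub>c circ_list \<alpha>s = \<beta> \<circ>\<^sub>c circ_list \<beta>s'"
    using Cons.prems(5) circ_list_Cons[OF irr(3)] circ_list_Cons[OF irr(4)] b by simp
  have ab: "\<alpha> = \<beta>" "circ_list \<alpha>s = circ_list \<beta>s'"
    using comp_circ_cancel[OF irr(3) p(1) irr(4) p(2) e s] by simp_all
  have no_unit: "circ_list (\<delta> # \<delta>s) \<noteq> [1]" if "irreducible_list (\<gamma> # \<delta> # \<delta>s)" for \<gamma> \<delta> \<delta>s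
  proof
    assume c: "circ_list (\<delta> # \<delta>s) = [1]"
    have d: "pos_composition \<delta>" "\<delta> \<noteq> [1]" "pos_composition (circ_list \<delta>s)"
      using that irreducible_list_no_unit[OF that] irreducible_list_pos by (simp_all add: irreducible_list_Cons)
    have "sum_list \<delta> * sum_list (circ_list \<delta>s) = 1"
      using comp_circ_props(2)[OF d(1,3)] c circ_list_Cons[OF d(1)] by simp
    then show False using sum_int_eq_1[OF d(1)] d(2) by simp
  qed
  show ?case
  proof (cases "\<alpha>s = [] \<or> \<beta>s' = []")
    case True
    have "\<alpha>s = [] \<and> \<beta>s' = []"
    proof (cases \<alpha>s)
      case Nil
      then have "circ_list \<beta>s' = [1]" using ab(2) by simp
      then show ?thesis using no_unit Cons.prems(2) Nil unfolding b by (cases \<beta>s') auto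
    next
      case (Cons \<delta> \<delta>s)
      then have "\<beta>s' = []" using True by simp
      then have "circ_list \<alpha>s = [1]" using ab(2) by simp
      then show ?thesis using no_unit Cons.prems(1) Cons by auto
    qed
    then show ?thesis using ab b by simp
  next
    case False
    then show ?thesis using Cons.IH[OF irr(1,2) _ _ ab(2)] ab(1) b by simp
  qed
qed simp

section \<open>Refining a factorization to the irreducible one\<close>

lemma rev_choice_sum:
  assumes "rev_choice \<beta>s \<gamma>s" "\<forall>\<beta>\<in>set \<beta>s. pos_composition \<beta>"
  shows "sum_list (circ_list \<gamma>s) = sum_list (circ_list \<beta>s)"
  by (rule coarsening_shapes_sum[OF coarsening_shapes_rev_choice[OF assms]])

text \<open>\<open>\<gamma>\<close> arises from the composition \<open>\<beta>\<close> by reversing some factors of an irreducible factorization.\<close>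

definition refines_choice :: "nat list \<Rightarrow> nat list \<Rightarrow> bool" where
  "refines_choice \<beta> \<gamma> \<longleftrightarrow> (\<exists>bs cs. bs \<noteq> [] \<and> irreducible_list bs \<and> rev_choice bs cs \<and>
     \<beta> = circ_list bs \<and> \<gamma> = circ_list cs)"

lemma irreducible_list_unit_only:
  assumes "irreducible_list \<alpha>s" "circ_list \<alpha>s \<noteq> [1]" shows "[1] \<notin> set \<alpha>s"
proof
  assume "[1] \<in> set \<alpha>s"
  then obtain xs ys where s: "\<alpha>s = xs @ [1] # ys" by (meson split_list)
  show False
  proof (cases "xs = [] \<and> ys = []")
    case True
    then show False using assms(2) s by simp
  next
    case False
    have "successively (\<lambda>\<alpha> \<beta>. \<not> trivial_pair \<alpha> \<beta>) \<alpha>s" using assms(1) by (simp add: irreducible_list_def)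
    then show False
      using False unfolding s successively_append_iff successively_Cons by (auto simp: trivial_pair_def)
  qed
qed

text \<open>Concatenate the irreducible factorizations. If the two factors that meet form a trivial pair, replace them by
their product: it has the same constant type, so that it is irreducible and symmetric and forms no
trivial pair with its neighbours.\<close>

lemma refines_choice_comp_circ:
  assumes "refines_choice \<beta> \<beta>'" "refines_choice \<gamma> \<gamma>'"
  shows "refines_choice (\<beta> \<circ>\<^sub>c \<gamma>) (\<beta>' \<circ>\<^sub>c \<gamma>')"
proof -
  obtain bs bs' where b: "bs \<noteq> []" "irreducible_list bs" "rev_choice bs bs'" "\<beta> = circ_list bs" "\<beta>' = circ_list bs'"
    using assms(1) unfolding refines_choice_def by blast
  obtain cs cs' where c: "cs \<noteq> []" "irreducible_list cs" "rev_choice cs cs'" "\<gamma> = circ_list cs" "\<gamma>' = circ_list cs'"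
    using assms(2) unfolding refines_choice_def by blast
  have pb: "\<forall>\<alpha>\<in>set bs. pos_composition \<alpha>" and pc: "\<forall>\<alpha>\<in>set cs. pos_composition \<alpha>"
    using b(2) c(2) by (auto simp: irreducible_list_def)
  note pb' = rev_choice_pos[OF b(3) pb] and pc' = rev_choice_pos[OF c(3) pc]
  have p: "pos_composition \<beta>" "pos_composition \<gamma>" "pos_composition \<beta>'" "pos_composition \<gamma>'"
    unfolding b(4,5) c(4,5) using circ_list_pos pb pc pb' pc' by simp_all
  have s: "sum_list \<beta>' = sum_list \<beta>" "sum_list \<gamma>' = sum_list \<gamma>"
    unfolding b(4,5) c(4,5) by (rule rev_choice_sum[OF b(3) pb], rule rev_choice_sum[OF c(3) pc])
  consider "\<beta> = [1]" | "\<gamma> = [1]" | "\<beta> \<noteq> [1]" "\<gamma> \<noteq> [1]" by blast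
  then show ?thesis
  proof cases
    case 1
    then have "\<beta>' = [1]" using s(1) sum_int_eq_1[OF p(3)] by simp
    then show ?thesis using assms(2) 1 comp_circ_one(2) by (simp only:)
  next
    case 2
    then have "\<gamma>' = [1]" using s(2) sum_int_eq_1[OF p(4)] by simp
    then show ?thesis using assms(1) 2 comp_circ_one(1) p(1,3) by metis
  next
    case 3
    have no1: "[1] \<notin> set bs" "[1] \<notin> set cs"
      using irreducible_list_unit_only[OF b(2)] irreducible_list_unit_only[OF c(2)] 3 b(4) c(4) by simp_all
    obtain xs x where bx: "bs = xs @ [x]" using b(1) by (metis append_butlast_last_id)
    obtain y ys where cy: "cs = y # ys" using c(1) by (cases cs) auto
    obtain xs' x' where bx': "bs' = xs' @ [x']" "rev_choice xs xs'" "x' = x \<or> x' = rev x"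
      using b(3) unfolding bx by (auto simp: list_all2_append1 list_all2_Cons1)
    obtain y' ys' where cy': "cs' = y' # ys'" "rev_choice ys ys'" "y' = y \<or> y' = rev y"
      using c(3) unfolding cy by (auto simp: list_all2_Cons1)
    have px: "pos_composition x" "pos_composition y" "x \<noteq> [1]" "y \<noteq> [1]"
      "pos_composition x'" "pos_composition y'"
      using pb pc no1 bx'(3) cy'(3) unfolding bx cy by auto
    have sb: "successively (\<lambda>\<alpha> \<beta>. \<not> trivial_pair \<alpha> \<beta>) (xs @ [x])"
      and sc: "successively (\<lambda>\<alpha> \<beta>. \<not> trivial_pair \<alpha> \<beta>) (y # ys)"
      using b(2) c(2) unfolding irreducible_list_def bx cy by simp_all
    show ?thesis
    proof (cases "trivial_pair x y")
      case False
      have "irreducible_list (bs @ cs)"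
        using b(2) c(2) False unfolding irreducible_list_def bx cy
        by (auto simp: successively_append_iff)
      moreover have "rev_choice (bs @ cs) (bs' @ cs')" using b(3) c(3) by (rule list_all2_appendI)
      moreover have "\<beta> \<circ>\<^sub>c \<gamma> = circ_list (bs @ cs)" "\<beta>' \<circ>\<^sub>c \<gamma>' = circ_list (bs' @ cs')"
        unfolding b(4,5) c(4,5) using pb pc pb' pc' by (subst circ_list_append; auto)+
      ultimately show ?thesis unfolding refines_choice_def using b(1) by blast
    next
      case True
      then obtain t where t: "t \<in> {0, 1}" "has_constant_type x t" "has_constant_type y t"
        using trivial_pair_iff[OF px(1,2)] px(3,4) by blast
      define z where "z = x \<circ>\<^sub>c y"
      have pz: "pos_composition z" unfolding z_def by (rule comp_circ_props(1)[OF px(1,2)])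
      have tz: "has_constant_type z t" unfolding z_def by (rule constant_type_comp_circ[OF px(1,2) t(2,3)])
      have z1: "z \<noteq> [1]"
      proof
        assume "z = [1]"
        then have "sum_list x * sum_list y = 1" using comp_circ_props(2)[OF px(1,2)] z_def by simp
        then show False using sum_int_eq_1[OF px(1)] px(3) by simp
      qed
      have x': "x' = x" "y' = y" using bx'(3) cy'(3) constant_type_rev px(1,2) t by auto
      have left: "\<not> trivial_pair w z" if w: "pos_composition w" "w \<noteq> [1]" "\<not> trivial_pair w x" for w
      proof
        assume "trivial_pair w z"
        then obtain t' where "t' \<in> {0, 1}" "has_constant_type w t'" "has_constant_type z t'"
          using trivial_pair_iff[OF w(1) pz] w(2) z1 by blast
        moreover from this have "t' = t" using constant_type_unique[OF pz z1 _ tz] by blast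
        ultimately show False using w(3) t(2) trivial_pair_iff[OF w(1) px(1)] by blast
      qed
      have right: "\<not> trivial_pair z w" if w: "pos_composition w" "w \<noteq> [1]" "\<not> trivial_pair y w" for w
      proof
        assume "trivial_pair z w"
        then obtain t' where "t' \<in> {0, 1}" "has_constant_type w t'" "has_constant_type z t'"
          using trivial_pair_iff[OF pz w(1)] w(2) z1 by blast
        moreover from this have "t' = t" using constant_type_unique[OF pz z1 _ tz] by blast
        ultimately show False using w(3) t(3) trivial_pair_iff[OF px(2) w(1)] by blast
      qed
      have l: "xs = [] \<or> \<not> trivial_pair (last xs) z"
      proof (cases "xs = []")
        case False
        then have m: "last xs \<in> set xs" by simp
        then have "last xs \<noteq> [1]" "pos_composition (last xs)" using no1(1) pb unfolding bx by auto
        moreover have "\<not> trivial_pair (last xs) x" using sb False by (simp add: successively_append_iff)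
        ultimately show ?thesis using left by blast
      qed simp
      have r: "ys = [] \<or> \<not> trivial_pair z (hd ys)"
      proof (cases "ys = []")
        case False
        then have m: "hd ys \<in> set ys" by simp
        then have "hd ys \<noteq> [1]" "pos_composition (hd ys)" using no1(2) pc unfolding cy by auto
        moreover have "\<not> trivial_pair y (hd ys)" using sc False by (simp add: successively_Cons)
        ultimately show ?thesis using right by blast
      qed simp
      have "irreducible_list (xs @ z # ys)"
        using b(2) c(2) l r pz constant_type_only_trivial[OF tz t(1)] sb sc
        unfolding irreducible_list_def bx cy successively_append_iff successively_Cons by auto
      moreover have "rev_choice (xs @ z # ys) (xs' @ z # ys')"
        using bx'(2) cy'(2) by (intro list_all2_appendI) simp_all
      moreover have merge: "circ_list (us @ z # vs) = circ_list (us @ [x]) \<circ>\<^sub>c circ_list (y # vs)"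
        if "\<forall>\<alpha>\<in>set us \<union> set vs. pos_composition \<alpha>" for us vs
      proof -
        have pu: "\<forall>\<alpha>\<in>set us. pos_composition \<alpha>" "\<forall>\<alpha>\<in>set vs. pos_composition \<alpha>" using that by auto
        note pu' = circ_list_pos[OF pu(1)] circ_list_pos[OF pu(2)]
        have "circ_list (us @ z # vs) = circ_list us \<circ>\<^sub>c (z \<circ>\<^sub>c circ_list vs)"
          using that pz by (subst circ_list_append) (auto simp: circ_list_Cons)
        also have "\<dots> = circ_list us \<circ>\<^sub>c (x \<circ>\<^sub>c (y \<circ>\<^sub>c circ_list vs))"
          unfolding z_def comp_circ_assoc[OF px(1,2) pu'(2)] ..
        also have "\<dots> = (circ_list us \<circ>\<^sub>c x) \<circ>\<^sub>c (y \<circ>\<^sub>c circ_list vs)"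
          by (rule comp_circ_assoc[symmetric, OF pu'(1) px(1) comp_circ_props(1)[OF px(2) pu'(2)]])
        also have "\<dots> = circ_list (us @ [x]) \<circ>\<^sub>c circ_list (y # vs)"
          using pu px by (subst circ_list_append) (auto simp: circ_list_Cons)
        finally show ?thesis .
      qed
      have "\<beta> \<circ>\<^sub>c \<gamma> = circ_list (xs @ z # ys)"
        unfolding b(4) c(4) bx cy using pb pc unfolding bx cy by (intro merge[symmetric]) auto
      moreover have "\<beta>' \<circ>\<^sub>c \<gamma>' = circ_list (xs' @ z # ys')"
        unfolding b(5) c(5) bx'(1) cy'(1) x' using pb' pc' unfolding bx'(1) cy'(1)
        by (intro merge[symmetric]) auto
      ultimately show ?thesis unfolding refines_choice_def by blast
    qed
  qed
qed

lemma refines_choice_refl: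
  assumes "pos_composition \<beta>" shows "refines_choice \<beta> \<beta>"
  using assms
proof (induction "sum_list \<beta>" arbitrary: \<beta> rule: less_induct)
  case less
  show ?case
  proof (cases "only_trivial_factorizations \<beta>")
    case True
    then have "irreducible_list [\<beta>]" using less.prems by (simp add: irreducible_list_def)
    then show ?thesis unfolding refines_choice_def by (intro exI[of _ "[\<beta>]"]) simp
  next
    case False
    then obtain \<sigma> \<tau> where st: "pos_composition \<sigma>" "pos_composition \<tau>" "\<beta> = \<sigma> \<circ>\<^sub>c \<tau>" "\<not> trivial_pair \<sigma> \<tau>"
      unfolding only_trivial_factorizations_def by blast
    then have "\<sigma> \<noteq> [1]" "\<tau> \<noteq> [1]" by (auto simp: trivial_pair_def)
    then have "sum_list \<sigma> > 1" "sum_list \<tau> > 1"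
      using sum_int_eq_1[OF st(1)] sum_int_eq_1[OF st(2)] pos_compositionD(3)[OF st(1)] pos_compositionD(3)[OF st(2)]
      by linarith+
    then have "sum_list \<sigma> < sum_list \<beta>" "sum_list \<tau> < sum_list \<beta>"
      unfolding st(3) comp_circ_props(2)[OF st(1,2)] by simp_all
    then show ?thesis
      using refines_choice_comp_circ[OF less.hyps[OF _ st(1)] less.hyps[OF _ st(2)]] st(3) by simp
  qed
qed

lemma refines_choice_rev:
  assumes "pos_composition \<beta>" shows "refines_choice \<beta> (rev \<beta>)"
proof -
  obtain bs cs where b: "bs \<noteq> []" "irreducible_list bs" "\<beta> = circ_list bs"
    using refines_choice_refl[OF assms] unfolding refines_choice_def by blast
  have "rev_choice bs (map rev bs)" by (simp add: list.rel_map list.rel_refl_strong)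
  moreover have "rev \<beta> = circ_list (map rev bs)"
    unfolding b(3) using b(2) by (intro rev_circ_list) (simp add: irreducible_list_def)
  ultimately show ?thesis unfolding refines_choice_def using b by blast
qed

text \<open>Hence it does not matter whether arbitrary or irreducible factors are reversed.\<close>

lemma refines_choice_circ_list:
  assumes "rev_choice \<beta>s \<gamma>s" "\<forall>\<beta>\<in>set \<beta>s. pos_composition \<beta>"
  shows "refines_choice (circ_list \<beta>s) (circ_list \<gamma>s)"
  using assms
proof (induction rule: list_all2_induct)
  case Nil
  show ?case using refines_choice_refl[of "[1]"] by simp
next
  case (Cons b bs c cs)
  have pb: "pos_composition b" "pos_composition c" using Cons.prems Cons.hyps by auto
  have "refines_choice b c" using Cons.hyps refines_choice_refl[OF pb(1)] refines_choice_rev[OF pb(1)] by blast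
  then show ?case
    using refines_choice_comp_circ Cons.IH Cons.prems circ_list_Cons[OF pb(1)] circ_list_Cons[OF pb(2)] by simp
qed

section \<open>The size of an equivalence class\<close>

lemma rev_choice_irreducible_list:
  assumes "rev_choice bs cs" "irreducible_list bs" shows "irreducible_list cs"
  using assms
proof (induction rule: list_all2_induct)
  case (Cons b bs c cs)
  have b: "pos_composition b" "only_trivial_factorizations b" "irreducible_list bs"
    "bs = [] \<or> \<not> trivial_pair b (hd bs)"
    using Cons.prems by (simp_all add: irreducible_list_Cons)
  have "only_trivial_factorizations (rev b)"
    unfolding only_trivial_factorizations_def
  proof (intro allI impI)
    fix \<sigma> \<tau> assume st: "pos_composition \<sigma> \<and> pos_composition \<tau> \<and> rev b = \<sigma> \<circ>\<^sub>c \<tau>"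
    then have "b = rev \<sigma> \<circ>\<^sub>c rev \<tau>" using rev_comp_circ[of \<sigma> \<tau>] by (metis rev_rev_ident)
    then have "trivial_pair (rev \<sigma>) (rev \<tau>)"
      using b(2) st unfolding only_trivial_factorizations_def by simp
    then show "trivial_pair \<sigma> \<tau>" by (simp add: trivial_pair_def)
  qed
  then have "pos_composition c" "only_trivial_factorizations c" using Cons.hyps(1) b by auto
  moreover have "cs = [] \<or> \<not> trivial_pair c (hd cs)"
  proof (cases bs)
    case Nil
    then show ?thesis using Cons.hyps(2) by simp
  next
    case (Cons b' bs')
    then obtain c' cs' where "cs = c' # cs'" "c' = b' \<or> c' = rev b'"
      using Cons.hyps(2) by (auto simp: list_all2_Cons1)
    moreover have "\<not> trivial_pair b b'" using b(4) Cons by simp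
    ultimately show ?thesis using Cons.hyps(1) by (auto simp: trivial_pair_def)
  qed
  ultimately show ?case using Cons.IH[OF b(3)] by (simp add: irreducible_list_Cons)
qed simp

lemma card_rev_choice:
  "finite {cs. rev_choice bs cs} \<and> card {cs. rev_choice bs cs} = 2 ^ length (filter (\<lambda>\<beta>. \<beta> \<noteq> rev \<beta>) bs)"
proof (induction bs)
  case Nil
  have "{cs. rev_choice [] cs} = {[]}" by auto
  then show ?case by simp
next
  case (Cons b bs)
  have eq: "{cs. rev_choice (b # bs) cs} = (\<lambda>(x, y). x # y) ` ({b, rev b} \<times> {cs. rev_choice bs cs})"
    by (auto simp: list_all2_Cons1)
  have "card {cs. rev_choice (b # bs) cs} = card ({b, rev b} \<times> {cs. rev_choice bs cs})"
    unfolding eq by (rule card_image) (auto simp: inj_on_def)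
  moreover have "card {b, rev b} = (if b \<noteq> rev b then 2 else 1)" by auto
  ultimately show ?case using Cons by (auto simp: eq card_cartesian_product)
qed

theorem theorem4p1:
  fixes \<beta> :: "nat list"
  assumes "pos_composition \<beta>"
  shows "(\<forall>\<gamma>. pos_composition \<gamma> \<longrightarrow>
      (\<beta> \<sim>\<^sub>c \<gamma> \<longleftrightarrow>
        (\<exists>k\<ge>1. \<exists>\<beta>s \<gamma>s. length \<beta>s = k \<and> length \<gamma>s = k \<and>
           (\<forall>i<k. pos_composition (\<beta>s ! i) \<and> pos_composition (\<gamma>s ! i)) \<and>
           \<beta> = circ_list \<beta>s \<and> \<gamma> = circ_list \<gamma>s \<and>
           (\<forall>i<k. \<gamma>s ! i = \<beta>s ! i \<or> \<gamma>s ! i = rev (\<beta>s ! i)))))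
    \<and> card {\<gamma>. composition \<gamma> \<and> \<beta> \<sim>\<^sub>c \<gamma>} = 2 ^ num_nonsymmetric_factors \<beta>"
proof
  have factors: "\<exists>\<beta>s \<gamma>s. \<beta>s \<noteq> [] \<and> (\<forall>\<alpha>\<in>set \<beta>s. pos_composition \<alpha>) \<and>
      \<beta> = circ_list \<beta>s \<and> \<gamma> = circ_list \<gamma>s \<and> rev_choice \<beta>s \<gamma>s"
    if \<gamma>: "pos_composition \<gamma>" and equiv: "\<beta> \<sim>\<^sub>c \<gamma>" for \<gamma>
  proof -
    note cb = pos_compositionD(2)[OF assms] and cg = pos_compositionD(2)[OF \<gamma>]
    have s: "coarsening_shapes \<beta> = coarsening_shapes \<gamma>"
      using equiv comp_equiv_iff_coarsening_shapes[OF cb cg] by simp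
    have "coarsening_shapes \<beta> = coarsening_shapes (rev \<gamma>)" using s coarsening_shapes_rev[OF cg] by simp
    moreover have "composition (rev \<gamma>)" using cg by simp
    ultimately show ?thesis
      using rev_choice_of_same_path_sums[OF assms \<gamma> coarsening_shapes_sum[OF s]
          same_path_sums_of_shapes[OF cb cg s] same_path_sums_of_shapes[OF cb]] by blast
  qed
  have equiv: "\<beta> \<sim>\<^sub>c circ_list \<gamma>s"
    if "\<beta> = circ_list \<beta>s" "rev_choice \<beta>s \<gamma>s" "\<forall>\<alpha>\<in>set \<beta>s. pos_composition \<alpha>" for \<beta>s \<gamma>s
  proof -
    have "pos_composition (circ_list \<gamma>s)" by (rule circ_list_pos[OF rev_choice_pos[OF that(2,3)]])
    then show ?thesis
      using comp_equiv_iff_coarsening_shapes[of \<beta> "circ_list \<gamma>s"] pos_compositionD(2) assms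
        coarsening_shapes_rev_choice[OF that(2,3)] that(1) by simp
  qed
  show "\<forall>\<gamma>. pos_composition \<gamma> \<longrightarrow>
      (\<beta> \<sim>\<^sub>c \<gamma> \<longleftrightarrow>
        (\<exists>k\<ge>1. \<exists>\<beta>s \<gamma>s. length \<beta>s = k \<and> length \<gamma>s = k \<and>
           (\<forall>i<k. pos_composition (\<beta>s ! i) \<and> pos_composition (\<gamma>s ! i)) \<and>
           \<beta> = circ_list \<beta>s \<and> \<gamma> = circ_list \<gamma>s \<and>
           (\<forall>i<k. \<gamma>s ! i = \<beta>s ! i \<or> \<gamma>s ! i = rev (\<beta>s ! i))))"
  proof (intro allI impI iffI)
    fix \<gamma> assume \<gamma>: "pos_composition \<gamma>" and "\<beta> \<sim>\<^sub>c \<gamma>"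
    then obtain \<beta>s \<gamma>s where s: "\<beta>s \<noteq> []" "\<forall>\<alpha>\<in>set \<beta>s. pos_composition \<alpha>"
      "\<beta> = circ_list \<beta>s" "\<gamma> = circ_list \<gamma>s" "rev_choice \<beta>s \<gamma>s"
      using factors by blast
    have len: "length \<gamma>s = length \<beta>s" using list_all2_lengthD[OF s(5)] by simp
    have nth: "\<forall>i<length \<beta>s. \<gamma>s ! i = \<beta>s ! i \<or> \<gamma>s ! i = rev (\<beta>s ! i)" using list_all2_nthD[OF s(5)] by blast
    have "\<forall>i<length \<beta>s. pos_composition (\<beta>s ! i) \<and> pos_composition (\<gamma>s ! i)"
      using s(2) rev_choice_pos[OF s(5,2)] len by simp
    moreover have "length \<beta>s \<ge> 1" using s(1) by (simp add: Suc_le_eq)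
    ultimately show "\<exists>k\<ge>1. \<exists>\<beta>s \<gamma>s. length \<beta>s = k \<and> length \<gamma>s = k \<and>
           (\<forall>i<k. pos_composition (\<beta>s ! i) \<and> pos_composition (\<gamma>s ! i)) \<and>
           \<beta> = circ_list \<beta>s \<and> \<gamma> = circ_list \<gamma>s \<and>
           (\<forall>i<k. \<gamma>s ! i = \<beta>s ! i \<or> \<gamma>s ! i = rev (\<beta>s ! i))"
      using len nth s(3,4) by blast
  next
    fix \<gamma> assume "\<exists>k\<ge>1. \<exists>\<beta>s \<gamma>s. length \<beta>s = k \<and> length \<gamma>s = k \<and>
           (\<forall>i<k. pos_composition (\<beta>s ! i) \<and> pos_composition (\<gamma>s ! i)) \<and>
           \<beta> = circ_list \<beta>s \<and> \<gamma> = circ_list \<gamma>s \<and>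
           (\<forall>i<k. \<gamma>s ! i = \<beta>s ! i \<or> \<gamma>s ! i = rev (\<beta>s ! i))"
    then obtain \<beta>s \<gamma>s where s: "length \<gamma>s = length \<beta>s" "\<forall>i<length \<beta>s. pos_composition (\<beta>s ! i)"
      "\<beta> = circ_list \<beta>s" "\<gamma> = circ_list \<gamma>s" "\<forall>i<length \<beta>s. \<gamma>s ! i = \<beta>s ! i \<or> \<gamma>s ! i = rev (\<beta>s ! i)"
      by blast
    have "rev_choice \<beta>s \<gamma>s" using s(1,5) by (simp add: list_all2_conv_all_nth)
    moreover have "\<forall>\<alpha>\<in>set \<beta>s. pos_composition \<alpha>" using s(2) by (simp add: all_set_conv_all_nth)
    ultimately show "\<beta> \<sim>\<^sub>c \<gamma>" using equiv s(3,4) by blast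
  qed
  obtain bs where bs: "bs \<noteq> []" "irreducible_list bs" "\<beta> = circ_list bs"
    using refines_choice_refl[OF assms] unfolding refines_choice_def by blast
  have pbs: "\<forall>\<alpha>\<in>set bs. pos_composition \<alpha>" using bs(2) by (simp add: irreducible_list_def)
  have fact: "irreducible_factorization \<beta> = bs"
    unfolding irreducible_factorization_def is_irreducible_factorization_iff
  proof (rule the_equality)
    show "bs \<noteq> [] \<and> irreducible_list bs \<and> \<beta> = circ_list bs" using bs by blast
    fix \<alpha>s assume a: "\<alpha>s \<noteq> [] \<and> irreducible_list \<alpha>s \<and> \<beta> = circ_list \<alpha>s"
    then have "circ_list \<alpha>s = circ_list bs" using bs(3) by (metis (no_types))
    then show "\<alpha>s = bs" using irreducible_list_unique[of \<alpha>s bs] a bs(1,2) by blast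
  qed
  have cls: "{\<gamma>. composition \<gamma> \<and> \<beta> \<sim>\<^sub>c \<gamma>} = circ_list ` {cs. rev_choice bs cs}"
  proof (intro equalityI subsetI)
    fix \<gamma> assume "\<gamma> \<in> {\<gamma>. composition \<gamma> \<and> \<beta> \<sim>\<^sub>c \<gamma>}"
    then have \<gamma>: "composition \<gamma>" "\<beta> \<sim>\<^sub>c \<gamma>" by simp_all
    have "coarsening_shapes \<beta> = coarsening_shapes \<gamma>"
      using comp_equiv_iff_coarsening_shapes[OF pos_compositionD(2)[OF assms] \<gamma>(1)] \<gamma>(2) by blast
    then have "sum_list \<beta> = sum_list \<gamma>" by (rule coarsening_shapes_sum)
    then have p\<gamma>: "pos_composition \<gamma>"
      using \<gamma>(1) pos_compositionD(3)[OF assms] by (auto simp: pos_composition_def)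
    obtain \<beta>s \<gamma>s where s: "\<forall>\<alpha>\<in>set \<beta>s. pos_composition \<alpha>"
      "\<beta> = circ_list \<beta>s" "\<gamma> = circ_list \<gamma>s" "rev_choice \<beta>s \<gamma>s"
      using factors[OF p\<gamma> \<gamma>(2)] by blast
    have "refines_choice \<beta> \<gamma>" unfolding s(2,3) by (rule refines_choice_circ_list[OF s(4,1)])
    then obtain ds cs where d: "ds \<noteq> []" "irreducible_list ds" "rev_choice ds cs" "\<beta> = circ_list ds" "\<gamma> = circ_list cs"
      unfolding refines_choice_def by blast
    have "ds = bs" by (rule irreducible_list_unique[OF d(2) bs(2) d(1) bs(1)]) (rule trans[OF d(4)[symmetric] bs(3)])
    then show "\<gamma> \<in> circ_list ` {cs. rev_choice bs cs}" using d(3,5) by blast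
  next
    fix \<gamma> assume "\<gamma> \<in> circ_list ` {cs. rev_choice bs cs}"
    then obtain cs where cs: "rev_choice bs cs" "\<gamma> = circ_list cs" by blast
    have "composition \<gamma>"
      unfolding cs(2) by (rule pos_compositionD(2)[OF circ_list_pos[OF rev_choice_pos[OF cs(1) pbs]]])
    then show "\<gamma> \<in> {\<gamma>. composition \<gamma> \<and> \<beta> \<sim>\<^sub>c \<gamma>}" using equiv[OF bs(3) cs(1) pbs] cs(2) by simp
  qed
  have "inj_on circ_list {cs. rev_choice bs cs}"
  proof (rule inj_onI)
    fix cs ds assume c: "cs \<in> {cs. rev_choice bs cs}" "ds \<in> {cs. rev_choice bs cs}" "circ_list cs = circ_list ds"
    then have r: "rev_choice bs cs" "rev_choice bs ds" by simp_all
    have "cs \<noteq> []" "ds \<noteq> []" using r bs(1) by auto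
    then show "cs = ds"
      using irreducible_list_unique[OF rev_choice_irreducible_list[OF r(1) bs(2)]
          rev_choice_irreducible_list[OF r(2) bs(2)]] c(3) by blast
  qed
  then show "card {\<gamma>. composition \<gamma> \<and> \<beta> \<sim>\<^sub>c \<gamma>} = 2 ^ num_nonsymmetric_factors \<beta>"
    unfolding cls num_nonsymmetric_factors_def fact using card_rev_choice[of bs] by (simp add: card_image)
qed

end
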